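(* Let $\Delta\in\mathbb Z$ be a non-square with $\Delta\equiv 0$ or $1\bmod 4$, let $K=\mathbb Q(\sqrt\Delta)$ with discriminant $\mathsf d_K$, and let $m\in\mathbb N$ with $\Delta=\mathsf d_Km^2$. Let $\mathfrak F_\Delta$ be the (additively written) composition class group of not negative definite primitive integral binary quadratic forms of discriminant $\Delta$, and let $\mathbb P_m'$, $R_m'(\Delta)$, $R_m^{\prime\circ}(\Delta)$, the classes $F_p\in\mathfrak F_\Delta$, and $\vartheta'\colon R_m'(\Delta)\to\mathcal F(\mathfrak F_\Delta)$, $\vartheta'(n)=\prod_{p\in\mathbb P_m'}F_p^{\mathsf v_p(n)}$, be as defined in the context. Then: 1. For every $n\in R_m'(\Delta)$: $n\in R_m^{\prime\circ}(\Delta)$ if and only if $\vartheta'(n)\in\mathcal B_\pm(\mathfrak F_\Delta)$. 2. $\vartheta_0'=\vartheta'|_{R_m^{\prime\circ}(\Delta)}\colon R_m^{\prime\circ}(\Delta)\to\mathcal B_\pm(\mathfrak F_\Delta)$ is a transfer homomorphism satisfying $\mathsf c(R_m^{\prime\circ}(\Delta),\vartheta_0')\le 2$.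
   Context: **Forms.** For $a,b,c\in\mathbb Z$ with $\gcd(a,b,c)=1$ and $\Delta=b^2-4ac$, the form $aX^2+bXY+cY^2$, if not negative definite, has a class $[\![a,b,c]\!]\in\mathfrak F_\Delta$ under proper equivalence; $\mathfrak F_\Delta$ is a finite abelian group under Gauss composition. Write $\Delta=4D+s$ with $D\in\mathbb Z$, $s\in\{0,1\}$. The zero element is the principal class $O=[\![1,s,-D]\!]$, and $-[\![a,b,c]\!]=[\![a,-b,c]\!]$. A class $F$ represents $n$ if some (equivalently every) form $f\in F$ satisfies $n=f(x,y)$ for some $x,y\in\mathbb Z$. $\mathbb P_m$ is the set of primes not dividing $m$ and $\mathbb N_m$ the set of positive integers coprime to $m$. $R_m(\Delta)$ is the set of $n\in\mathbb N_m$ represented by some class $F\in\mathfrak F_\Delta$, and $R_m^\circ(\Delta)$ the set of $n\in R_m(\Delta)$ represented by $O$. $\mathsf v_p$ is the $p$-adic exponent and $f_p$ the inertia degree of $p$ in $K$. Set $\mathbb P_m'=\{p\in\mathbb P_m:f_p=1\}$, let $\mathbb N_m'$ be the monoid of positive integers all of whose prime divisors lie in $\mathbb P_m'$, and put $R_m'(\Delta)=R_m(\Delta)\cap\mathbb N_m'$, $R_m^{\prime\circ}(\Delta)=R_m^\circ(\Delta)\cap\mathbb N_m'$. **Ideal classes.** $\mathcal O_\Delta=\mathbb Z[\frac{s+\sqrt\Delta}{2}]$ is the order of discriminant $\Delta$ (with conductor $m\mathcal O_K$). $\mathcal C^+(\mathcal O_\Delta)$ is the narrow class group: invertible fractional ideals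 modulo principal fractional ideals $a\mathcal O_\Delta$ with $a\in K^\times$ totally positive (positive under all real embeddings); it is written additively and $[\mathfrak a]^+$ is the class of $\mathfrak a$. There is an isomorphism $\Phi_\Delta\colon\mathfrak F_\Delta\to\mathcal C^+(\mathcal O_\Delta)$ with $\Phi_\Delta([\![a,b,c]\!])=\bigl[\bigl(a,\tfrac{b+\sqrt\Delta}{2}\bigr)\bigr]^+$ for $a>0$. For every $p\in\mathbb P_m$ fix a prime ideal $\mathfrak p_p$ of $\mathcal O_\Delta$ lying above $p$ such that $\mathcal C^+(\mathcal O_\Delta)=\{[\mathfrak p_p]^+:p\in\mathbb P_m'\}$ (possible, since each class contains infinitely many prime ideals of degree 1), and set $F_p=\Phi_\Delta^{-1}([\mathfrak p_p]^+)$. **Plus-minus weighted zero-sum sequences.** $\mathcal F(G)$ is the (multiplicative) free abelian monoid with basis $G$. For a finite abelian group $G$, $\mathcal B_\pm(G)=\{g_1\cdot\ldots\cdot g_\ell\in\mathcal F(G):\ \ell\ge0,\ \varepsilon_1g_1+\dots+\varepsilon_\ell g_\ell=0\text{ for some }\varepsilon_i\in\{1,-1\}\}$. **Transfer homomorphisms.** A monoid is a commutative cancellative semigroup with identity; $H^\times$ is its group of units, $H_{\rm red}=\{aH^\times:a\in H\}$, and $\mathcal A(H)$ its set of atoms. A monoid homomorphism $\theta\colon H\to B$ is a transfer homomorphism if (T1) $B=\theta(H)B^\times$ and $\theta^{-1}(B^\times)=H^\times$; (T2) if $u\in H$, $b,c\in B$ and $\theta(u)=bc$, then there are $v,w\in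 H$ with $u=vw$, $\theta(v)\in bB^\times$, $\theta(w)\in cB^\times$. **Catenary degree in the fibres.** $\mathsf Z(H)=\mathcal F(\mathcal A(H_{\rm red}))$, with the canonical homomorphism $\pi\colon\mathsf Z(H)\to H_{\rm red}$, and $\mathsf Z(a)=\pi^{-1}(aH^\times)$. The distance $\mathsf d(z,z')$ of $z,z'\in\mathsf Z(H)$ is $\max\{|z\gcd(z,z')^{-1}|,|z'\gcd(z,z')^{-1}|\}$, where $|\cdot|$ is length. For a transfer homomorphism $\theta\colon H\to B$ of atomic monoids, $\overline\theta\colon\mathsf Z(H)\to\mathsf Z(B)$ is the homomorphism with $\overline\theta(uH^\times)=\theta(u)B^\times$ for all $u\in\mathcal A(H)$. $\mathsf c(a,\theta)$ is the smallest $N\in\mathbb N_0\cup\{\infty\}$ such that whenever $z,z'\in\mathsf Z(a)$ with $\overline\theta(z)=\overline\theta(z')$, there are $z=z_0,\dots,z_k=z'$ in $\mathsf Z(a)$ with $\overline\theta(z_i)=\overline\theta(z)$ and $\mathsf d(z_{i-1},z_i)\le N$ for all $i\in[1,k]$. $\mathsf c(H,\theta)=\sup\{\mathsf c(a,\theta):a\in H\}$. *)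

theory Defs
  imports
    Complex_Main
    "HOL-Library.Multiset"
    "HOL-Library.Extended_Nat"
    "HOL-Computational_Algebra.Polynomial"
    "HOL-Computational_Algebra.Primes"
    "HOL-Algebra.Divisibility"
    "HOL-Algebra.Ideal_Product"
    "HOL-Algebra.QuotRing"
begin

section \<open>Binary quadratic forms\<close>

text \<open>The triple \<open>(a, b, c)\<close> stands for the form \<open>a X^2 + b X Y + c Y^2\<close>.\<close>

type_synonym bqf = "int \<times> int \<times> int"

fun bqf_eval :: "bqf \<Rightarrow> int \<Rightarrow> int \<Rightarrow> int" where
  "bqf_eval (a, b, c) x y = a * x\<^sup>2 + b * x * y + c * y\<^sup>2"

fun bqf_disc :: "bqf \<Rightarrow> int" where
  "bqf_disc (a, b, c) = b\<^sup>2 - 4 * a * c"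

fun bqf_primitive :: "bqf \<Rightarrow> bool" where
  "bqf_primitive (a, b, c) \<longleftrightarrow> gcd a (gcd b c) = 1"

definition bqf_negative_definite :: "bqf \<Rightarrow> bool" where
  "bqf_negative_definite f \<longleftrightarrow> (\<forall>x y. (x, y) \<noteq> (0, 0) \<longrightarrow> bqf_eval f x y < 0)"

definition bqf_properly_equiv :: "bqf \<Rightarrow> bqf \<Rightarrow> bool" where
  "bqf_properly_equiv f g \<longleftrightarrow>
     (\<exists>p q r s. p * s - q * r = 1 \<and>
        (\<forall>x y. bqf_eval g x y = bqf_eval f (p * x + q * y) (r * x + s * y)))"

definition bqf_class :: "bqf \<Rightarrow> bqf set" where
  "bqf_class f = {g. bqf_properly_equiv f g}"

definition form_classes :: "int \<Rightarrow> bqf set set" where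
  "form_classes \<Delta> =
     bqf_class ` {f. bqf_disc f = \<Delta> \<and> bqf_primitive f \<and> \<not> bqf_negative_definite f}"

text \<open>
  Gauss composition, in Dirichlet's description by united forms: any two classes contain
  forms \<open>(a, b, a' c)\<close> and \<open>(a', b, a c)\<close> with \<open>a, a' > 0\<close>, and the class of
  \<open>(a a', b, c)\<close> depends only on the two classes.  Primitivity of the two forms makes
  \<open>gcd a (gcd a' b) = 1\<close> automatic.  The lemma after the definition is Gauss's bilinear
  identity, which says that the third form is composed of the other two.
\<close>

definition form_compose :: "bqf set \<Rightarrow> bqf set \<Rightarrow> bqf set" where
  "form_compose F F' =
     (THE H. \<exists>a a' b c. a > 0 \<and> a' > 0 \<and> (a, b, a' * c) \<in> F \<and> (a', b, a * c) \<in> F' \<and>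
        H = bqf_class (a * a', b, c))"

lemma united_forms_identity:
  "bqf_eval (a, b, a' * c) x y * bqf_eval (a', b, a * c) z w =
     bqf_eval (a * a', b, c) (x * z - c * y * w) (a * x * w + a' * y * z + b * y * w)"
  by (simp add: power2_eq_square algebra_simps)

text \<open>For \<open>\<Delta> = 4 D + s\<close> with \<open>s \<in> {0, 1}\<close> one has \<open>s = \<Delta> mod 4\<close> and \<open>D = \<Delta> div 4\<close>.\<close>

definition principal_class :: "int \<Rightarrow> bqf set" where
  "principal_class \<Delta> = bqf_class (1, \<Delta> mod 4, - (\<Delta> div 4))"

text \<open>As usual in HOL-Algebra, the (additively written) group is a multiplicative record.\<close>

definition form_class_group :: "int \<Rightarrow> bqf set monoid" where
  "form_class_group \<Delta> =
     \<lparr>carrier = form_classes \<Delta>, mult = form_compose, one = principal_class \<Delta>\<rparr>"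

definition class_represents :: "bqf set \<Rightarrow> int \<Rightarrow> bool" where
  "class_represents F n \<longleftrightarrow> (\<exists>f\<in>F. \<exists>x y. n = bqf_eval f x y)"


section \<open>Quadratic fields and orders, as subsets of the complex numbers\<close>

definition ring_on :: "complex set \<Rightarrow> complex ring" where
  "ring_on S = \<lparr>carrier = S, mult = (*), one = 1, zero = 0, add = (+)\<rparr>"

definition quad_field :: "int \<Rightarrow> complex set" where
  "quad_field \<Delta> = {x + y * csqrt (of_int \<Delta>) | x y. x \<in> \<rat> \<and> y \<in> \<rat>}"

text \<open>The number \<open>\<omega> = (s + \<surd>\<Delta>) / 2\<close> satisfies \<open>\<omega>^2 = s \<omega> + D\<close>,
  hence \<open>\<int>[\<omega>] = \<int> + \<int> \<omega>\<close>.\<close>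

definition quad_order :: "int \<Rightarrow> complex set" where
  "quad_order \<Delta> =
     {of_int x + of_int y * ((of_int (\<Delta> mod 4) + csqrt (of_int \<Delta>)) / 2) | x y. True}"

definition integers_of :: "complex set \<Rightarrow> complex set" where
  "integers_of K = {x \<in> K. algebraic_int x}"

abbreviation field_embeddings :: "complex set \<Rightarrow> (complex \<Rightarrow> complex) set" where
  "field_embeddings K \<equiv> ring_hom (ring_on K) (ring_on UNIV)"

text \<open>The discriminant of a quadratic field: the squared determinant of the embeddings
  (identity and \<open>\<sigma>\<close>) applied to an integral basis.\<close>

definition quad_field_disc :: "complex set \<Rightarrow> int" where
  "quad_field_disc K =
     (THE d. \<exists>u v. \<exists>\<sigma>\<in>field_embeddings K.
        integers_of K = {of_int x * u + of_int y * v | x y. True} \<and>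
        (\<forall>x y. of_int x * u + of_int y * v = 0 \<longrightarrow> x = 0 \<and> y = 0) \<and>
        (\<exists>z\<in>K. \<sigma> z \<noteq> z) \<and>
        of_int d = (u * \<sigma> v - v * \<sigma> u)\<^sup>2)"

definition totally_positive :: "complex set \<Rightarrow> complex \<Rightarrow> bool" where
  "totally_positive K z \<longleftrightarrow> (\<forall>\<sigma>\<in>field_embeddings K. \<sigma> ` K \<subseteq> \<real> \<longrightarrow> Re (\<sigma> z) > 0)"

definition prime_above :: "complex set \<Rightarrow> nat \<Rightarrow> complex set \<Rightarrow> bool" where
  "prime_above R p I \<longleftrightarrow> primeideal I (ring_on R) \<and> I \<inter> \<int> = {of_int (int p * k) | k. True}"

text \<open>In a quadratic (hence Galois) field all primes above \<open>p\<close> have the same degree;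
  the residue field has \<open>p ^ f\<close> elements.\<close>

definition inertia_degree :: "complex set \<Rightarrow> nat \<Rightarrow> nat" where
  "inertia_degree K p =
     (THE f. \<exists>I. prime_above (integers_of K) p I \<and>
        card (carrier (ring_on (integers_of K) Quot I)) = p ^ f)"


subsection \<open>Narrow class group of an order\<close>

definition frac_ideal :: "int \<Rightarrow> complex set \<Rightarrow> bool" where
  "frac_ideal \<Delta> I \<longleftrightarrow>
     additive_subgroup I (ring_on (quad_field \<Delta>)) \<and> I \<noteq> {0} \<and>
     (\<forall>x\<in>quad_order \<Delta>. \<forall>y\<in>I. x * y \<in> I) \<and>
     (\<exists>d\<in>quad_order \<Delta>. d \<noteq> 0 \<and> (\<forall>y\<in>I. d * y \<in> quad_order \<Delta>))"

text \<open>\<^const>\<open>ideal_prod\<close> is the additive closure of the set of products, so it also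
  multiplies fractional ideals when used in the field.\<close>

abbreviation frac_ideal_mult :: "int \<Rightarrow> complex set \<Rightarrow> complex set \<Rightarrow> complex set" where
  "frac_ideal_mult \<Delta> \<equiv> ideal_prod (ring_on (quad_field \<Delta>))"

definition invertible_frac_ideals :: "int \<Rightarrow> complex set set" where
  "invertible_frac_ideals \<Delta> =
     {I. frac_ideal \<Delta> I \<and> (\<exists>J. frac_ideal \<Delta> J \<and> frac_ideal_mult \<Delta> I J = quad_order \<Delta>)}"

definition frac_ideal_group :: "int \<Rightarrow> complex set monoid" where
  "frac_ideal_group \<Delta> =
     \<lparr>carrier = invertible_frac_ideals \<Delta>, mult = frac_ideal_mult \<Delta>, one = quad_order \<Delta>\<rparr>"

definition pos_principal_ideals :: "int \<Rightarrow> complex set set" where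
  "pos_principal_ideals \<Delta> =
     {(\<lambda>x. z * x) ` quad_order \<Delta> | z.
        z \<in> quad_field \<Delta> \<and> z \<noteq> 0 \<and> totally_positive (quad_field \<Delta>) z}"

definition narrow_class_group :: "int \<Rightarrow> complex set set monoid" where
  "narrow_class_group \<Delta> = frac_ideal_group \<Delta> Mod pos_principal_ideals \<Delta>"

definition narrow_class :: "int \<Rightarrow> complex set \<Rightarrow> complex set set" where
  "narrow_class \<Delta> I = pos_principal_ideals \<Delta> #>\<^bsub>frac_ideal_group \<Delta>\<^esub> I"

text \<open>The isomorphism from form classes to narrow ideal classes; every class in
  \<^const>\<open>form_classes\<close> contains forms with \<open>a > 0\<close>, and they all give the same value.\<close>

definition form_to_ideal_class :: "int \<Rightarrow> bqf set \<Rightarrow> complex set set" where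
  "form_to_ideal_class \<Delta> F =
     (THE C. \<exists>a b c. (a, b, c) \<in> F \<and> a > 0 \<and>
        C = narrow_class \<Delta>
              (Idl\<^bsub>ring_on (quad_order \<Delta>)\<^esub> {of_int a, (of_int b + csqrt (of_int \<Delta>)) / 2}))"

definition ideal_to_form_class :: "int \<Rightarrow> complex set set \<Rightarrow> bqf set" where
  "ideal_to_form_class \<Delta> = the_inv_into (form_classes \<Delta>) (form_to_ideal_class \<Delta>)"


section \<open>Represented numbers\<close>

definition primes_away :: "nat \<Rightarrow> nat set" where
  "primes_away m = {p. Factorial_Ring.prime p \<and> \<not> p dvd m}"

definition naturals_away :: "nat \<Rightarrow> nat set" where
  "naturals_away m = {n. n > 0 \<and> coprime n m}"

definition primes_away_deg1 :: "int \<Rightarrow> nat \<Rightarrow> nat set" where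
  "primes_away_deg1 \<Delta> m = {p \<in> primes_away m. inertia_degree (quad_field \<Delta>) p = 1}"

definition naturals_away_deg1 :: "int \<Rightarrow> nat \<Rightarrow> nat set" where
  "naturals_away_deg1 \<Delta> m =
     {n. n > 0 \<and> (\<forall>p. Factorial_Ring.prime p \<and> p dvd n \<longrightarrow> p \<in> primes_away_deg1 \<Delta> m)}"

definition represented :: "int \<Rightarrow> nat \<Rightarrow> nat set" where
  "represented \<Delta> m = {n \<in> naturals_away m. \<exists>F\<in>form_classes \<Delta>. class_represents F (int n)}"

definition represented_principal :: "int \<Rightarrow> nat \<Rightarrow> nat set" where
  "represented_principal \<Delta> m =
     {n \<in> represented \<Delta> m. class_represents (principal_class \<Delta>) (int n)}"

definition represented_deg1 :: "int \<Rightarrow> nat \<Rightarrow> nat set" where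
  "represented_deg1 \<Delta> m = represented \<Delta> m \<inter> naturals_away_deg1 \<Delta> m"

definition represented_principal_deg1 :: "int \<Rightarrow> nat \<Rightarrow> nat set" where
  "represented_principal_deg1 \<Delta> m = represented_principal \<Delta> m \<inter> naturals_away_deg1 \<Delta> m"

text \<open>Here \<open>P p\<close> is the chosen prime ideal of the order above \<open>p\<close>.  Elements of the free abelian
  monoid over a set are multisets, written additively.\<close>

definition prime_form_class :: "int \<Rightarrow> (nat \<Rightarrow> complex set) \<Rightarrow> nat \<Rightarrow> bqf set" where
  "prime_form_class \<Delta> P p = ideal_to_form_class \<Delta> (narrow_class \<Delta> (P p))"

definition theta_deg1 :: "int \<Rightarrow> nat \<Rightarrow> (nat \<Rightarrow> complex set) \<Rightarrow> nat \<Rightarrow> bqf set multiset" where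
  "theta_deg1 \<Delta> m P n =
     (\<Sum>p \<in> primes_away_deg1 \<Delta> m \<inter> prime_factors n.
        replicate_mset (multiplicity p n) (prime_form_class \<Delta> P p))"

definition nat_mult_monoid :: "nat set \<Rightarrow> nat monoid" where
  "nat_mult_monoid S = \<lparr>carrier = S, mult = (*), one = 1\<rparr>"


section \<open>Plus-minus weighted zero-sum sequences\<close>

definition pm_zero_sum :: "('g, 'b) monoid_scheme \<Rightarrow> 'g multiset set" where
  "pm_zero_sum G =
     {mset gs | gs. set gs \<subseteq> carrier G \<and>
        (\<exists>\<epsilon> :: nat \<Rightarrow> int. (\<forall>i < length gs. \<epsilon> i \<in> {1, -1}) \<and>
           (\<Otimes>\<^bsub>G\<^esub>i\<in>{..<length gs}. (gs ! i) [^]\<^bsub>G\<^esub> \<epsilon> i) = \<one>\<^bsub>G\<^esub>)}"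

definition mset_monoid :: "'a multiset set \<Rightarrow> 'a multiset monoid" where
  "mset_monoid S = \<lparr>carrier = S, mult = (+), one = {#}\<rparr>"


section \<open>Transfer homomorphisms and catenary degree in the fibres\<close>

definition reduced_monoid :: "('a, 'b) monoid_scheme \<Rightarrow> 'a set monoid" where
  "reduced_monoid H =
     \<lparr>carrier = (\<lambda>a. a <#\<^bsub>H\<^esub> Units H) ` carrier H, mult = set_mult H, one = Units H\<rparr>"

definition atoms :: "('a, 'b) monoid_scheme \<Rightarrow> 'a set" where
  "atoms H = {u \<in> carrier H. Divisibility.irreducible H u}"

definition transfer_hom ::
  "('a, 'c) monoid_scheme \<Rightarrow> ('b, 'd) monoid_scheme \<Rightarrow> ('a \<Rightarrow> 'b) \<Rightarrow> bool" where
  "transfer_hom H B \<theta> \<longleftrightarrow>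
     comm_monoid_cancel H \<and> comm_monoid_cancel B \<and>
     \<theta> \<in> hom H B \<and> \<theta> \<one>\<^bsub>H\<^esub> = \<one>\<^bsub>B\<^esub> \<and>
     carrier B = \<theta> ` carrier H <#>\<^bsub>B\<^esub> Units B \<and>
     {a \<in> carrier H. \<theta> a \<in> Units B} = Units H \<and>
     (\<forall>u\<in>carrier H. \<forall>b\<in>carrier B. \<forall>c\<in>carrier B. \<theta> u = b \<otimes>\<^bsub>B\<^esub> c \<longrightarrow>
        (\<exists>v\<in>carrier H. \<exists>w\<in>carrier H. u = v \<otimes>\<^bsub>H\<^esub> w \<and>
           \<theta> v \<in> b <#\<^bsub>B\<^esub> Units B \<and> \<theta> w \<in> c <#\<^bsub>B\<^esub> Units B))"

definition factorizations :: "('a, 'b) monoid_scheme \<Rightarrow> 'a set multiset set" where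
  "factorizations H = {z. set_mset z \<subseteq> atoms (reduced_monoid H)}"

definition factorization_value :: "('a, 'b) monoid_scheme \<Rightarrow> 'a set multiset \<Rightarrow> 'a set" where
  "factorization_value H z =
     (\<Otimes>\<^bsub>reduced_monoid H\<^esub>U\<in>set_mset z. U [^]\<^bsub>reduced_monoid H\<^esub> count z U)"

definition factorizations_of :: "('a, 'b) monoid_scheme \<Rightarrow> 'a \<Rightarrow> 'a set multiset set" where
  "factorizations_of H a =
     {z \<in> factorizations H. factorization_value H z = a <#\<^bsub>H\<^esub> Units H}"

definition factorization_dist :: "'a multiset \<Rightarrow> 'a multiset \<Rightarrow> nat" where
  "factorization_dist z z' = max (size (z - z \<inter># z')) (size (z' - z \<inter># z'))"

text \<open>The image \<open>\<theta> ` U <#> Units B\<close> of a coset \<open>U\<close> of \<open>u\<close> is the coset of \<open>\<theta> u\<close>.\<close>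

definition factorization_map ::
  "('b, 'd) monoid_scheme \<Rightarrow> ('a \<Rightarrow> 'b) \<Rightarrow> 'a set multiset \<Rightarrow> 'b set multiset" where
  "factorization_map B \<theta> z = image_mset (\<lambda>U. \<theta> ` U <#>\<^bsub>B\<^esub> Units B) z"

definition fibre_catenary_elem ::
  "('a, 'c) monoid_scheme \<Rightarrow> ('b, 'd) monoid_scheme \<Rightarrow> ('a \<Rightarrow> 'b) \<Rightarrow> 'a \<Rightarrow> enat" where
  "fibre_catenary_elem H B \<theta> a =
     (LEAST N. \<forall>z\<in>factorizations_of H a. \<forall>z'\<in>factorizations_of H a.
        factorization_map B \<theta> z = factorization_map B \<theta> z' \<longrightarrow>
        (\<exists>k. \<exists>zs :: nat \<Rightarrow> 'a set multiset. zs 0 = z \<and> zs k = z' \<and>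
           (\<forall>i\<le>k. zs i \<in> factorizations_of H a \<and>
              factorization_map B \<theta> (zs i) = factorization_map B \<theta> z) \<and>
           (\<forall>i<k. enat (factorization_dist (zs i) (zs (Suc i))) \<le> N)))"

definition fibre_catenary ::
  "('a, 'c) monoid_scheme \<Rightarrow> ('b, 'd) monoid_scheme \<Rightarrow> ('a \<Rightarrow> 'b) \<Rightarrow> enat" where
  "fibre_catenary H B \<theta> = (SUP a\<in>carrier H. fibre_catenary_elem H B \<theta> a)"

end

theory Submission
  imports Defs
begin

text \<open>
  The heart of the matter is a statement about ideals.  Let \<open>n = p\<^sub>1 \<dots> p\<^sub>l\<close> with primes of degree one
  that do not divide the conductor.  Then \<open>n\<close> is represented by the principal form iff some product
  \<open>[P p\<^sub>1]\<^sup>\<plusminus>\<^sup>1 \<dots> [P p\<^sub>l]\<^sup>\<plusminus>\<^sup>1\<close> of narrow ideal classes is trivial (lemma \<open>norm_iff_signed_product\<close>).  The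
  principal form is the norm form of the order, so \<open>n\<close> is represented iff \<open>n = \<alpha> \<alpha>'\<close> for some \<open>\<alpha>\<close> in
  the order, with conjugate \<open>\<alpha>'\<close>.  The conjugate of \<open>P p\<close> has the inverse class, because their product
  is \<open>(p)\<close>.  If \<open>n = \<alpha> \<alpha>'\<close>, then \<open>(\<alpha>)(\<alpha>') = (n)\<close> is contained in \<open>P p\<^sub>1\<close>, hence so is \<open>(\<alpha>)\<close> or \<open>(\<alpha>')\<close>,
  and \<open>P p\<^sub>1\<close> or its conjugate can be cancelled from \<open>(\<alpha>)\<close>; by induction \<open>(\<alpha>)\<close> is a product of ideals
  \<open>P p\<^sub>i\<close> or their conjugates, and its class is trivial because \<open>\<alpha>\<close> or \<open>-\<alpha>\<close> is totally positive.
  Conversely, a trivial signed product gives an ideal of norm \<open>n\<close> with a totally positive generator,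
  and the norm of the generator is \<open>n\<close>.

  To read this as a statement about forms one needs that composition makes the form classes an
  abelian group isomorphic to the narrow class group.  A form \<open>(a, b, c)\<close> with \<open>a > 0\<close> corresponds to the
  lattice \<open>\<int>a + \<int>(b + \<surd>\<Delta>)/2\<close>.  The Hermite normal form (\<open>integral_ideal_lat\<close>) shows that all invertible
  ideals are rational multiples of such lattices, a change of basis of determinant 1 is a proper
  equivalence of forms (\<open>lat_similar_if_equiv\<close>, \<open>equiv_if_lat_similar\<close>), and united forms have
  lattices whose product is the lattice of the composed form (\<open>lat_ip_lat\<close>).

  The degree of a prime enters as follows.  A prime ideal \<open>P p\<close> of the order is either \<open>(p)\<close> or a
  lattice \<open>\<int>p + \<int>(b + \<surd>\<Delta>)/2\<close>.  In the first case \<open>p\<close> would be inert in the maximal order, which agrees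
  with the given order at primes not dividing the conductor, and would have degree 2
  (\<open>degree_one_prime_of_norm\<close>).  The maximal order is identified with the order of the fundamental
  discriminant by \<open>integers_of_K\<close>: over a fundamental discriminant all ideals are invertible, so that
  no element outside the order can be integral.

  The rest is combinatorics.  By the first part, the monoid of represented numbers is the full
  preimage of the monoid of plus-minus weighted zero-sum sequences under the homomorphism of free
  monoids that replaces every prime \<open>p\<close> by its class \<open>F\<^sub>p\<close>, and every class is an \<open>F\<^sub>p\<close>.  Factorizations
  of an image lift, and two factorizations with the same image are connected by swapping two primes
  with the same class between two atoms, which is a step of distance at most 2 (locale
  \<open>labelled_primes\<close>).
\<close>

section \<open>Signed products in abelian groups\<close>

text \<open>
  All values \<open>g\<^sub>1\<^sup>\<plusminus>\<^sup>1 \<otimes> \<dots> \<otimes> g\<^sub>l\<^sup>\<plusminus>\<^sup>1\<close>.  Recursion on the list replaces sign functions on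
  index sets, so that statements about products of ideals can be proved by list induction.
\<close>

fun signed_products :: "('g, 'b) monoid_scheme \<Rightarrow> 'g list \<Rightarrow> 'g set" where
  "signed_products G [] = {\<one>\<^bsub>G\<^esub>}"
| "signed_products G (g # gs) =
     (\<Union>x\<in>signed_products G gs. {g \<otimes>\<^bsub>G\<^esub> x, inv\<^bsub>G\<^esub> g \<otimes>\<^bsub>G\<^esub> x})"

context comm_group
begin

lemma signed_products_closed:
  "set gs \<subseteq> carrier G \<Longrightarrow> signed_products G gs \<subseteq> carrier G"
  by (induction gs) auto

lemma signed_products_append:
  assumes "set gs \<subseteq> carrier G" "set hs \<subseteq> carrier G"
    and "x \<in> signed_products G gs" "y \<in> signed_products G hs"
  shows "x \<otimes> y \<in> signed_products G (gs @ hs)"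
  using assms
proof (induction gs arbitrary: x)
  case Nil
  then show ?case using signed_products_closed[of hs] by auto
next
  case (Cons g gs)
  then obtain z where z: "z \<in> signed_products G gs" "x = g \<otimes> z \<or> x = inv g \<otimes> z"
    by auto
  have "z \<in> carrier G" "y \<in> carrier G"
    using z Cons.prems signed_products_closed[of gs] signed_products_closed[of hs] by auto
  then have "x \<otimes> y = g \<otimes> (z \<otimes> y) \<or> x \<otimes> y = inv g \<otimes> (z \<otimes> y)"
    using z(2) Cons.prems by (elim disjE) (auto simp: m_assoc)
  moreover have "z \<otimes> y \<in> signed_products G (gs @ hs)"
    using Cons z by auto
  ultimately show ?case by auto
qed

lemma finprod_lessThan_Suc_shift:
  assumes "\<And>i. i < Suc n \<Longrightarrow> f i \<in> carrier G"
  shows "(\<Otimes>i\<in>{..<Suc n}. f i) = f 0 \<otimes> (\<Otimes>i\<in>{..<n}. f (Suc i))"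
proof -
  have "(\<Otimes>i\<in>{..<Suc n}. f i) = f 0 \<otimes> (\<Otimes>i\<in>Suc ` {..<n}. f i)"
    unfolding lessThan_Suc_eq_insert_0 using assms by (subst finprod_insert) auto
  also have "(\<Otimes>i\<in>Suc ` {..<n}. f i) = (\<Otimes>i\<in>{..<n}. f (Suc i))"
    using assms by (subst finprod_reindex) auto
  finally show ?thesis .
qed

lemma signed_products_iff:
  assumes "set gs \<subseteq> carrier G"
  shows "x \<in> signed_products G gs \<longleftrightarrow>
    (\<exists>\<epsilon> :: nat \<Rightarrow> int. (\<forall>i < length gs. \<epsilon> i \<in> {1, -1}) \<and>
       (\<Otimes>i\<in>{..<length gs}. (gs ! i) [^] \<epsilon> i) = x)"
  using assms
proof (induction gs arbitrary: x)
  case Nil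
  then show ?case by auto
next
  case (Cons g gs)
  have expand: "(\<Otimes>i\<in>{..<length (g # gs)}. ((g # gs) ! i) [^] \<epsilon> i) =
      g [^] \<epsilon> 0 \<otimes> (\<Otimes>i\<in>{..<length gs}. (gs ! i) [^] \<epsilon> (Suc i))" for \<epsilon> :: "nat \<Rightarrow> int"
    using Cons.prems nth_mem[of _ gs]
    by (subst length_Cons, subst finprod_lessThan_Suc_shift)
       (auto simp: nth_Cons subset_iff split: nat.splits)
  have g: "g [^] (1::int) = g" "g [^] (- 1::int) = inv g"
    using Cons.prems by (auto simp: int_pow_neg)
  have IH: "y \<in> signed_products G gs \<longleftrightarrow>
    (\<exists>\<epsilon> :: nat \<Rightarrow> int. (\<forall>i < length gs. \<epsilon> i \<in> {1, -1}) \<and>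
       (\<Otimes>i\<in>{..<length gs}. (gs ! i) [^] \<epsilon> i) = y)" for y
    using Cons by simp
  show ?case
  proof
    assume "x \<in> signed_products G (g # gs)"
    then obtain y where y: "y \<in> signed_products G gs" "x = g \<otimes> y \<or> x = inv g \<otimes> y" by auto
    then obtain e :: int where e: "e \<in> {1, -1}" "x = g [^] e \<otimes> y" using g
      by (metis insertI1 insertI2)
    from y obtain \<epsilon> :: "nat \<Rightarrow> int" where \<epsilon>: "\<forall>i < length gs. \<epsilon> i \<in> {1, -1}"
      "(\<Otimes>i\<in>{..<length gs}. (gs ! i) [^] \<epsilon> i) = y" using IH by blast
    have "(\<forall>i < length (g # gs). case_nat e \<epsilon> i \<in> {1, -1}) \<and>
       (\<Otimes>i\<in>{..<length (g # gs)}. ((g # gs) ! i) [^] case_nat e \<epsilon> i) = x"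
      unfolding expand using e \<epsilon> by (auto split: nat.splits)
    then show "\<exists>\<epsilon> :: nat \<Rightarrow> int. (\<forall>i < length (g # gs). \<epsilon> i \<in> {1, -1}) \<and>
       (\<Otimes>i\<in>{..<length (g # gs)}. ((g # gs) ! i) [^] \<epsilon> i) = x" by blast
  next
    assume "\<exists>\<epsilon> :: nat \<Rightarrow> int. (\<forall>i < length (g # gs). \<epsilon> i \<in> {1, -1}) \<and>
       (\<Otimes>i\<in>{..<length (g # gs)}. ((g # gs) ! i) [^] \<epsilon> i) = x"
    then obtain \<epsilon> :: "nat \<Rightarrow> int" where \<epsilon>: "\<forall>i < length (g # gs). \<epsilon> i \<in> {1, -1}"
      "(\<Otimes>i\<in>{..<length (g # gs)}. ((g # gs) ! i) [^] \<epsilon> i) = x" by blast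
    let ?y = "\<Otimes>i\<in>{..<length gs}. (gs ! i) [^] \<epsilon> (Suc i)"
    have "?y \<in> signed_products G gs"
      unfolding IH using \<epsilon>(1) by (intro exI[of _ "\<lambda>i. \<epsilon> (Suc i)"]) auto
    moreover have "x = g [^] \<epsilon> 0 \<otimes> ?y" using \<epsilon>(2) unfolding expand by simp
    moreover have "\<epsilon> 0 = 1 \<or> \<epsilon> 0 = -1" using \<epsilon>(1) by auto
    ultimately show "x \<in> signed_products G (g # gs)" using g by auto
  qed
qed

lemma pm_zero_sum_iff:
  "M \<in> pm_zero_sum G \<longleftrightarrow>
     (\<exists>gs. M = mset gs \<and> set gs \<subseteq> carrier G \<and> \<one> \<in> signed_products G gs)"
  unfolding pm_zero_sum_def using signed_products_iff by blast

lemma pm_zero_sum_add: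
  assumes "M \<in> pm_zero_sum G" "N \<in> pm_zero_sum G"
  shows "M + N \<in> pm_zero_sum G"
proof -
  from assms obtain gs hs where
    "M = mset gs" "set gs \<subseteq> carrier G" "\<one> \<in> signed_products G gs"
    "N = mset hs" "set hs \<subseteq> carrier G" "\<one> \<in> signed_products G hs"
    unfolding pm_zero_sum_iff by blast
  then show ?thesis
    unfolding pm_zero_sum_iff using signed_products_append[of gs hs \<one> \<one>]
    by (intro exI[of _ "gs @ hs"]) auto
qed

lemma pm_zero_sum_empty: "{#} \<in> pm_zero_sum G"
  unfolding pm_zero_sum_iff by (intro exI[of _ "[]"]) simp

end

lemma (in group_hom) signed_products_hom:
  assumes "set gs \<subseteq> carrier G" "comm_group G"
  shows "signed_products H (map h gs) = h ` signed_products G gs"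
  using assms(1)
proof (induction gs)
  case Nil
  then show ?case by simp
next
  case (Cons g gs)
  have sub: "signed_products G gs \<subseteq> carrier G"
    using Cons.prems comm_group.signed_products_closed[OF assms(2)] by auto
  have "signed_products H (map h (g # gs)) =
      (\<Union>x\<in>signed_products G gs. {h g \<otimes>\<^bsub>H\<^esub> h x, inv\<^bsub>H\<^esub> h g \<otimes>\<^bsub>H\<^esub> h x})"
    using Cons by auto
  also have "\<dots> = (\<Union>x\<in>signed_products G gs. {h (g \<otimes> x), h (inv g \<otimes> x)})"
    using sub Cons.prems by (intro SUP_cong) (auto simp: subset_iff)
  finally show ?case by auto
qed


section \<open>Transfer homomorphisms that merge primes\<close>

text \<open>
  This turns a list of classes into a list of primes: the order of a zero-sum sequence is
  carried over to the prime divisors of a number.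
\<close>

lemma image_mset_eq_mset_obtain_list:
  assumes "image_mset f M = mset gs"
  obtains xs where "mset xs = M" "map f xs = gs"
proof -
  have "\<exists>xs. mset xs = M \<and> map f xs = gs"
    using assms
  proof (induction gs arbitrary: M)
    case (Cons g gs)
    then obtain x M' where "M = add_mset x M'" "f x = g" "image_mset f M' = mset gs"
      by (metis msed_map_invR mset.simps(2))
    with Cons.IH[of M'] obtain xs where "mset xs = M'" "map f xs = gs" by blast
    with \<open>M = add_mset x M'\<close> \<open>f x = g\<close> show ?case by (intro exI[of _ "x # xs"]) simp
  qed simp
  with that show ?thesis by blast
qed

text \<open>
  The monoid \<open>H\<close> of all \<open>n\<close> composed of primes in \<open>Q\<close> whose multiset of prime divisors is
  carried into a monoid \<open>B\<close> of multisets by a labelling \<open>F\<close> of the primes.  Since \<open>H\<close> is the full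
  preimage of \<open>B\<close>, primes with the same label are interchangeable.
\<close>

locale labelled_primes =
  fixes Q :: "nat set" and F :: "nat \<Rightarrow> 'g" and B :: "'g multiset set"
    and H :: "nat set" and \<theta> :: "nat \<Rightarrow> 'g multiset"
  assumes prime_Q: "p \<in> Q \<Longrightarrow> Factorial_Ring.prime p"
    and empty_B: "{#} \<in> B"
    and add_B: "M \<in> B \<Longrightarrow> N \<in> B \<Longrightarrow> M + N \<in> B"
    and labels_B: "M \<in> B \<Longrightarrow> set_mset M \<subseteq> F ` Q"
    and H_iff: "n \<in> H \<longleftrightarrow> n > 0 \<and> prime_factors n \<subseteq> Q \<and>
      image_mset F (prime_factorization n) \<in> B"
    and \<theta>_eq: "n \<in> H \<Longrightarrow> \<theta> n = image_mset F (prime_factorization n)"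
begin

abbreviation "HM \<equiv> nat_mult_monoid H"
abbreviation "BM \<equiv> mset_monoid B"

lemma pos: "n \<in> H \<Longrightarrow> n > 0" by (simp add: H_iff)

lemma one_H: "1 \<in> H" "Suc 0 \<in> H" by (simp_all add: H_iff empty_B)

lemma mult_H: "a \<in> H \<Longrightarrow> b \<in> H \<Longrightarrow> a * b \<in> H"
  by (auto simp: H_iff prime_factorization_mult add_B)

lemma \<theta>_mult: "a \<in> H \<Longrightarrow> b \<in> H \<Longrightarrow> \<theta> (a * b) = \<theta> a + \<theta> b"
  using \<theta>_eq mult_H pos by (simp add: prime_factorization_mult)

lemma \<theta>_one: "\<theta> 1 = {#}" using \<theta>_eq[OF one_H(1)] by simp

lemma \<theta>_in_B: "n \<in> H \<Longrightarrow> \<theta> n \<in> B" using \<theta>_eq H_iff by metis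

lemma \<theta>_empty_iff: "n \<in> H \<Longrightarrow> \<theta> n = {#} \<longleftrightarrow> n = 1"
  using \<theta>_eq[of n] pos[of n] by (simp add: prime_factorization_empty_iff)

lemma prod_mset_H:
  assumes "set_mset X \<subseteq> Q" "image_mset F X \<in> B"
  shows "prod_mset X \<in> H" "\<theta> (prod_mset X) = image_mset F X"
proof -
  have pf: "prime_factorization (prod_mset X) = X"
    using assms prime_Q by (intro prime_factorization_prod_mset_primes) auto
  have "prod_mset X > 0"
    using assms prime_Q not_prime_0 by (metis gr0I prod_mset_zero_iff subset_iff)
  with pf assms show "prod_mset X \<in> H" by (simp add: H_iff)
  with pf show "\<theta> (prod_mset X) = image_mset F X" by (simp add: \<theta>_eq)
qed

lemma \<theta>_surj: assumes "M \<in> B" shows "\<exists>n\<in>H. \<theta> n = M"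
proof -
  from labels_B[OF assms] have "\<exists>X. set_mset X \<subseteq> Q \<and> image_mset F X = M"
  proof (induction M)
    case (add g M)
    then obtain X p where "set_mset X \<subseteq> Q" "image_mset F X = M" "p \<in> Q" "F p = g" by auto
    then show ?case by (intro exI[of _ "add_mset p X"]) auto
  qed simp
  with prod_mset_H assms show ?thesis by metis
qed

text \<open>Splitting \<open>\<theta> u\<close> splits the multiset of primes of \<open>u\<close>.\<close>

lemma \<theta>_split:
  assumes u: "u \<in> H" and bc: "b \<in> B" "c \<in> B" "\<theta> u = b + c"
  shows "\<exists>v\<in>H. \<exists>w\<in>H. u = v * w \<and> \<theta> v = b \<and> \<theta> w = c"
proof -
  have "image_mset F (prime_factorization u) = b + c" using u bc \<theta>_eq by simp
  then obtain X Y where XY: "prime_factorization u = X + Y" "b = image_mset F X" "c = image_mset F Y"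
    by (blast dest: image_mset_eq_plusD)
  have "set_mset (X + Y) \<subseteq> Q" using u H_iff unfolding XY(1)[symmetric] by simp
  then have "prod_mset X \<in> H" "prod_mset Y \<in> H" "\<theta> (prod_mset X) = b" "\<theta> (prod_mset Y) = c"
    using prod_mset_H[of X] prod_mset_H[of Y] XY bc by auto
  moreover have "u = prod_mset X * prod_mset Y"
    using pos[OF u] prod_mset_prime_factorization[of u] XY(1)
    by (simp add: prod_mset_prime_factorization_nat)
  ultimately show ?thesis by blast
qed

lemma comm_monoid_HM: "comm_monoid HM"
  by (rule comm_monoidI) (auto simp: nat_mult_monoid_def mult_H one_H)

lemma cancel_HM: "comm_monoid_cancel HM"
  by (rule comm_monoid_cancelI[OF comm_monoid_HM]) (auto simp: nat_mult_monoid_def dest: pos)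

lemma cancel_BM: "comm_monoid_cancel BM"
  by (rule comm_monoid_cancelI, rule comm_monoidI)
     (auto simp: mset_monoid_def add_B empty_B ac_simps)

lemma Units_HM: "Units HM = {1}"
  using one_H by (auto simp: Units_def nat_mult_monoid_def)

lemma Units_BM: "Units BM = {{#}}"
  using empty_B by (auto simp: Units_def mset_monoid_def)

theorem transfer_hom_\<theta>: "transfer_hom HM BM \<theta>"
  unfolding transfer_hom_def Units_HM Units_BM
proof (intro conjI)
  show "\<theta> \<in> hom HM BM"
    by (auto simp: hom_def nat_mult_monoid_def mset_monoid_def \<theta>_in_B \<theta>_mult)
  show "carrier BM = \<theta> ` carrier HM <#>\<^bsub>BM\<^esub> {{#}}"
    using \<theta>_surj \<theta>_in_B by (force simp: set_mult_def nat_mult_monoid_def mset_monoid_def)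
  show "{a \<in> carrier HM. \<theta> a \<in> {{#}}} = {1}"
    using one_H by (auto simp: nat_mult_monoid_def \<theta>_empty_iff \<theta>_one)
  show "\<forall>u\<in>carrier HM. \<forall>b\<in>carrier BM. \<forall>c\<in>carrier BM. \<theta> u = b \<otimes>\<^bsub>BM\<^esub> c \<longrightarrow>
        (\<exists>v\<in>carrier HM. \<exists>w\<in>carrier HM. u = v \<otimes>\<^bsub>HM\<^esub> w \<and>
           \<theta> v \<in> b <#\<^bsub>BM\<^esub> {{#}} \<and> \<theta> w \<in> c <#\<^bsub>BM\<^esub> {{#}})"
    using \<theta>_split by (simp add: nat_mult_monoid_def mset_monoid_def l_coset_def)
qed (simp_all add: cancel_HM cancel_BM, simp_all add: nat_mult_monoid_def mset_monoid_def \<theta>_one[simplified])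


subsection \<open>Factorizations as multisets of numbers\<close>

definition atom :: "nat \<Rightarrow> bool" where
  "atom u \<longleftrightarrow> u \<in> H \<and> u \<noteq> 1 \<and> (\<forall>v\<in>H. \<forall>w\<in>H. u = v * w \<longrightarrow> v = 1 \<or> w = 1)"

lemma atom_H: "atom u \<Longrightarrow> u \<in> H" by (simp add: atom_def)

text \<open>
  Any splitting of the common image lifts to \<open>u\<close> as well as to \<open>v\<close>.
\<close>

lemma atom_cong_\<theta>:
  assumes "atom u" "v \<in> H" "\<theta> v = \<theta> u"
  shows "atom v"
  unfolding atom_def
proof (intro conjI ballI impI)
  show "v \<noteq> 1" using assms \<theta>_empty_iff by (metis atom_def \<theta>_one)
  fix x y assume xy: "x \<in> H" "y \<in> H" "v = x * y"
  then have "\<theta> u = \<theta> x + \<theta> y" using assms \<theta>_mult by simp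
  then obtain x' y' where "x' \<in> H" "y' \<in> H" "u = x' * y'" "\<theta> x' = \<theta> x" "\<theta> y' = \<theta> y"
    using \<theta>_split[of u "\<theta> x" "\<theta> y"] xy \<theta>_in_B assms atom_H by blast
  then show "x = 1 \<or> y = 1" using assms(1) xy \<theta>_empty_iff by (metis atom_def)
qed (use assms in simp)

abbreviation "RM \<equiv> reduced_monoid HM"

lemma carrier_RM: "carrier RM = (\<lambda>u. {u}) ` H"
  unfolding reduced_monoid_def Units_HM by (auto simp: l_coset_def nat_mult_monoid_def)

lemma mult_RM: "{a} \<otimes>\<^bsub>RM\<^esub> {b} = {a * b}"
  by (simp add: reduced_monoid_def set_mult_def nat_mult_monoid_def)

lemma one_RM: "\<one>\<^bsub>RM\<^esub> = {1}"
  by (simp add: reduced_monoid_def Units_HM)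

lemma comm_monoid_RM: "comm_monoid RM"
  by (rule comm_monoidI) (auto simp: carrier_RM mult_RM one_RM mult_H one_H ac_simps simp flip: One_nat_def)

lemma Units_RM: "Units RM = {{1}}"
  using one_H unfolding Units_def carrier_RM by (auto simp: mult_RM one_RM simp flip: One_nat_def)

lemma atoms_RM: "atoms RM = (\<lambda>u. {u}) ` {u. atom u}"
proof -
  have pf: "properfactor RM {a} {u} \<longleftrightarrow> (\<exists>c\<in>H. u = a * c \<and> c \<noteq> 1)" if "a \<in> H" "u \<in> H" for a u
  proof -
    have d: "{x} divides\<^bsub>RM\<^esub> {y} \<longleftrightarrow> (\<exists>c\<in>H. y = x * c)" for x y
      by (auto simp: factor_def carrier_RM mult_RM)
    show ?thesis
    proof
      assume "properfactor RM {a} {u}"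
      then obtain c where c: "c \<in> H" "u = a * c" and n: "\<not> (\<exists>c\<in>H. a = u * c)"
        unfolding properfactor_def d by blast
      have "c \<noteq> 1"
      proof
        assume "c = 1"
        with c have "a = u * 1" by simp
        with n one_H(1) show False by blast
      qed
      with c show "\<exists>c\<in>H. u = a * c \<and> c \<noteq> 1" by blast
    next
      assume "\<exists>c\<in>H. u = a * c \<and> c \<noteq> 1"
      then obtain c where c: "c \<in> H" "u = a * c" "c \<noteq> 1" by blast
      have "a \<noteq> u * e" for e using c(2,3) pos[OF \<open>a \<in> H\<close>] by auto
      with c show "properfactor RM {a} {u}" unfolding properfactor_def d by blast
    qed
  qed
  have "Divisibility.irreducible RM {u} \<longleftrightarrow> atom u" if "u \<in> H" for u
  proof -
    have "Divisibility.irreducible RM {u} \<longleftrightarrow>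
       u \<noteq> 1 \<and> (\<forall>a\<in>H. (\<exists>c\<in>H. u = a * c \<and> c \<noteq> 1) \<longrightarrow> a = 1)"
      unfolding Divisibility.irreducible_def Units_RM carrier_RM using pf that by auto
    also have "\<dots> \<longleftrightarrow> atom u" unfolding atom_def using that by blast
    finally show ?thesis .
  qed
  then show ?thesis unfolding atoms_def carrier_RM using atom_H by auto
qed

lemma factorization_value_singletons:
  assumes "set_mset y \<subseteq> H"
  shows "factorization_value HM (image_mset (\<lambda>u. {u}) y) = {prod_mset y}"
proof -
  interpret RM: comm_monoid RM by (rule comm_monoid_RM)
  have pow: "{u} [^]\<^bsub>RM\<^esub> k = {u ^ k}" if "u \<in> H" for u and k :: nat
    using that by (induction k) (auto simp: one_RM mult_RM mult.commute)
  have "(\<Otimes>\<^bsub>RM\<^esub>U\<in>(\<lambda>u. {u}) ` S. U [^]\<^bsub>RM\<^esub> e U) = {\<Prod>u\<in>S. u ^ e {u}}"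
    if "finite S" "S \<subseteq> H" for S and e :: "nat set \<Rightarrow> nat"
    using that
  proof (induction S rule: finite_induct)
    case (insert x S)
    then have c: "{u} [^]\<^bsub>RM\<^esub> e {u} \<in> carrier RM" if "u \<in> insert x S" for u
      using that by (intro RM.nat_pow_closed) (auto simp: carrier_RM)
    have "(\<Otimes>\<^bsub>RM\<^esub>U\<in>(\<lambda>u. {u}) ` insert x S. U [^]\<^bsub>RM\<^esub> e U) =
        {x} [^]\<^bsub>RM\<^esub> e {x} \<otimes>\<^bsub>RM\<^esub> (\<Otimes>\<^bsub>RM\<^esub>U\<in>(\<lambda>u. {u}) ` S. U [^]\<^bsub>RM\<^esub> e U)"
      unfolding image_insert using insert c by (subst RM.finprod_insert) auto
    then show ?case using insert pow[of x] by (simp add: mult_RM)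
  qed (simp add: one_RM)
  from this[of "set_mset y" "count (image_mset (\<lambda>u. {u}) y)"] assms
  have "factorization_value HM (image_mset (\<lambda>u. {u}) y) =
      {\<Prod>u\<in>set_mset y. u ^ count (image_mset (\<lambda>u. {u}) y) {u}}"
    unfolding factorization_value_def by simp
  also have "(\<Prod>u\<in>set_mset y. u ^ count (image_mset (\<lambda>u. {u}) y) {u}) = prod_mset y"
  proof -
    have "count (image_mset (\<lambda>u. {u}) y) {u} = count y u" for u by (induction y) auto
    then show ?thesis by (simp add: prod_mset_multiplicity)
  qed
  finally show ?thesis .
qed

lemma factorizations_of_HM:
  "factorizations_of HM a =
     image_mset (\<lambda>u. {u}) ` {y. (\<forall>u\<in>#y. atom u) \<and> prod_mset y = a}"
proof -
  have atomic: "set_mset z \<subseteq> (\<lambda>u. {u}) ` {u. atom u} \<longleftrightarrow>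
      (\<exists>y. (\<forall>u\<in>#y. atom u) \<and> z = image_mset (\<lambda>u. {u}) y)" for z :: "nat set multiset"
  proof
    assume "set_mset z \<subseteq> (\<lambda>u. {u}) ` {u. atom u}"
    then show "\<exists>y. (\<forall>u\<in>#y. atom u) \<and> z = image_mset (\<lambda>u. {u}) y"
    proof (induction z)
      case (add U z)
      then obtain y u where "\<forall>u\<in>#y. atom u" "z = image_mset (\<lambda>u. {u}) y" "U = {u}" "atom u"
        by auto
      then show ?case by (intro exI[of _ "add_mset u y"]) auto
    qed simp
  qed auto
  have coset: "a <#\<^bsub>HM\<^esub> {1} = {a}" by (simp add: l_coset_def nat_mult_monoid_def)
  have "factorization_value HM (image_mset (\<lambda>u. {u}) y) = {prod_mset y}"
    if "\<forall>u\<in>#y. atom u" for y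
    using that atom_H by (intro factorization_value_singletons) auto
  then have "z \<in> factorizations_of HM a \<longleftrightarrow>
      (\<exists>y. (\<forall>u\<in>#y. atom u) \<and> z = image_mset (\<lambda>u. {u}) y \<and> prod_mset y = a)" for z
    unfolding factorizations_of_def factorizations_def atoms_RM Units_HM coset mem_Collect_eq atomic
    by (metis singleton_inject)
  then show ?thesis by blast
qed

lemma factorization_map_singletons:
  "factorization_map BM \<theta> (image_mset (\<lambda>u. {u}) y) = image_mset (\<lambda>M. {M}) (image_mset \<theta> y)"
proof -
  have "\<theta> ` {u} <#>\<^bsub>BM\<^esub> Units BM = {\<theta> u}" for u
    unfolding Units_BM by (simp add: set_mult_def mset_monoid_def)
  then show ?thesis
    unfolding factorization_map_def by (simp add: multiset.map_comp comp_def)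
qed


subsection \<open>Exchanging primes with equal labels\<close>

text \<open>One link of a chain in a fibre.  At most two atoms change, so the distance is at most 2.\<close>

definition exchange :: "nat multiset \<Rightarrow> nat multiset \<Rightarrow> bool" where
  "exchange y z \<longleftrightarrow> (\<exists>a b c d r. y = {#a, b#} + r \<and> z = {#c, d#} + r \<and> a * b = c * d \<and>
     \<theta> c = \<theta> a \<and> \<theta> d = \<theta> b \<and> atom c \<and> atom d)"

lemma exchange_add: "exchange y z \<Longrightarrow> exchange (add_mset x y) (add_mset x z)"
  unfolding exchange_def
proof (elim exE conjE)
  fix a b c d r
  assume "y = {#a, b#} + r" "z = {#c, d#} + r" "a * b = c * d"
     "\<theta> c = \<theta> a" "\<theta> d = \<theta> b" "atom c" "atom d"
  then show "\<exists>a b c d r. add_mset x y = {#a, b#} + r \<and> add_mset x z = {#c, d#} + r \<and>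
     a * b = c * d \<and> \<theta> c = \<theta> a \<and> \<theta> d = \<theta> b \<and> atom c \<and> atom d"
    by (intro exI[of _ a] exI[of _ b] exI[of _ c] exI[of _ d] exI[of _ "add_mset x r"]) auto
qed

lemma exchanges_add: "exchange\<^sup>*\<^sup>* y z \<Longrightarrow> exchange\<^sup>*\<^sup>* (add_mset x y) (add_mset x z)"
  by (induction rule: rtranclp_induct) (auto intro: exchange_add rtranclp.rtrancl_into_rtrancl)

lemma exchange_preserves:
  assumes "exchange y z" "\<forall>u\<in>#y. atom u"
  shows "\<forall>u\<in>#z. atom u" "prod_mset z = prod_mset y" "image_mset \<theta> z = image_mset \<theta> y"
  using assms unfolding exchange_def by (auto simp: mult.assoc[symmetric])

lemma exchanges_preserve:
  assumes "exchange\<^sup>*\<^sup>* y z" "\<forall>u\<in>#y. atom u"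
  shows "(\<forall>u\<in>#z. atom u) \<and> prod_mset z = prod_mset y \<and> image_mset \<theta> z = image_mset \<theta> y"
  using assms by (induction rule: rtranclp_induct) (use exchange_preserves in auto)

text \<open>
  An atom \<open>u\<close> is turned into an atom \<open>v\<close> with the same image one prime at a time: a prime \<open>q\<close>
  that \<open>v\<close> has in excess occurs in another factor, and is swapped there against a prime \<open>p\<close> that
  \<open>u\<close> has in excess and that carries the same label.
\<close>

lemma exchange_towards:
  assumes "atom u" "v \<in> H" "\<theta> v = \<theta> u" "\<forall>x\<in>#y. atom x" "v dvd u * prod_mset y"
  shows "\<exists>y'. exchange\<^sup>*\<^sup>* (add_mset u y) (add_mset v y')"
  using assms
proof (induction "size (prime_factorization v - prime_factorization u)" arbitrary: u y rule: less_induct)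
  case less
  let ?A = "prime_factorization u" and ?B = "prime_factorization v"
  have uH: "u \<in> H" using less.prems(1) atom_H by blast
  have im: "image_mset F ?A = image_mset F ?B" using less.prems \<theta>_eq uH by simp
  show ?case
  proof (cases "?B - ?A = {#}")
    case True
    then have "?B \<subseteq># ?A" by (simp add: Diff_eq_empty_iff_mset)
    moreover have "size ?B = size ?A" using im by (metis size_image_mset)
    ultimately have "?B = ?A" by (metis mset_subset_size subset_mset.le_imp_less_or_eq less_irrefl)
    then have "v = u" using prime_factorization_unique[of v u] pos uH less.prems by simp
    then show ?thesis by blast
  next
    case False
    then obtain q where q: "q \<in># ?B - ?A" by blast
    have "image_mset F (?A - ?B) = image_mset F (?B - ?A)"
    proof -
      have "?A = (?A \<inter># ?B) + (?A - ?B)" "?B = (?A \<inter># ?B) + (?B - ?A)"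
        by (auto simp: multiset_eq_iff)
      with im show ?thesis by (metis add_left_cancel image_mset_union)
    qed
    then obtain p where p: "p \<in># ?A - ?B" "F p = F q"
      using q by (metis (no_types, lifting) imageE image_eqI set_image_mset)
    have pA: "p \<in># ?A" and qB: "q \<in># ?B" using p q by (meson in_diffD)+
    have pr: "Factorial_Ring.prime p" "Factorial_Ring.prime q" "p \<in> Q" "q \<in> Q"
      using pA qB uH less.prems(2) H_iff by auto
    obtain r where r: "u = p * r" using pA by auto
    have ypos: "prod_mset y > 0"
      using less.prems(4) atom_H pos by (auto intro!: Nat.gr0I simp: prod_mset_zero_iff)
    have "count ?A q < count ?B q" using q by (simp add: in_diff_count)
    moreover have "?B \<subseteq># ?A + prime_factorization (prod_mset y)"
      using less.prems(5) pos[OF uH] ypos pos[OF less.prems(2)]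
      by (metis dvd_0_left_iff mult_is_0 not_gr_zero prime_factorization_mult prime_factorization_subset_iff_dvd)
    then have "count ?B q \<le> count ?A q + count (prime_factorization (prod_mset y)) q"
      by (metis count_union mset_subset_eq_count)
    ultimately have "count (prime_factorization (prod_mset y)) q > 0" by linarith
    then have "q dvd prod_mset y" by (metis count_greater_zero_iff in_prime_factors_iff)
    then obtain x where x: "x \<in># y" "q dvd x" using pr prime_dvd_prod_mset_iff by blast
    then obtain s where s: "x = q * s" by blast
    obtain y0 where y0: "y = add_mset x y0" using x by (meson multi_member_split)
    have xH: "x \<in> H" and xat: "atom x" using x less.prems atom_H by auto
    define u' x' where "u' = q * r" and "x' = p * s"
    have rs: "r > 0" "s > 0" using r s pos[OF uH] pos[OF xH] by auto
    have pfs: "?A = add_mset p (prime_factorization r)"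
      "prime_factorization u' = add_mset q (prime_factorization r)"
      "prime_factorization x = add_mset q (prime_factorization s)"
      "prime_factorization x' = add_mset p (prime_factorization s)"
      using rs pr unfolding r s u'_def x'_def
      by (auto simp: prime_factorization_mult prime_factorization_prime)
    have u'H: "u' \<in> H" and x'H: "x' \<in> H"
      using uH xH pfs p(2) pr rs by (auto simp: H_iff u'_def x'_def prime_gt_0_nat)
    have \<theta>': "\<theta> u' = \<theta> u" "\<theta> x' = \<theta> x"
      using \<theta>_eq[OF u'H] \<theta>_eq[OF uH] \<theta>_eq[OF x'H] \<theta>_eq[OF xH] pfs p(2) by auto
    have at: "atom u'" "atom x'"
      using atom_cong_\<theta>[OF less.prems(1) u'H] atom_cong_\<theta>[OF xat x'H] \<theta>' by auto
    have prod: "u * x = u' * x'" unfolding r s u'_def x'_def by simp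
    have ex: "exchange (add_mset u y) (add_mset u' (add_mset x' y0))"
      unfolding exchange_def y0 using \<theta>' at prod
      by (intro exI[of _ u] exI[of _ x] exI[of _ u'] exI[of _ x'] exI[of _ y0]) auto
    have sm: "size (?B - prime_factorization u') < size (?B - ?A)"
    proof -
      have "count ?A p > count ?B p" using p(1) by (simp add: in_diff_count)
      have "q \<noteq> p" using p(1) q by (auto simp: in_diff_count)
      have "?B - prime_factorization u' \<subset># ?B - ?A"
      proof (rule subset_mset.le_neq_trans)
        have "count ?B p \<le> count (prime_factorization r) p"
          using \<open>count ?A p > count ?B p\<close> pfs by simp
        then show "?B - prime_factorization u' \<subseteq># ?B - ?A"
          unfolding pfs by (auto simp: subseteq_mset_def)
        have "count (?B - prime_factorization u') q < count (?B - ?A) q"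
          using \<open>count ?A q < count ?B q\<close> \<open>q \<noteq> p\<close> unfolding pfs by simp
        then show "?B - prime_factorization u' \<noteq> ?B - ?A" by (metis less_irrefl)
      qed
      then show ?thesis by (rule mset_subset_size)
    qed
    have "\<exists>y'. exchange\<^sup>*\<^sup>* (add_mset u' (add_mset x' y0)) (add_mset v y')"
      using less.hyps[OF sm at(1) less.prems(2), of "add_mset x' y0"] less.prems y0 \<theta>' at prod
      by (simp add: mult.assoc[symmetric])
    with ex show ?thesis by (meson converse_rtranclp_into_rtranclp)
  qed
qed

text \<open>
  Choose an atom \<open>v\<close> of \<open>z\<close> with the same image as the first atom of \<open>y\<close>, turn that atom into \<open>v\<close>,
  cancel \<open>v\<close> on both sides and continue with the remaining atoms.
\<close>

lemma exchanges_connect: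
  assumes "\<forall>u\<in>#y. atom u" "\<forall>u\<in>#z. atom u" "prod_mset y = prod_mset z"
    "image_mset \<theta> y = image_mset \<theta> z"
  shows "exchange\<^sup>*\<^sup>* y z"
  using assms
proof (induction y arbitrary: z rule: measure_induct_rule[of size])
  case (less y)
  show ?case
  proof (cases y)
    case empty
    then show ?thesis using less.prems by simp
  next
    case (add u y0)
    then have "\<theta> u \<in># image_mset \<theta> z" using less.prems(4) by (metis add_mset_add_single image_mset_add_mset union_single_eq_member)
    then obtain v where v: "v \<in># z" "\<theta> v = \<theta> u" by auto
    then obtain z0 where z0: "z = add_mset v z0" by (meson multi_member_split)
    have "v dvd u * prod_mset y0"
      using less.prems(3) unfolding add z0 by (metis dvd_triv_left prod_mset.add_mset)
    then obtain y' where y': "exchange\<^sup>*\<^sup>* y (add_mset v y')"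
      using exchange_towards[of u v y0] less.prems v atom_H unfolding add by auto
    from exchanges_preserve[OF this less.prems(1)]
    have pres: "\<forall>x\<in>#y'. atom x" "v * prod_mset y' = v * prod_mset z0"
      "add_mset (\<theta> v) (image_mset \<theta> y') = add_mset (\<theta> v) (image_mset \<theta> z0)"
      using less.prems(3,4) z0 by auto
    have "v > 0" using v less.prems atom_H pos by blast
    then have "prod_mset y' = prod_mset z0" "image_mset \<theta> y' = image_mset \<theta> z0"
      using pres by auto
    moreover have "size y' < size y"
    proof -
      have "size y = size (add_mset v y')"
        using exchanges_preserve[OF y' less.prems(1)] by (metis size_image_mset)
      then show ?thesis by simp
    qed
    ultimately have "exchange\<^sup>*\<^sup>* y' z0"
      using less.IH[of y' z0] pres(1) less.prems(2) z0 by auto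
    from exchanges_add[OF this, of v] y' show ?thesis unfolding z0 by simp
  qed
qed

lemma factorization_dist_exchange:
  assumes "exchange y z"
  shows "factorization_dist (image_mset (\<lambda>u. {u}) y) (image_mset (\<lambda>u. {u}) z) \<le> 2"
proof -
  have bound: "size (X - X \<inter># Y) \<le> 2" if "R \<subseteq># X \<inter># Y" "size X = size R + 2" for X Y R :: "nat set multiset"
    using that size_mset_mono[of R "X \<inter># Y"] size_Diff_submset[of "X \<inter># Y" X] by auto
  from assms obtain a b c d r where "y = {#a, b#} + r" "z = {#c, d#} + r"
    unfolding exchange_def by blast
  then have X: "image_mset (\<lambda>u. {u}) y = {#{a}, {b}#} + image_mset (\<lambda>u. {u}) r"
    and Y: "image_mset (\<lambda>u. {u}) z = {#{c}, {d}#} + image_mset (\<lambda>u. {u}) r" by simp_all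
  then have "image_mset (\<lambda>u. {u}) r \<subseteq># image_mset (\<lambda>u. {u}) y \<inter># image_mset (\<lambda>u. {u}) z"
    unfolding X Y by (intro subset_mset.inf_greatest mset_subset_eq_add_right)
  moreover have "size (image_mset (\<lambda>u. {u}) y) = size (image_mset (\<lambda>u. {u}) r) + 2"
    "size (image_mset (\<lambda>u. {u}) z) = size (image_mset (\<lambda>u. {u}) r) + 2"
    unfolding X Y by simp_all
  ultimately show ?thesis
    unfolding factorization_dist_def max.bounded_iff
    by (metis bound subset_mset.inf_commute)
qed

theorem fibre_catenary_le_2: "fibre_catenary HM BM \<theta> \<le> 2"
  unfolding fibre_catenary_def
proof (rule SUP_least)
  let ?s = "image_mset (\<lambda>u::nat. {u})"
  fix a assume "a \<in> carrier HM"
  show "fibre_catenary_elem HM BM \<theta> a \<le> 2"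
    unfolding fibre_catenary_elem_def
  proof (rule Least_le, intro ballI impI)
    fix z z'
    assume z: "z \<in> factorizations_of HM a" "z' \<in> factorizations_of HM a"
      and same: "factorization_map BM \<theta> z = factorization_map BM \<theta> z'"
    then obtain y y' where y: "z = ?s y" "\<forall>u\<in>#y. atom u" "prod_mset y = a"
      and y': "z' = ?s y'" "\<forall>u\<in>#y'. atom u" "prod_mset y' = a"
      unfolding factorizations_of_HM by blast
    have "inj (image_mset (\<lambda>M :: 'g multiset. {M}))"
      by (intro multiset.inj_map injI) auto
    then have "image_mset \<theta> y = image_mset \<theta> y'"
      using same unfolding y(1) y'(1) factorization_map_singletons by (simp add: inj_eq)
    then have "exchange\<^sup>*\<^sup>* y y'" using exchanges_connect y y' by simp
    then obtain k f where f: "f 0 = y" "f k = y'" "\<And>i. i < k \<Longrightarrow> exchange (f i) (f (Suc i))"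
      by (metis rtranclp_imp_relpowp relpowp_fun_conv)
    have "exchange\<^sup>*\<^sup>* y (f i)" if "i \<le> k" for i
      using that
    proof (induction i)
      case (Suc i)
      then show ?case using f(3)[of i] by (auto intro: rtranclp.rtrancl_into_rtrancl)
    qed (simp add: f(1))
    then have pres: "(\<forall>u\<in>#f i. atom u) \<and> prod_mset (f i) = a \<and> image_mset \<theta> (f i) = image_mset \<theta> y"
      if "i \<le> k" for i
      using exchanges_preserve[of y "f i"] y that by simp
    show "\<exists>k zs. zs 0 = z \<and> zs k = z' \<and>
           (\<forall>i\<le>k. zs i \<in> factorizations_of HM a \<and>
              factorization_map BM \<theta> (zs i) = factorization_map BM \<theta> z) \<and>
           (\<forall>i<k. enat (factorization_dist (zs i) (zs (Suc i))) \<le> 2)"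
    proof (intro exI[of _ k] exI[of _ "\<lambda>i. ?s (f i)"] conjI allI impI)
      show "enat (factorization_dist (?s (f i)) (?s (f (Suc i)))) \<le> 2" if "i < k" for i
        using factorization_dist_exchange[OF f(3)[OF that]] by (simp add: numeral_eq_enat)
      show "?s (f i) \<in> factorizations_of HM a" if "i \<le> k" for i
        using pres[OF that] unfolding factorizations_of_HM by blast
      show "factorization_map BM \<theta> (?s (f i)) = factorization_map BM \<theta> z" if "i \<le> k" for i
        unfolding y(1) factorization_map_singletons using pres[OF that] by simp
    qed (simp_all add: f y(1) y'(1))
  qed
qed

end


section \<open>Quadratic fields and their conjugation\<close>

lemma ring_on_simps [simp]:
  "carrier (ring_on S) = S" "x \<otimes>\<^bsub>ring_on S\<^esub> y = x * y" "\<one>\<^bsub>ring_on S\<^esub> = 1"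
  "\<zero>\<^bsub>ring_on S\<^esub> = 0" "x \<oplus>\<^bsub>ring_on S\<^esub> y = x + y"
  by (simp_all add: ring_on_def)

lemma cring_ring_on:
  assumes "1 \<in> S" "\<And>x y. x \<in> S \<Longrightarrow> y \<in> S \<Longrightarrow> x - y \<in> S" "\<And>x y. x \<in> S \<Longrightarrow> y \<in> S \<Longrightarrow> x * y \<in> S"
  shows "cring (ring_on S)"
proof -
  have 0: "0 \<in> S" using assms(2)[OF assms(1) assms(1)] by simp
  have m: "- x \<in> S" if "x \<in> S" for x using assms(2)[OF 0 that] by simp
  have p: "x + y \<in> S" if "x \<in> S" "y \<in> S" for x y using assms(2)[OF that(1) m[OF that(2)]] by simp
  show ?thesis
  proof (rule cringI)
    show "abelian_group (ring_on S)"
    proof (rule abelian_groupI)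
      show "\<exists>y\<in>carrier (ring_on S). y \<oplus>\<^bsub>ring_on S\<^esub> x = \<zero>\<^bsub>ring_on S\<^esub>"
        if "x \<in> carrier (ring_on S)" for x
        using m that by (intro bexI[of _ "- x"]) auto
    qed (auto simp: 0 p)
    show "Group.comm_monoid (ring_on S)"
      by (rule Group.comm_monoidI) (auto simp: assms)
  qed (auto simp: algebra_simps)
qed

lemma a_inv_ring_on:
  assumes "cring (ring_on S)" "x \<in> S"
  shows "\<ominus>\<^bsub>ring_on S\<^esub> x = - x"
proof -
  interpret cring "ring_on S" by fact
  have "\<ominus>\<^bsub>ring_on S\<^esub> x \<in> S" "(\<ominus>\<^bsub>ring_on S\<^esub> x) + x = 0"
    using assms(2) l_neg[of x] a_inv_closed[of x] by auto
  then show ?thesis by (simp add: eq_neg_iff_add_eq_0)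
qed

lemma additive_subgroup_ring_on_iff:
  assumes "cring (ring_on S)"
  shows "additive_subgroup I (ring_on S) \<longleftrightarrow>
    I \<subseteq> S \<and> 0 \<in> I \<and> (\<forall>x\<in>I. \<forall>y\<in>I. x + y \<in> I) \<and> (\<forall>x\<in>I. - x \<in> I)"
proof
  assume "additive_subgroup I (ring_on S)"
  then interpret additive_subgroup I "ring_on S" .
  interpret R: cring "ring_on S" by fact
  have "- x \<in> I" if "x \<in> I" for x
  proof -
    have "\<ominus>\<^bsub>ring_on S\<^esub> x \<in> I"
      unfolding a_inv_def
      by (rule subgroup.m_inv_closed[OF a_subgroup that])
    moreover have "\<ominus>\<^bsub>ring_on S\<^esub> x = - x"
      using that a_subset by (intro a_inv_ring_on[OF assms]) auto
    ultimately show ?thesis by simp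
  qed
  then show "I \<subseteq> S \<and> 0 \<in> I \<and> (\<forall>x\<in>I. \<forall>y\<in>I. x + y \<in> I) \<and> (\<forall>x\<in>I. - x \<in> I)"
    using a_subset a_closed zero_closed by auto
next
  assume I: "I \<subseteq> S \<and> 0 \<in> I \<and> (\<forall>x\<in>I. \<forall>y\<in>I. x + y \<in> I) \<and> (\<forall>x\<in>I. - x \<in> I)"
  interpret R: cring "ring_on S" by fact
  have "subgroup I (add_monoid (ring_on S))"
  proof (rule group.subgroupI)
    show "group (add_monoid (ring_on S))" by (rule R.a_group)
    fix x assume x: "x \<in> I"
    then have "\<ominus>\<^bsub>ring_on S\<^esub> x = - x" using I by (intro a_inv_ring_on[OF assms]) auto
    then have "inv\<^bsub>add_monoid (ring_on S)\<^esub> x = - x" unfolding a_inv_def .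
    then show "inv\<^bsub>add_monoid (ring_on S)\<^esub> x \<in> I" using I x by auto
  qed (use I in auto)
  then show "additive_subgroup I (ring_on S)" by (rule additive_subgroup.intro)
qed


locale quadratic =
  fixes \<Delta> :: int
  assumes nonsquare: "\<nexists>k. \<Delta> = k\<^sup>2"
    and mod4: "\<Delta> mod 4 = 0 \<or> \<Delta> mod 4 = 1"
begin

definition \<delta> :: complex where "\<delta> = csqrt (of_int \<Delta>)"

abbreviation K :: "complex set" where "K \<equiv> quad_field \<Delta>"

lemma \<delta>_sq: "\<delta> * \<delta> = of_int \<Delta>"
  unfolding \<delta>_def by (metis power2_csqrt power2_eq_square)

lemma \<Delta>_nonzero: "\<Delta> \<noteq> 0" using nonsquare by (metis zero_power2)

lemma \<delta>_nonzero: "\<delta> \<noteq> 0" using \<delta>_sq \<Delta>_nonzero by auto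

lemma \<delta>_irrational: "\<delta> \<notin> \<rat>"
proof
  assume "\<delta> \<in> \<rat>"
  moreover have "algebraic_int \<delta>"
    unfolding \<delta>_def by (intro algebraic_int_csqrt int_imp_algebraic_int) auto
  ultimately have "\<delta> \<in> \<int>" using rational_algebraic_int_is_int by blast
  then obtain k where "\<delta> = of_int k" by (auto elim: Ints_cases)
  then have "(of_int \<Delta> :: complex) = of_int (k\<^sup>2)" using \<delta>_sq by (simp add: power2_eq_square)
  then show False using nonsquare by (simp only: of_int_eq_iff) blast
qed

lemma rational_basis:
  assumes "x \<in> \<rat>" "y \<in> \<rat>" "x + y * \<delta> = 0"
  shows "x = 0 \<and> y = 0"
proof (cases "y = 0")
  case False
  then have "\<delta> = - x / y" using assms(3) by (simp add: field_simps eq_neg_iff_add_eq_0)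
  then show ?thesis using assms \<delta>_irrational by (metis Rats_divide Rats_minus_iff)
qed (use assms in auto)

lemma rational_coords:
  assumes "x \<in> \<rat>" "y \<in> \<rat>" "x' \<in> \<rat>" "y' \<in> \<rat>" "x + y * \<delta> = x' + y' * \<delta>"
  shows "x = x'" "y = y'"
  using rational_basis[of "x - x'" "y - y'"] assms by (auto simp: algebra_simps)

lemma K_iff: "z \<in> K \<longleftrightarrow> (\<exists>x\<in>\<rat>. \<exists>y\<in>\<rat>. z = x + y * \<delta>)"
  unfolding quad_field_def \<delta>_def by blast

lemma K_intro: "x \<in> \<rat> \<Longrightarrow> y \<in> \<rat> \<Longrightarrow> x + y * \<delta> \<in> K"
  unfolding K_iff by blast

lemma K_cases:
  assumes "z \<in> K"
  obtains x y where "x \<in> \<rat>" "y \<in> \<rat>" "z = x + y * \<delta>"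
  using assms unfolding K_iff by blast

lemma Rats_K: "x \<in> \<rat> \<Longrightarrow> x \<in> K"
  using K_intro[of x 0] by simp

lemma \<delta>_K [simp]: "\<delta> \<in> K" using K_intro[of 0 1] by simp

lemma K_simps [simp]: "0 \<in> K" "1 \<in> K" "of_int n \<in> K" "of_nat k \<in> K" "numeral w \<in> K"
  by (auto intro: Rats_K)

lemma K_add [simp]: "z \<in> K \<Longrightarrow> w \<in> K \<Longrightarrow> z + w \<in> K"
proof (elim K_cases)
  fix x y x' y' assume "x \<in> \<rat>" "y \<in> \<rat>" "z = x + y * \<delta>" "x' \<in> \<rat>" "y' \<in> \<rat>" "w = x' + y' * \<delta>"
  then show "z + w \<in> K" using K_intro[of "x + x'" "y + y'"] by (simp add: algebra_simps)
qed

lemma mult_expand: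
  "(x + y * \<delta>) * (x' + y' * \<delta>) = (x * x' + of_int \<Delta> * y * y') + (x * y' + x' * y) * \<delta>"
  unfolding \<delta>_sq[symmetric] by (simp add: algebra_simps)

lemma K_mult [simp]: "z \<in> K \<Longrightarrow> w \<in> K \<Longrightarrow> z * w \<in> K"
  by (elim K_cases) (simp add: mult_expand K_intro)

lemma K_minus [simp]: "z \<in> K \<Longrightarrow> - z \<in> K"
  using K_mult[of "- 1" z] K_simps(3)[of "- 1"] by simp

lemma K_diff [simp]: "z \<in> K \<Longrightarrow> w \<in> K \<Longrightarrow> z - w \<in> K"
  using K_add[of z "- w"] by simp

text \<open>
  The nontrivial automorphism of the field, defined by coordinates because only on an imaginary
  field does it agree with complex conjugation.
\<close>

definition cj :: "complex \<Rightarrow> complex" where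
  "cj z = (THE w. \<exists>x\<in>\<rat>. \<exists>y\<in>\<rat>. z = x + y * \<delta> \<and> w = x - y * \<delta>)"

lemma cj_eval:
  assumes "x \<in> \<rat>" "y \<in> \<rat>"
  shows "cj (x + y * \<delta>) = x - y * \<delta>"
  unfolding cj_def
proof (rule the_equality)
  fix w assume "\<exists>x'\<in>\<rat>. \<exists>y'\<in>\<rat>. x + y * \<delta> = x' + y' * \<delta> \<and> w = x' - y' * \<delta>"
  then show "w = x - y * \<delta>" using rational_coords[OF assms] by auto
qed (use assms in blast)

lemma cj_Rats [simp]: "x \<in> \<rat> \<Longrightarrow> cj x = x"
  using cj_eval[of x 0] by simp

lemma cj_simps [simp]: "cj 0 = 0" "cj 1 = 1" "cj (of_int n) = of_int n" "cj (of_nat k) = of_nat k"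
  "cj (numeral w) = numeral w" "cj \<delta> = - \<delta>"
  using cj_eval[of 0 1] by simp_all

lemma cj_K [simp]: "z \<in> K \<Longrightarrow> cj z \<in> K"
proof (elim K_cases)
  fix x y assume "x \<in> \<rat>" "y \<in> \<rat>" "z = x + y * \<delta>"
  then show "cj z \<in> K" using cj_eval[of x y] K_intro[of x "- y"] by simp
qed

lemma cj_add [simp]: "z \<in> K \<Longrightarrow> w \<in> K \<Longrightarrow> cj (z + w) = cj z + cj w"
proof (elim K_cases)
  fix x y x' y' assume "x \<in> \<rat>" "y \<in> \<rat>" "z = x + y * \<delta>" "x' \<in> \<rat>" "y' \<in> \<rat>" "w = x' + y' * \<delta>"
  moreover from this have "z + w = (x + x') + (y + y') * \<delta>" by (simp add: algebra_simps)
  then have "cj (z + w) = (x + x') - (y + y') * \<delta>"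
    using calculation cj_eval[of "x + x'" "y + y'"] by (simp only: Rats_add)
  ultimately show "cj (z + w) = cj z + cj w" by (simp add: cj_eval ring_distribs)
qed

lemma cj_mult [simp]: "z \<in> K \<Longrightarrow> w \<in> K \<Longrightarrow> cj (z * w) = cj z * cj w"
proof (elim K_cases)
  fix x y x' y' assume *: "x \<in> \<rat>" "y \<in> \<rat>" "z = x + y * \<delta>" "x' \<in> \<rat>" "y' \<in> \<rat>" "w = x' + y' * \<delta>"
  then have "cj (z * w) = (x * x' + of_int \<Delta> * y * y') - (x * y' + x' * y) * \<delta>"
    by (simp add: mult_expand cj_eval)
  then show "cj (z * w) = cj z * cj w"
    using * by (simp add: cj_eval algebra_simps flip: \<delta>_sq)
qed

lemma cj_cj [simp]: "z \<in> K \<Longrightarrow> cj (cj z) = z"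
proof (elim K_cases)
  fix x y assume "x \<in> \<rat>" "y \<in> \<rat>" "z = x + y * \<delta>"
  then show "cj (cj z) = z" using cj_eval[of x y] cj_eval[of x "- y"] by simp
qed

lemma cj_minus [simp]: "z \<in> K \<Longrightarrow> cj (- z) = - cj z"
  using cj_mult[of "- 1" z] K_simps(3)[of "- 1"] cj_simps(3)[of "- 1"] by simp

lemma cj_eq_0_iff [simp]: "z \<in> K \<Longrightarrow> cj z = 0 \<longleftrightarrow> z = 0"
  by (metis cj_cj cj_simps(1))

lemma norm_Rats: "z \<in> K \<Longrightarrow> z * cj z \<in> \<rat>"
proof (elim K_cases)
  fix x y assume *: "x \<in> \<rat>" "y \<in> \<rat>" "z = x + y * \<delta>"
  then have "z * cj z = x * x - of_int \<Delta> * y * y"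
    by (simp add: cj_eval algebra_simps flip: \<delta>_sq)
  then show "z * cj z \<in> \<rat>" using * by simp
qed

lemma K_inverse [simp]:
  assumes "z \<in> K" shows "inverse z \<in> K"
proof (cases "z = 0")
  case False
  then have "z * cj z \<noteq> 0" using assms by simp
  then have "inverse z = inverse (z * cj z) * cj z" by simp
  moreover have "inverse (z * cj z) \<in> \<rat>" using norm_Rats[OF assms] by (rule Rats_inverse)
  then have "inverse (z * cj z) \<in> K" by (rule Rats_K)
  ultimately show ?thesis using assms by (metis K_mult cj_K)
qed simp

lemma K_divide [simp]: "z \<in> K \<Longrightarrow> w \<in> K \<Longrightarrow> z / w \<in> K"
  by (simp add: divide_inverse)

lemma cj_inverse [simp]: "z \<in> K \<Longrightarrow> cj (inverse z) = inverse (cj z)"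
proof (cases "z = 0")
  case False
  assume z: "z \<in> K"
  have "cj z * cj (inverse z) = 1" using cj_mult[OF z K_inverse[OF z]] False by simp
  then show ?thesis by (rule inverse_unique[symmetric])
qed simp

lemma cj_divide [simp]: "z \<in> K \<Longrightarrow> w \<in> K \<Longrightarrow> cj (z / w) = cj z / cj w"
  by (simp add: divide_inverse)

lemma cring_K: "cring (ring_on K)"
  by (rule cring_ring_on) auto


subsection \<open>Embeddings and total positivity\<close>

text \<open>An embedding fixes \<open>\<rat>\<close> and maps \<open>\<delta>\<close> to a root of \<open>X\<^sup>2 - \<Delta>\<close>.\<close>

lemma embedding_cases:
  assumes "\<sigma> \<in> field_embeddings K"
  shows "(\<forall>z\<in>K. \<sigma> z = z) \<or> (\<forall>z\<in>K. \<sigma> z = cj z)"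
proof -
  have add: "\<sigma> (x + y) = \<sigma> x + \<sigma> y" and mult: "\<sigma> (x * y) = \<sigma> x * \<sigma> y"
    if "x \<in> K" "y \<in> K" for x y
    using ring_hom_add[OF assms, of x y] ring_hom_mult[OF assms, of x y] that by auto
  have one: "\<sigma> 1 = 1" using ring_hom_one[OF assms] by simp
  have zero: "\<sigma> 0 = 0" using add[of 0 0] by simp
  have nat: "\<sigma> (of_nat n) = of_nat n" for n
    by (induction n) (auto simp: zero add one)
  have int: "\<sigma> (of_int k) = of_int k" for k
  proof (cases k)
    case (neg n)
    have "\<sigma> (of_int k) + \<sigma> (of_nat (Suc n)) = \<sigma> (of_int k + of_nat (Suc n))"
      by (rule add[symmetric]) auto
    also have "of_int k + of_nat (Suc n) = (0 :: complex)" using neg by simp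
    finally have "\<sigma> (of_int k) = - of_nat (Suc n)"
      unfolding nat zero by (simp only: eq_neg_iff_add_eq_0)
    then show ?thesis using neg by simp
  qed (simp add: nat)
  have rat: "\<sigma> x = x" if "x \<in> \<rat>" for x
  proof -
    from that obtain a b where ab: "b > 0" "x = of_int a / of_int b" by (auto elim: Rats_cases')
    then have ba: "of_int b * x = of_int a" by simp
    have "of_int b * \<sigma> x = \<sigma> (of_int b * x)"
      using mult[of "of_int b" x] that int by (simp add: Rats_K)
    also have "\<dots> = of_int b * x" unfolding ba by (rule int)
    finally show ?thesis using ab(1) by simp
  qed
  have ev: "\<sigma> (x + y * \<delta>) = x + y * \<sigma> \<delta>" if "x \<in> \<rat>" "y \<in> \<rat>" for x y
    using that add[of x "y * \<delta>"] mult[of y \<delta>] rat by (simp add: Rats_K)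
  have "\<sigma> \<delta> * \<sigma> \<delta> = \<delta> * \<delta>"
    using mult[of \<delta> \<delta>] int[of \<Delta>] \<delta>_sq by simp
  then consider "\<sigma> \<delta> = \<delta>" | "\<sigma> \<delta> = - \<delta>" by (auto simp: square_eq_iff)
  then show ?thesis
  proof cases
    case 1
    then have "\<sigma> z = z" if "z \<in> K" for z using that ev by (elim K_cases) simp
    then show ?thesis by blast
  next
    case 2
    then have "\<sigma> z = cj z" if "z \<in> K" for z using that ev by (elim K_cases) (simp add: cj_eval)
    then show ?thesis by blast
  qed
qed

lemma id_embedding: "(\<lambda>z. z) \<in> field_embeddings K"
  by (rule ring_hom_memI) auto

lemma cj_embedding: "cj \<in> field_embeddings K"
  by (rule ring_hom_memI) auto

lemma K_real: assumes "\<Delta> > 0" "z \<in> K" shows "z \<in> \<real>"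
proof -
  have "\<delta> = of_real (sqrt (of_int \<Delta>))"
    unfolding \<delta>_def using assms(1) csqrt_of_real_nonneg[of "of_int \<Delta>"] by simp
  then have "\<delta> \<in> \<real>" by simp
  moreover have "\<rat> \<subseteq> (\<real> :: complex set)"
    by (auto elim!: Rats_cases' intro!: Reals_divide)
  ultimately show ?thesis using assms(2) by (elim K_cases) (auto intro!: Reals_add Reals_mult)
qed

lemma totally_positive_iff:
  assumes "z \<in> K"
  shows "totally_positive K z \<longleftrightarrow> \<Delta> < 0 \<or> Re z > 0 \<and> Re (cj z) > 0"
proof (cases "\<Delta> < 0")
  case True
  have "\<not> \<sigma> ` K \<subseteq> \<real>" if "\<sigma> \<in> field_embeddings K" for \<sigma>
  proof
    assume "\<sigma> ` K \<subseteq> \<real>"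
    then have "\<sigma> \<delta> \<in> \<real>" by (auto simp: image_subset_iff)
    then have "\<delta> \<in> \<real>" using embedding_cases[OF that] by auto
    then obtain r where "\<delta> = of_real r" by (auto elim: Reals_cases)
    then have "complex_of_real (r * r) = of_real (of_int \<Delta>)" using \<delta>_sq by simp
    then have "r * r = of_int \<Delta>" by (simp only: of_real_eq_iff)
    then show False using True by (metis not_less of_int_less_0_iff zero_le_square)
  qed
  then show ?thesis using True unfolding totally_positive_def by blast
next
  case False
  then have \<Delta>: "\<Delta> > 0" using \<Delta>_nonzero by linarith
  have real: "(\<lambda>z. z) ` K \<subseteq> \<real>" "cj ` K \<subseteq> \<real>" using K_real[OF \<Delta>] by auto
  have "totally_positive K z \<longleftrightarrow> Re z > 0 \<and> Re (cj z) > 0"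
  proof
    assume "totally_positive K z"
    then show "Re z > 0 \<and> Re (cj z) > 0"
      unfolding totally_positive_def using id_embedding cj_embedding real by blast
  next
    assume "Re z > 0 \<and> Re (cj z) > 0"
    then show "totally_positive K z"
      unfolding totally_positive_def using embedding_cases assms by metis
  qed
  then show ?thesis using False by simp
qed

text \<open>
  Zero is excluded explicitly: on an imaginary field there is no real embedding, and
  \<^const>\<open>totally_positive\<close> holds for every element.
\<close>

definition pos :: "complex \<Rightarrow> bool" where
  "pos z \<longleftrightarrow> z \<in> K \<and> z \<noteq> 0 \<and> totally_positive K z"

lemma pos_iff: "pos z \<longleftrightarrow> z \<in> K \<and> z \<noteq> 0 \<and> (\<Delta> < 0 \<or> Re z > 0 \<and> Re (cj z) > 0)"
  unfolding pos_def using totally_positive_iff by blast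

lemma Re_mult_real: "\<Delta> > 0 \<Longrightarrow> z \<in> K \<Longrightarrow> w \<in> K \<Longrightarrow> Re (z * w) = Re z * Re w"
  using K_real[of z] K_real[of w] by (auto elim!: Reals_cases)

lemma cj_eq_cnj: assumes "\<Delta> < 0" "z \<in> K" shows "cj z = cnj z"
proof -
  have "cnj \<delta> \<in> {\<delta>, - \<delta>}"
  proof -
    have "cnj \<delta> * cnj \<delta> = \<delta> * \<delta>" using \<delta>_sq by (metis complex_cnj_mult complex_cnj_of_int)
    then show ?thesis by (simp add: square_eq_iff)
  qed
  moreover have "cnj \<delta> \<noteq> \<delta>"
  proof
    assume "cnj \<delta> = \<delta>"
    then have "\<delta> \<in> \<real>" by (simp add: Reals_cnj_iff)
    then have "0 \<le> Re (\<delta> * \<delta>)" by (auto elim!: Reals_cases)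
    then show False using \<delta>_sq assms(1) by simp
  qed
  ultimately have "cnj \<delta> = - \<delta>" by blast
  moreover have "cnj x = x" if "x \<in> \<rat>" for x
    using that by (auto elim!: Rats_cases')
  ultimately show ?thesis using assms(2) by (elim K_cases) (simp add: cj_eval)
qed

text \<open>
  A norm is a positive definite form on an imaginary field and the product of the two real
  conjugates on a real one.  In both cases, up to the sign of the element, total positivity means
  positive norm.
\<close>

lemma pos_norm: assumes "pos z" shows "Re (z * cj z) > 0"
proof (cases "\<Delta> < 0")
  case True
  then have "z * cj z = of_real ((norm z)\<^sup>2)"
    using assms cj_eq_cnj[of z] unfolding pos_def complex_norm_square by simp
  then show ?thesis using assms unfolding pos_def by simp
next
  case False
  then have "\<Delta> > 0" using \<Delta>_nonzero by linarith
  then show ?thesis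
    using assms False unfolding pos_iff by (subst Re_mult_real) auto
qed

lemma pos_of_norm: assumes "z \<in> K" "Re (z * cj z) > 0" shows "pos z \<or> pos (- z)"
proof (cases "\<Delta> < 0")
  case True
  then show ?thesis using assms unfolding pos_iff by auto
next
  case False
  then have "\<Delta> > 0" using \<Delta>_nonzero by linarith
  then have "Re z * Re (cj z) > 0" using assms Re_mult_real[of z "cj z"] by (simp only: cj_K)
  then show ?thesis using assms unfolding pos_iff by (auto simp: zero_less_mult_iff)
qed

lemma pos_mult: assumes "pos z" "pos w" shows "pos (z * w)"
proof (cases "\<Delta> < 0")
  case False
  then have "\<Delta> > 0" using \<Delta>_nonzero by linarith
  then show ?thesis using assms Re_mult_real[of z w] Re_mult_real[of "cj z" "cj w"]
    unfolding pos_iff by (simp del: times_complex.sel)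
qed (use assms in \<open>auto simp: pos_iff\<close>)

lemma pos_inverse: assumes "pos z" shows "pos (inverse z)"
proof (cases "\<Delta> < 0")
  case False
  have inv: "Re (inverse w) > 0" if "w \<in> K" "Re w > 0" for w
  proof -
    have "w \<in> \<real>" using K_real[of w] that False \<Delta>_nonzero by simp
    then obtain r where "w = of_real r" by (rule Reals_cases)
    then show ?thesis using that(2) by (simp flip: of_real_inverse)
  qed
  show ?thesis
    using assms False inv[of z] inv[of "cj z"] unfolding pos_iff
    by (simp del: inverse_complex.sel)
qed (use assms in \<open>auto simp: pos_iff\<close>)

lemma pos_Rats: assumes "x \<in> \<rat>" "Re x > 0" shows "pos x"
  using assms by (auto simp: pos_iff Rats_K)

lemma pos_of_nat: "n > 0 \<Longrightarrow> pos (of_nat n)" by (rule pos_Rats) auto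

lemma pos_1: "pos 1" using pos_of_nat[of 1] by simp

lemma pos_K: "pos z \<Longrightarrow> z \<in> K" and pos_nz: "pos z \<Longrightarrow> z \<noteq> 0" by (auto simp: pos_def)


section \<open>The quadratic order and its narrow class group\<close>

abbreviation Ord :: "complex set" where "Ord \<equiv> quad_order \<Delta>"

definition \<omega> :: complex where "\<omega> = (of_int (\<Delta> mod 4) + \<delta>) / 2"

lemma \<omega>_K [simp]: "\<omega> \<in> K" by (simp add: \<omega>_def)

lemma cj_\<omega>: "cj \<omega> = of_int (\<Delta> mod 4) - \<omega>"
  by (simp add: \<omega>_def field_simps)

lemma \<omega>_sq: "\<omega> * \<omega> = of_int (\<Delta> mod 4) * \<omega> + of_int (\<Delta> div 4)"
proof -
  have "\<Delta> = 4 * (\<Delta> div 4) + (\<Delta> mod 4)" by simp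
  then have "(of_int \<Delta> :: complex) = 4 * of_int (\<Delta> div 4) + of_int (\<Delta> mod 4)"
    by (metis of_int_add of_int_mult of_int_numeral)
  moreover have "(of_int (\<Delta> mod 4) :: complex) * of_int (\<Delta> mod 4) = of_int (\<Delta> mod 4)"
    using mod4 by auto
  moreover have "4 * (\<omega> * \<omega>) = of_int (\<Delta> mod 4) * of_int (\<Delta> mod 4) + 2 * of_int (\<Delta> mod 4) * \<delta> + \<delta> * \<delta>"
    unfolding \<omega>_def by (simp add: field_simps)
  ultimately have "4 * (\<omega> * \<omega>) = 4 * (of_int (\<Delta> mod 4) * \<omega> + of_int (\<Delta> div 4))"
    unfolding \<delta>_sq by (simp add: \<omega>_def field_simps)
  then show ?thesis by (subst (asm) mult_left_cancel) auto
qed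

lemma Ord_iff: "z \<in> Ord \<longleftrightarrow> (\<exists>x y. z = of_int x + of_int y * \<omega>)"
  unfolding quad_order_def \<omega>_def \<delta>_def by blast

lemma Ord_intro: "of_int x + of_int y * \<omega> \<in> Ord" unfolding Ord_iff by blast

lemma Ord_cases:
  assumes "z \<in> Ord" obtains x y where "z = of_int x + of_int y * \<omega>"
  using assms unfolding Ord_iff by blast

lemma Ord_coords:
  assumes "of_int x + of_int y * \<omega> = of_int x' + of_int y' * \<omega>"
  shows "x = x'" "y = y'"
proof -
  let ?s = "\<Delta> mod 4"
  have "(of_int (2 * x + y * ?s) / 2 + of_int y / 2 * \<delta>) = (of_int (2 * x' + y' * ?s) / 2 + of_int y' / 2 * \<delta>)"
    using assms unfolding \<omega>_def by (simp add: field_simps)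
  from rational_coords[OF _ _ _ _ this]
  have "(of_int (2 * x + y * ?s) :: complex) = of_int (2 * x' + y' * ?s)" "(of_int y :: complex) = of_int y'"
    by auto
  then show "x = x'" "y = y'" by (simp_all only: of_int_eq_iff)
qed

lemma Ord_K: "z \<in> Ord \<Longrightarrow> z \<in> K"
  by (elim Ord_cases) simp

lemma Ord_int [simp]: "of_int n \<in> Ord" "of_nat k \<in> Ord" "0 \<in> Ord" "1 \<in> Ord"
  using Ord_intro[of n 0] Ord_intro[of "int k" 0] Ord_intro[of 0 0] Ord_intro[of 1 0] by auto

lemma \<omega>_Ord [simp]: "\<omega> \<in> Ord" using Ord_intro[of 0 1] by simp

lemma Ord_add [simp]: "z \<in> Ord \<Longrightarrow> w \<in> Ord \<Longrightarrow> z + w \<in> Ord"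
proof (elim Ord_cases)
  fix x y x' y' assume "z = of_int x + of_int y * \<omega>" "w = of_int x' + of_int y' * \<omega>"
  then show "z + w \<in> Ord" using Ord_intro[of "x + x'" "y + y'"] by (simp add: algebra_simps)
qed

lemma Ord_mult_expand:
  "(of_int x + of_int y * \<omega>) * (of_int x' + of_int y' * \<omega>) =
     of_int (x * x' + \<Delta> div 4 * y * y') + of_int (x * y' + x' * y + \<Delta> mod 4 * y * y') * \<omega>"
proof -
  have "(of_int x + of_int y * \<omega>) * (of_int x' + of_int y' * \<omega>) =
     of_int x * of_int x' + (of_int x * of_int y' + of_int x' * of_int y) * \<omega> + of_int y * of_int y' * (\<omega> * \<omega>)"
    by (simp add: algebra_simps)
  then show ?thesis unfolding \<omega>_sq by (simp add: algebra_simps)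
qed

lemma Ord_mult [simp]: "z \<in> Ord \<Longrightarrow> w \<in> Ord \<Longrightarrow> z * w \<in> Ord"
  by (elim Ord_cases) (simp only: Ord_mult_expand Ord_intro)

lemma Ord_minus [simp]: "z \<in> Ord \<Longrightarrow> - z \<in> Ord"
  using Ord_mult[of "- 1" z] Ord_int(1)[of "- 1"] by simp

lemma Ord_diff [simp]: "z \<in> Ord \<Longrightarrow> w \<in> Ord \<Longrightarrow> z - w \<in> Ord"
  using Ord_add[of z "- w"] by simp

lemma Ord_cj [simp]: "z \<in> Ord \<Longrightarrow> cj z \<in> Ord"
  by (elim Ord_cases) (simp add: cj_\<omega>)

lemma cj_image_Ord: "cj ` Ord = Ord"
proof
  show "Ord \<subseteq> cj ` Ord" using Ord_cj Ord_K cj_cj by (metis image_eqI subsetI)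
qed auto

lemma Ord_Rats: assumes "z \<in> Ord" "z \<in> \<rat>" shows "z \<in> \<int>"
proof -
  from assms(1) obtain x y where z: "z = of_int x + of_int y * \<omega>" by (rule Ord_cases)
  then have e: "z + 0 * \<delta> = of_int (2 * x + y * (\<Delta> mod 4)) / 2 + of_int y / 2 * \<delta>"
    unfolding \<omega>_def by (simp add: field_simps)
  have "0 = (of_int y / 2 :: complex)"
    by (rule rational_coords(2)[OF _ _ _ _ e]) (use assms in auto)
  then show ?thesis using z by auto
qed

lemma cring_Ord: "cring (ring_on Ord)"
  by (rule cring_ring_on) auto

lemma norm_Ord: "(of_int x + of_int y * \<omega>) * cj (of_int x + of_int y * \<omega>) =
    of_int (bqf_eval (1, \<Delta> mod 4, - (\<Delta> div 4)) x y)"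
proof -
  have "(of_int x + of_int y * \<omega>) * cj (of_int x + of_int y * \<omega>) =
      of_int x * of_int x + of_int x * of_int y * of_int (\<Delta> mod 4)
      + of_int y * of_int y * (of_int (\<Delta> mod 4) * \<omega> - \<omega> * \<omega>)"
    by (simp add: cj_\<omega> algebra_simps)
  then show ?thesis unfolding \<omega>_sq by (simp add: power2_eq_square algebra_simps)
qed

lemma K_denominator:
  assumes "z \<in> K" obtains n :: nat where "n > 0" "of_nat n * z \<in> Ord"
proof -
  from assms obtain x y where z: "x \<in> \<rat>" "y \<in> \<rat>" "z = x + y * \<delta>" by (rule K_cases)
  then obtain a b c d where ab: "b > 0" "x = of_int a / of_int b" and cd: "d > 0" "y = of_int c / of_int d"
    by (metis Rats_cases')
  have "of_int (b * d) * z = of_int (a * d) + of_int (c * b) * (2 * \<omega> - of_int (\<Delta> mod 4))"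
    unfolding z(3) ab(2) cd(2) using ab(1) cd(1) by (simp add: \<omega>_def field_simps)
  also have "\<dots> = of_int (a * d - c * b * (\<Delta> mod 4)) + of_int (2 * c * b) * \<omega>"
    by (simp add: algebra_simps)
  finally have "of_int (b * d) * z \<in> Ord" by (simp only: Ord_intro)
  moreover have "of_int (b * d) = (of_nat (nat (b * d)) :: complex)" using ab cd by simp
  ultimately show ?thesis using that[of "nat (b * d)"] ab cd by simp
qed

lemma frac_ideal_iff:
  "frac_ideal \<Delta> I \<longleftrightarrow>
     I \<subseteq> K \<and> (\<exists>x\<in>I. x \<noteq> 0) \<and> (\<forall>x\<in>I. \<forall>y\<in>I. x + y \<in> I) \<and>
     (\<forall>x\<in>Ord. \<forall>y\<in>I. x * y \<in> I) \<and> (\<exists>d\<in>Ord. d \<noteq> 0 \<and> (\<forall>y\<in>I. d * y \<in> Ord))"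
proof
  assume "frac_ideal \<Delta> I"
  then show "I \<subseteq> K \<and> (\<exists>x\<in>I. x \<noteq> 0) \<and> (\<forall>x\<in>I. \<forall>y\<in>I. x + y \<in> I) \<and>
     (\<forall>x\<in>Ord. \<forall>y\<in>I. x * y \<in> I) \<and> (\<exists>d\<in>Ord. d \<noteq> 0 \<and> (\<forall>y\<in>I. d * y \<in> Ord))"
    unfolding frac_ideal_def additive_subgroup_ring_on_iff[OF cring_K] by auto
next
  assume *: "I \<subseteq> K \<and> (\<exists>x\<in>I. x \<noteq> 0) \<and> (\<forall>x\<in>I. \<forall>y\<in>I. x + y \<in> I) \<and>
     (\<forall>x\<in>Ord. \<forall>y\<in>I. x * y \<in> I) \<and> (\<exists>d\<in>Ord. d \<noteq> 0 \<and> (\<forall>y\<in>I. d * y \<in> Ord))"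
  then obtain x where "x \<in> I" "x \<noteq> 0" by blast
  moreover from * have "0 * x \<in> I" using \<open>x \<in> I\<close> Ord_int by blast
  moreover have "- y \<in> I" if "y \<in> I" for y
  proof -
    have "of_int (-1) * y \<in> I" using * that Ord_int(1) by blast
    then show ?thesis by simp
  qed
  ultimately show "frac_ideal \<Delta> I"
    unfolding frac_ideal_def additive_subgroup_ring_on_iff[OF cring_K] using * by auto
qed

lemma frac_ideal_Ord: "frac_ideal \<Delta> Ord"
  unfolding frac_ideal_iff by (auto simp: Ord_K intro!: bexI[of _ 1])

lemma frac_idealD:
  assumes "frac_ideal \<Delta> I"
  shows "x \<in> I \<Longrightarrow> x \<in> K" "x \<in> I \<Longrightarrow> y \<in> I \<Longrightarrow> x + y \<in> I" "z \<in> Ord \<Longrightarrow> x \<in> I \<Longrightarrow> z * x \<in> I"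
  using assms unfolding frac_ideal_iff by auto

abbreviation ip :: "complex set \<Rightarrow> complex set \<Rightarrow> complex set" (infixl \<open>\<bullet>\<close> 70) where
  "I \<bullet> J \<equiv> frac_ideal_mult \<Delta> I J"

lemma ip_prod: "x \<in> I \<Longrightarrow> y \<in> J \<Longrightarrow> x * y \<in> I \<bullet> J"
  using ideal_prod.prod[of x I y J "ring_on K"] by simp

lemma ip_sum: "x \<in> I \<bullet> J \<Longrightarrow> y \<in> I \<bullet> J \<Longrightarrow> x + y \<in> I \<bullet> J"
  using ideal_prod.sum[of x "ring_on K" I J y] by simp

lemma ip_induct [consumes 1, case_names prod sum]:
  assumes "s \<in> I \<bullet> J" "\<And>x y. x \<in> I \<Longrightarrow> y \<in> J \<Longrightarrow> P (x * y)"
    "\<And>x y. x \<in> I \<bullet> J \<Longrightarrow> y \<in> I \<bullet> J \<Longrightarrow> P x \<Longrightarrow> P y \<Longrightarrow> P (x + y)"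
  shows "P s"
  using assms(1) by (induction rule: ideal_prod.induct) (use assms in auto)

lemma ip_subsetI:
  assumes "\<And>x y. x \<in> I \<Longrightarrow> y \<in> J \<Longrightarrow> x * y \<in> M" "\<And>x y. x \<in> M \<Longrightarrow> y \<in> M \<Longrightarrow> x + y \<in> M"
  shows "I \<bullet> J \<subseteq> M"
proof
  fix s assume "s \<in> I \<bullet> J" then show "s \<in> M" by (induction rule: ip_induct) (use assms in auto)
qed

lemma ip_comm: "I \<bullet> J = J \<bullet> I"
proof -
  have "I \<bullet> J \<subseteq> J \<bullet> I" for I J
    by (rule ip_subsetI) (auto simp: ip_sum, metis ip_prod mult.commute)
  then show ?thesis by blast
qed

lemma ip_assoc: "I \<bullet> J \<bullet> L = I \<bullet> (J \<bullet> L)"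
proof -
  have *: "I \<bullet> J \<bullet> L \<subseteq> I \<bullet> (J \<bullet> L)" for I J L
  proof (rule ip_subsetI)
    fix s l assume "s \<in> I \<bullet> J" "l \<in> L"
    then show "s * l \<in> I \<bullet> (J \<bullet> L)"
      by (induction rule: ip_induct) (auto simp: mult.assoc distrib_right ip_prod ip_sum)
  qed (rule ip_sum)
  have "I \<bullet> (J \<bullet> L) = L \<bullet> J \<bullet> I" by (metis ip_comm)
  also have "\<dots> \<subseteq> L \<bullet> (J \<bullet> I)" by (rule *)
  also have "\<dots> = I \<bullet> J \<bullet> L" by (metis ip_comm)
  finally show ?thesis using *[of I J L] by blast
qed

lemma ip_Ord: assumes "frac_ideal \<Delta> I" shows "Ord \<bullet> I = I"
proof
  show "Ord \<bullet> I \<subseteq> I" by (rule ip_subsetI) (use frac_idealD[OF assms] in auto)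
  show "I \<subseteq> Ord \<bullet> I" using ip_prod[of 1 Ord _ I] by auto
qed

lemma frac_ideal_ip:
  assumes I: "frac_ideal \<Delta> I" and J: "frac_ideal \<Delta> J"
  shows "frac_ideal \<Delta> (I \<bullet> J)"
  unfolding frac_ideal_iff
proof (intro conjI ballI)
  show "I \<bullet> J \<subseteq> K" by (rule ip_subsetI) (use frac_idealD[OF I] frac_idealD[OF J] in auto)
  from I J obtain x y where "x \<in> I" "x \<noteq> 0" "y \<in> J" "y \<noteq> 0" unfolding frac_ideal_iff by blast
  then show "\<exists>x\<in>I \<bullet> J. x \<noteq> 0" using ip_prod[of x I y J] by (intro bexI[of _ "x * y"]) auto
  show "z * s \<in> I \<bullet> J" if "z \<in> Ord" "s \<in> I \<bullet> J" for z s
    using that(2)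
  proof (induction rule: ip_induct)
    case (prod x y)
    then show ?case using frac_idealD(3)[OF I that(1)] ip_prod[of "z * x" I y J] by (simp add: mult.assoc)
  next
    case (sum x y)
    then show ?case by (simp add: distrib_left ip_sum)
  qed
  from I J obtain d e where d: "d \<in> Ord" "d \<noteq> 0" "\<forall>y\<in>I. d * y \<in> Ord"
    and e: "e \<in> Ord" "e \<noteq> 0" "\<forall>y\<in>J. e * y \<in> Ord" unfolding frac_ideal_iff by blast
  have "d * e * s \<in> Ord" if "s \<in> I \<bullet> J" for s
    using that
  proof (induction rule: ip_induct)
    case (prod x y)
    then have "(d * x) * (e * y) \<in> Ord" using d e by auto
    then show ?case by (simp add: ac_simps)
  next
    case (sum x y)
    then show ?case by (simp add: distrib_left)
  qed
  then show "\<exists>d\<in>Ord. d \<noteq> 0 \<and> (\<forall>y\<in>I \<bullet> J. d * y \<in> Ord)"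
    using d e by (intro bexI[of _ "d * e"]) auto
qed (rule ip_sum)

definition scale :: "complex \<Rightarrow> complex set \<Rightarrow> complex set" where
  "scale z I = (\<lambda>x. z * x) ` I"

lemma scale_iff: "z \<noteq> 0 \<Longrightarrow> x \<in> scale z I \<longleftrightarrow> x / z \<in> I"
  unfolding scale_def by (force simp: field_simps)

lemma scale_scale: "scale z (scale w I) = scale (z * w) I"
  unfolding scale_def by (auto simp: image_image mult.assoc)

lemma scale_1: "scale 1 I = I" unfolding scale_def by simp

lemma scale_minus:
  assumes "frac_ideal \<Delta> I" shows "scale (- z) I = scale z I"
proof -
  have "- x \<in> I" if "x \<in> I" for x using frac_idealD(3)[OF assms Ord_int(1)[of "-1"] that] by simp
  then show ?thesis unfolding scale_def by (force simp: image_iff)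
qed

lemma ip_scale: "scale z I \<bullet> J = scale z (I \<bullet> J)"
proof
  have "x + y \<in> scale z (I \<bullet> J)" if "x \<in> scale z (I \<bullet> J)" "y \<in> scale z (I \<bullet> J)" for x y
    using that unfolding scale_def by (auto simp: ip_sum simp flip: distrib_left)
  then show "scale z I \<bullet> J \<subseteq> scale z (I \<bullet> J)"
    by (intro ip_subsetI) (auto simp: scale_def mult.assoc ip_prod)
  show "scale z (I \<bullet> J) \<subseteq> scale z I \<bullet> J"
  proof
    fix s assume "s \<in> scale z (I \<bullet> J)"
    then obtain t where t: "t \<in> I \<bullet> J" "s = z * t" unfolding scale_def by blast
    from t(1) have "z * t \<in> scale z I \<bullet> J"
    proof (induction rule: ip_induct)
      case (prod x y)
      then have "z * x \<in> scale z I" unfolding scale_def by (intro imageI)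
      from ip_prod[OF this prod(2)] show ?case by (simp add: mult.assoc)
    qed (simp add: distrib_left ip_sum)
    then show "s \<in> scale z I \<bullet> J" by (simp add: t(2))
  qed
qed

lemma frac_ideal_scale:
  assumes I: "frac_ideal \<Delta> I" and z: "z \<in> K" "z \<noteq> 0"
  shows "frac_ideal \<Delta> (scale z I)"
  unfolding frac_ideal_iff
proof (intro conjI ballI)
  show "scale z I \<subseteq> K" using frac_idealD(1)[OF I] z by (auto simp: scale_def)
  show "\<exists>x\<in>scale z I. x \<noteq> 0" using I z unfolding frac_ideal_iff scale_def by force
  show "x + y \<in> scale z I" if "x \<in> scale z I" "y \<in> scale z I" for x y
    using that frac_idealD(2)[OF I] unfolding scale_def by (auto simp flip: distrib_left)
  show "a * y \<in> scale z I" if a: "a \<in> Ord" and y: "y \<in> scale z I" for a y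
  proof -
    from y obtain x where x: "x \<in> I" "y = z * x" unfolding scale_def by blast
    have "a * y = z * (a * x)" using x by (simp add: ac_simps)
    then show ?thesis using frac_idealD(3)[OF I a x(1)] unfolding scale_def by blast
  qed
  from I obtain d where d: "d \<in> Ord" "d \<noteq> 0" "\<forall>y\<in>I. d * y \<in> Ord" unfolding frac_ideal_iff by blast
  from z obtain n :: nat where n: "n > 0" "of_nat n * z \<in> Ord" using K_denominator by blast
  have "of_nat n * d * y \<in> Ord" if "y \<in> scale z I" for y
  proof -
    from that obtain x where "x \<in> I" "y = z * x" unfolding scale_def by blast
    then have "(of_nat n * z) * (d * x) \<in> Ord" using d n by auto
    then show ?thesis using \<open>y = z * x\<close> by (simp add: ac_simps)
  qed
  then show "\<exists>d\<in>Ord. d \<noteq> 0 \<and> (\<forall>y\<in>scale z I. d * y \<in> Ord)"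
    using d n by (intro bexI[of _ "of_nat n * d"]) auto
qed

lemma cj_ip:
  assumes "I \<subseteq> K" "J \<subseteq> K" shows "cj ` (I \<bullet> J) = (cj ` I) \<bullet> (cj ` J)"
proof -
  have sub: "cj ` (I \<bullet> J) \<subseteq> (cj ` I) \<bullet> (cj ` J)" if "I \<subseteq> K" "J \<subseteq> K" for I J
  proof (rule image_subsetI)
    fix s assume "s \<in> I \<bullet> J"
    then have "s \<in> K \<and> cj s \<in> (cj ` I) \<bullet> (cj ` J)"
      by (induction rule: ip_induct) (use that in \<open>auto simp: subset_iff intro!: ip_prod ip_sum\<close>)
    then show "cj s \<in> (cj ` I) \<bullet> (cj ` J)" by blast
  qed
  have inv: "cj ` cj ` I = I" if "I \<subseteq> K" for I
    using that by (force simp: image_image subset_iff image_iff)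
  have "cj ` I \<subseteq> K" "cj ` J \<subseteq> K" using assms by auto
  from sub[OF this] have "cj ` ((cj ` I) \<bullet> (cj ` J)) \<subseteq> I \<bullet> J" using inv assms by simp
  then have "cj ` cj ` ((cj ` I) \<bullet> (cj ` J)) \<subseteq> cj ` (I \<bullet> J)" by (rule image_mono)
  moreover have "(cj ` I) \<bullet> (cj ` J) \<subseteq> K"
    by (rule ip_subsetI) (use assms in \<open>auto simp: subset_iff\<close>)
  ultimately show ?thesis using inv sub[OF assms] by simp
qed

lemma frac_ideal_cj:
  assumes "frac_ideal \<Delta> I" shows "frac_ideal \<Delta> (cj ` I)"
  unfolding frac_ideal_iff
proof (intro conjI ballI)
  have K: "x \<in> K" if "x \<in> I" for x using that frac_idealD(1)[OF assms] by blast
  then show "cj ` I \<subseteq> K" by auto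
  show "\<exists>x\<in>cj ` I. x \<noteq> 0" using assms K unfolding frac_ideal_iff by force
  show "x + y \<in> cj ` I" if "x \<in> cj ` I" "y \<in> cj ` I" for x y
    using that frac_idealD(2)[OF assms] K by (force simp flip: cj_add)
  show "z * y \<in> cj ` I" if z: "z \<in> Ord" and y: "y \<in> cj ` I" for z y
  proof -
    from y obtain x where x: "x \<in> I" "y = cj x" by blast
    have "z * y = cj (cj z * x)" using x K z Ord_K by simp
    then show ?thesis using frac_idealD(3)[OF assms Ord_cj[OF z] x(1)] by blast
  qed
  from assms obtain d where d: "d \<in> Ord" "d \<noteq> 0" "\<forall>y\<in>I. d * y \<in> Ord" unfolding frac_ideal_iff by blast
  have "cj d * cj y \<in> Ord" if "y \<in> I" for y
  proof -
    have "cj (d * y) \<in> Ord" using d that by (intro Ord_cj) auto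
    then show ?thesis using K[OF that] Ord_K[OF d(1)] by simp
  qed
  then show "\<exists>d\<in>Ord. d \<noteq> 0 \<and> (\<forall>y\<in>cj ` I. d * y \<in> Ord)"
    using d Ord_K by (intro bexI[of _ "cj d"]) auto
qed

abbreviation Inv :: "complex set set" where "Inv \<equiv> invertible_frac_ideals \<Delta>"
abbreviation IG :: "complex set monoid" where "IG \<equiv> frac_ideal_group \<Delta>"
abbreviation CG :: "complex set set monoid" where "CG \<equiv> narrow_class_group \<Delta>"
abbreviation cls :: "complex set \<Rightarrow> complex set set" where "cls \<equiv> narrow_class \<Delta>"

lemma Inv_frac: "I \<in> Inv \<Longrightarrow> frac_ideal \<Delta> I"
  unfolding invertible_frac_ideals_def by blast

lemma InvI: "frac_ideal \<Delta> I \<Longrightarrow> frac_ideal \<Delta> J \<Longrightarrow> I \<bullet> J = Ord \<Longrightarrow> I \<in> Inv"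
  unfolding invertible_frac_ideals_def by blast

lemma Inv_K: "I \<in> Inv \<Longrightarrow> I \<subseteq> K" using Inv_frac frac_idealD(1) by blast

lemma Inv_obtain:
  assumes "I \<in> Inv" obtains J where "J \<in> Inv" "I \<bullet> J = Ord"
  using assms unfolding invertible_frac_ideals_def by (auto simp: ip_comm)

lemma Inv_Ord: "Ord \<in> Inv"
  using frac_ideal_Ord ip_Ord by (intro InvI[of _ Ord]) auto

lemma Inv_ip: assumes "I \<in> Inv" "J \<in> Inv" shows "I \<bullet> J \<in> Inv"
proof -
  from assms obtain I' J' where I': "I' \<in> Inv" "I \<bullet> I' = Ord" and J': "J' \<in> Inv" "J \<bullet> J' = Ord"
    using Inv_obtain by metis
  have "I \<bullet> J \<bullet> (J' \<bullet> I') = I \<bullet> (J \<bullet> J') \<bullet> I'" by (simp add: ip_assoc)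
  also have "\<dots> = Ord" using I' J' assms by (metis Inv_frac ip_Ord ip_comm)
  finally show ?thesis using assms I' J' by (meson Inv_frac InvI frac_ideal_ip)
qed

lemma Inv_scale: assumes "I \<in> Inv" "z \<in> K" "z \<noteq> 0" shows "scale z I \<in> Inv"
proof -
  from assms obtain J where J: "J \<in> Inv" "I \<bullet> J = Ord" using Inv_obtain by metis
  have "scale z I \<bullet> scale (inverse z) J = scale z (scale (inverse z) (J \<bullet> I))"
    by (metis ip_scale ip_comm)
  also have "\<dots> = Ord" using J assms by (simp add: scale_scale scale_1 ip_comm)
  finally show ?thesis
    using assms J by (intro InvI[of _ "scale (inverse z) J"] frac_ideal_scale) (auto simp: Inv_frac)
qed

lemma Inv_cj: assumes "I \<in> Inv" shows "cj ` I \<in> Inv"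
proof -
  from assms obtain J where J: "J \<in> Inv" "I \<bullet> J = Ord" using Inv_obtain by metis
  then have "(cj ` I) \<bullet> (cj ` J) = Ord" using cj_ip[of I J] assms Inv_K cj_image_Ord by metis
  then show ?thesis using assms J by (intro InvI[of _ "cj ` J"]) (auto simp: Inv_frac frac_ideal_cj)
qed

lemma comm_group_IG: "comm_group IG"
proof (rule comm_groupI)
  fix I assume "I \<in> carrier IG"
  then show "\<exists>J\<in>carrier IG. J \<otimes>\<^bsub>IG\<^esub> I = \<one>\<^bsub>IG\<^esub>"
    using Inv_obtain[of I] by (auto simp: frac_ideal_group_def) (metis ip_comm)
next
  fix I J assume "I \<in> carrier IG" "J \<in> carrier IG"
  show "I \<otimes>\<^bsub>IG\<^esub> J = J \<otimes>\<^bsub>IG\<^esub> I" unfolding frac_ideal_group_def by (simp add: ip_comm[of I J])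
qed (simp_all add: frac_ideal_group_def Inv_ip Inv_Ord ip_assoc ip_Ord Inv_frac)

lemma pos_principal_iff: "J \<in> pos_principal_ideals \<Delta> \<longleftrightarrow> (\<exists>z. pos z \<and> J = scale z Ord)"
  unfolding pos_principal_ideals_def pos_def scale_def by blast

lemma subgroup_pos_principal: "subgroup (pos_principal_ideals \<Delta>) IG"
proof -
  interpret comm_group IG by (rule comm_group_IG)
  have prod: "scale z Ord \<bullet> scale w Ord = scale (z * w) Ord" for z w
    by (metis frac_ideal_Ord ip_Ord ip_comm ip_scale scale_scale)
  show ?thesis
  proof (rule subgroupI)
    show "pos_principal_ideals \<Delta> \<subseteq> carrier IG"
      using Inv_scale Inv_Ord by (auto simp: pos_principal_iff frac_ideal_group_def pos_def)
    show "pos_principal_ideals \<Delta> \<noteq> {}" using pos_1 pos_principal_iff by blast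
    fix I assume "I \<in> pos_principal_ideals \<Delta>"
    then obtain z where z: "pos z" "I = scale z Ord" unfolding pos_principal_iff by blast
    have "scale (inverse z) Ord = inv\<^bsub>IG\<^esub> I"
    proof (rule inv_equality[symmetric])
      show "scale (inverse z) Ord \<otimes>\<^bsub>IG\<^esub> I = \<one>\<^bsub>IG\<^esub>"
        using z prod[of "inverse z" z] by (simp add: frac_ideal_group_def pos_nz scale_1)
    qed (use z Inv_scale Inv_Ord in \<open>auto simp: frac_ideal_group_def pos_def\<close>)
    then show "inv\<^bsub>IG\<^esub> I \<in> pos_principal_ideals \<Delta>"
      using pos_inverse[OF z(1)] pos_principal_iff by metis
    fix J assume "J \<in> pos_principal_ideals \<Delta>"
    then obtain w where w: "pos w" "J = scale w Ord" unfolding pos_principal_iff by blast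
    have "I \<otimes>\<^bsub>IG\<^esub> J = scale (z * w) Ord" using z w prod by (simp add: frac_ideal_group_def)
    then show "I \<otimes>\<^bsub>IG\<^esub> J \<in> pos_principal_ideals \<Delta>"
      using pos_mult[OF z(1) w(1)] pos_principal_iff by blast
  qed
qed

lemma normal_pos_principal: "pos_principal_ideals \<Delta> \<lhd> IG"
  using comm_group.normal_iff_subgroup[OF comm_group_IG] subgroup_pos_principal by blast

lemma comm_group_CG: "comm_group CG"
  unfolding narrow_class_group_def
  by (rule comm_group.abelian_FactGroup[OF comm_group_IG subgroup_pos_principal])

lemma carrier_CG: "carrier CG = cls ` Inv"
  unfolding narrow_class_group_def narrow_class_def FactGroup_def RCOSETS_def
  by (auto simp: frac_ideal_group_def)

lemma cls_closed: "I \<in> Inv \<Longrightarrow> cls I \<in> carrier CG" by (simp add: carrier_CG)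

lemma cls_ip: assumes "I \<in> Inv" "J \<in> Inv" shows "cls (I \<bullet> J) = cls I \<otimes>\<^bsub>CG\<^esub> cls J"
proof -
  have c: "I \<in> carrier IG" "J \<in> carrier IG" "I \<bullet> J = I \<otimes>\<^bsub>IG\<^esub> J"
    using assms by (simp_all add: frac_ideal_group_def)
  show ?thesis
    unfolding narrow_class_def narrow_class_group_def FactGroup_def c(3)
    using normal.rcos_sum[OF normal_pos_principal c(1,2)] by simp
qed

lemma cls_eq_iff:
  assumes "I \<in> Inv" "J \<in> Inv" shows "cls I = cls J \<longleftrightarrow> (\<exists>z. pos z \<and> J = scale z I)"
proof -
  interpret comm_group IG by (rule comm_group_IG)
  let ?P = "pos_principal_ideals \<Delta>"
  have c: "I \<in> carrier IG" "J \<in> carrier IG" using assms by (simp_all add: frac_ideal_group_def)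
  have coset: "J \<in> cls I \<longleftrightarrow> (\<exists>z. pos z \<and> J = scale z I)"
  proof -
    have "scale z Ord \<otimes>\<^bsub>IG\<^esub> I = scale z I" for z
      using ip_scale[of z Ord I] ip_Ord[OF Inv_frac[OF assms(1)]] by (simp add: frac_ideal_group_def)
    then show ?thesis
      unfolding narrow_class_def r_coset_def by (auto simp: pos_principal_iff Bex_def) 
  qed
  have "cls I = cls J \<longleftrightarrow> J \<in> cls I"
    unfolding narrow_class_def
    using repr_independence[OF _ c(1) subgroup_pos_principal] rcos_self[OF c(2) subgroup_pos_principal]
    by blast
  then show ?thesis using coset by simp
qed

lemma cls_scale: assumes "I \<in> Inv" "pos z" shows "cls (scale z I) = cls I"
  using cls_eq_iff[OF assms(1) Inv_scale[OF assms(1) pos_K[OF assms(2)] pos_nz[OF assms(2)]]] assms by blast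

lemma cls_Ord: "cls Ord = \<one>\<^bsub>CG\<^esub>"
proof -
  interpret comm_group CG by (rule comm_group_CG)
  have "cls Ord \<otimes>\<^bsub>CG\<^esub> cls Ord = cls Ord"
    using cls_ip[OF Inv_Ord Inv_Ord] ip_Ord[OF frac_ideal_Ord] by simp
  then show ?thesis using cls_closed[OF Inv_Ord] l_cancel_one by blast
qed

lemma cls_inverse:
  assumes "I \<in> Inv" "J \<in> Inv" "I \<bullet> J = scale z Ord" "pos z"
  shows "cls J = inv\<^bsub>CG\<^esub> cls I"
proof -
  interpret comm_group CG by (rule comm_group_CG)
  have "cls J \<otimes>\<^bsub>CG\<^esub> cls I = \<one>\<^bsub>CG\<^esub>"
    using cls_ip[OF assms(2,1)] assms(3,4) cls_scale[OF Inv_Ord] cls_Ord by (metis ip_comm)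
  then show ?thesis using inv_equality assms cls_closed by metis
qed

end


section \<open>Ideals as lattices\<close>

lemma int_subgroup_principal:
  fixes S :: "int set"
  assumes add: "\<And>x y. x \<in> S \<Longrightarrow> y \<in> S \<Longrightarrow> x + y \<in> S" and mult: "\<And>n x. x \<in> S \<Longrightarrow> n * x \<in> S"
    and nz: "x \<in> S" "x \<noteq> 0"
  obtains k where "k > 0" "\<And>n. n \<in> S \<longleftrightarrow> k dvd n"
proof -
  have "\<bar>x\<bar> \<in> S" using mult[OF nz(1), of "sgn x"] by (simp add: abs_sgn mult.commute)
  then have ex: "0 < nat \<bar>x\<bar> \<and> int (nat \<bar>x\<bar>) \<in> S" using nz by simp
  define k where "k = (LEAST k. 0 < k \<and> int k \<in> S)"
  have k: "0 < k" "int k \<in> S" using LeastI[of "\<lambda>k. 0 < k \<and> int k \<in> S", OF ex] unfolding k_def by auto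
  have "int k dvd n" if "n \<in> S" for n
  proof (rule ccontr)
    assume "\<not> int k dvd n"
    then have pos: "n mod int k > 0" using k(1) by (simp add: mod_int_pos_iff order.not_eq_order_implies_strict dvd_eq_mod_eq_0)
    have "n mod int k = n + (- (n div int k)) * int k" by (simp add: minus_div_mult_eq_mod [symmetric])
    then have "n mod int k \<in> S" using add[OF that mult[OF k(2)]] by metis
    then have "k \<le> nat (n mod int k)"
      using Least_le[of "\<lambda>k. 0 < k \<and> int k \<in> S" "nat (n mod int k)"] pos unfolding k_def[symmetric] by simp
    moreover have "n mod int k < int k" using k(1) by simp
    ultimately show False using pos by linarith
  qed
  moreover have "n \<in> S" if "int k dvd n" for n
    using that mult[OF k(2)] by (metis dvdE mult.commute)
  ultimately show ?thesis using that[of "int k"] k(1) by auto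
qed

context quadratic
begin

definition bet :: "int \<Rightarrow> complex" where "bet b = (of_int b + \<delta>) / 2"

text \<open>
  The ideal attached to a form \<open>(a, b, c)\<close>, where \<open>c\<close> is determined by \<open>a\<close>, \<open>b\<close> and the discriminant.
\<close>

definition lat :: "int \<Rightarrow> int \<Rightarrow> complex set" where
  "lat a b = {of_int (x * a) + of_int y * bet b | x y. True}"

lemma lat_iff: "z \<in> lat a b \<longleftrightarrow> (\<exists>x y. z = of_int (x * a) + of_int y * bet b)"
  unfolding lat_def by blast

lemma lat_intro: "of_int (x * a) + of_int y * bet b \<in> lat a b" unfolding lat_iff by blast

lemma lat_gens: "of_int a \<in> lat a b" "bet b \<in> lat a b"
  using lat_intro[of 1 a 0 b] lat_intro[of 0 a 1 b] by simp_all

lemma bet_K [simp]: "bet b \<in> K" by (simp add: bet_def)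

lemma cj_bet: "cj (bet b) = of_int b - bet b" by (simp add: bet_def field_simps)

lemma lat_coords:
  assumes "of_int x + of_int y * bet b = of_int x' + of_int y' * bet b"
  shows "x = x'" "y = y'"
proof -
  have "(of_int (2 * x + y * b) / 2 + of_int y / 2 * \<delta>) = (of_int (2 * x' + y' * b) / 2 + of_int y' / 2 * \<delta>)"
    using assms unfolding bet_def by (simp add: field_simps)
  from rational_coords[OF _ _ _ _ this]
  have "(of_int (2 * x + y * b) :: complex) = of_int (2 * x' + y' * b)" "(of_int y :: complex) = of_int y'"
    by auto
  then show "x = x'" "y = y'" by (simp_all only: of_int_eq_iff)
qed

lemma bet_sq:
  assumes "b\<^sup>2 - 4 * a * c = \<Delta>"
  shows "bet b * bet b = of_int b * bet b - of_int (a * c)"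
proof -
  have "(of_int \<Delta> :: complex) = of_int b * of_int b - 4 * of_int a * of_int c"
    unfolding assms[symmetric] by (simp add: power2_eq_square)
  moreover have "4 * (bet b * bet b) = of_int b * of_int b + 2 * of_int b * \<delta> + \<delta> * \<delta>"
    unfolding bet_def by (simp add: field_simps)
  moreover have "4 * (of_int b * bet b - of_int (a * c)) =
      2 * of_int b * of_int b + 2 * of_int b * \<delta> - 4 * of_int a * of_int c"
    unfolding bet_def by (simp add: field_simps)
  ultimately have "4 * (bet b * bet b) = 4 * (of_int b * bet b - of_int (a * c))"
    unfolding \<delta>_sq by simp
  then show ?thesis by (subst (asm) mult_left_cancel) auto
qed

lemma bet_norm:
  assumes "b\<^sup>2 - 4 * a * c = \<Delta>"
  shows "bet b * cj (bet b) = of_int (a * c)"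
  using bet_sq[OF assms] by (simp add: cj_bet algebra_simps)

lemma disc_parity: assumes "b\<^sup>2 - 4 * a * c = \<Delta>" shows "even (b - \<Delta> mod 4)"
proof -
  have "even (\<Delta> mod 4) \<longleftrightarrow> even \<Delta>" by presburger
  moreover have "even \<Delta> \<longleftrightarrow> even b" unfolding assms[symmetric] by simp
  ultimately show ?thesis by simp
qed

lemma bet_eq_\<omega>: "bet (2 * h + \<Delta> mod 4) = of_int h + \<omega>"
  unfolding bet_def \<omega>_def by (simp add: field_simps)

lemma bet_Ord: assumes "b\<^sup>2 - 4 * a * c = \<Delta>" shows "bet b \<in> Ord"
proof -
  from disc_parity[OF assms] obtain h where "b = 2 * h + \<Delta> mod 4" by (metis dvdE diff_eq_eq)
  then show ?thesis using Ord_intro[of h 1] by (simp add: bet_eq_\<omega>)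
qed

lemma lat_sub_Ord: assumes "b\<^sup>2 - 4 * a * c = \<Delta>" shows "lat a b \<subseteq> Ord"
  unfolding lat_def using bet_Ord[OF assms] by (auto simp del: of_int_mult)

lemma lat_add: "z \<in> lat a b \<Longrightarrow> w \<in> lat a b \<Longrightarrow> z + w \<in> lat a b"
  unfolding lat_iff
proof (elim exE)
  fix x y x' y' assume "z = of_int (x * a) + of_int y * bet b" "w = of_int (x' * a) + of_int y' * bet b"
  then show "\<exists>x y. z + w = of_int (x * a) + of_int y * bet b"
    by (intro exI[of _ "x + x'"] exI[of _ "y + y'"]) (simp add: algebra_simps)
qed

lemma lat_Ord_mult:
  assumes "b\<^sup>2 - 4 * a * c = \<Delta>" "z \<in> Ord" "w \<in> lat a b"
  shows "z * w \<in> lat a b"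
proof -
  from disc_parity[OF assms(1)] obtain h where h: "b = 2 * h + \<Delta> mod 4" by (metis dvdE diff_eq_eq)
  from assms(2) obtain u v where z: "z = of_int u + of_int v * \<omega>" by (rule Ord_cases)
  from assms(3) obtain x y where w: "w = of_int (x * a) + of_int y * bet b" unfolding lat_iff by blast
  have \<omega>: "\<omega> = bet b - of_int h" unfolding h bet_eq_\<omega> by simp
  have "z * w = of_int ((u - v * h) * x * a) + of_int ((u - v * h) * y + v * x * a) * bet b
      + of_int (v * y) * (bet b * bet b)"
    unfolding z w \<omega> by (simp add: algebra_simps)
  also have "\<dots> = of_int (((u - v * h) * x - v * y * c) * a) + of_int ((u - v * h) * y + v * x * a + v * y * b) * bet b"
    unfolding bet_sq[OF assms(1)] by (simp add: algebra_simps)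
  finally show ?thesis using lat_intro by metis
qed

lemma frac_ideal_integral:
  assumes "I \<subseteq> Ord" "\<exists>x\<in>I. x \<noteq> 0" "\<And>x y. x \<in> I \<Longrightarrow> y \<in> I \<Longrightarrow> x + y \<in> I"
    "\<And>x y. x \<in> Ord \<Longrightarrow> y \<in> I \<Longrightarrow> x * y \<in> I"
  shows "frac_ideal \<Delta> I"
  unfolding frac_ideal_iff using assms Ord_K by (auto intro!: bexI[of _ 1])

lemma frac_ideal_lat:
  assumes "b\<^sup>2 - 4 * a * c = \<Delta>" "a \<noteq> 0"
  shows "frac_ideal \<Delta> (lat a b)"
proof (rule frac_ideal_integral)
  show "\<exists>x\<in>lat a b. x \<noteq> 0"
    using lat_gens(1)[of a b] assms(2) by (intro bexI[of _ "of_int a"]) auto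
qed (fact lat_sub_Ord[OF assms(1)] lat_add lat_Ord_mult[OF assms(1)])+

lemma ideal_Ord_iff:
  "ideal I (ring_on Ord) \<longleftrightarrow> I \<subseteq> Ord \<and> 0 \<in> I \<and> (\<forall>x\<in>I. \<forall>y\<in>I. x + y \<in> I) \<and> (\<forall>x\<in>Ord. \<forall>y\<in>I. x * y \<in> I)"
proof
  assume "ideal I (ring_on Ord)"
  then interpret ideal I "ring_on Ord" .
  have "additive_subgroup I (ring_on Ord)" by (rule additive_subgroup_axioms)
  then show "I \<subseteq> Ord \<and> 0 \<in> I \<and> (\<forall>x\<in>I. \<forall>y\<in>I. x + y \<in> I) \<and> (\<forall>x\<in>Ord. \<forall>y\<in>I. x * y \<in> I)"
    unfolding additive_subgroup_ring_on_iff[OF cring_Ord] using I_l_closed by auto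
next
  assume *: "I \<subseteq> Ord \<and> 0 \<in> I \<and> (\<forall>x\<in>I. \<forall>y\<in>I. x + y \<in> I) \<and> (\<forall>x\<in>Ord. \<forall>y\<in>I. x * y \<in> I)"
  interpret cring "ring_on Ord" by (rule cring_Ord)
  have "- x \<in> I" if "x \<in> I" for x
    using * that Ord_int(1)[of "- 1"] by (metis mult_minus1 of_int_1 of_int_minus)
  then have "additive_subgroup I (ring_on Ord)"
    unfolding additive_subgroup_ring_on_iff[OF cring_Ord] using * by blast
  then have "subgroup I (add_monoid (ring_on Ord))" by (rule additive_subgroup.a_subgroup)
  moreover have "x * y \<in> I" if "x \<in> I" "y \<in> Ord" for x y using * that by (metis mult.commute)
  ultimately show "ideal I (ring_on Ord)"
    by (intro idealI[OF ring_axioms]) (use * in auto)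
qed

lemma genideal_lat:
  assumes "b\<^sup>2 - 4 * a * c = \<Delta>"
  shows "Idl\<^bsub>ring_on Ord\<^esub> {of_int a, (of_int b + csqrt (of_int \<Delta>)) / 2} = lat a b"
proof -
  have bet: "(of_int b + csqrt (of_int \<Delta>)) / 2 = bet b" unfolding bet_def \<delta>_def ..
  have "ideal (lat a b) (ring_on Ord)"
    unfolding ideal_Ord_iff
    using lat_sub_Ord[OF assms] lat_add lat_Ord_mult[OF assms] lat_intro[of 0 a 0 b] by simp
  moreover have "lat a b \<subseteq> I" if "ideal I (ring_on Ord)" "of_int a \<in> I" "bet b \<in> I" for I
  proof
    fix z assume "z \<in> lat a b"
    then obtain x y where "z = of_int x * of_int a + of_int y * bet b" unfolding lat_iff by force
    then show "z \<in> I" using that Ord_int(1) unfolding ideal_Ord_iff by blast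
  qed
  ultimately show ?thesis
    unfolding genideal_def bet using lat_gens by auto
qed


text \<open>
  Multiplication of ideals reproduces Dirichlet's composition of united forms.  The product contains
  \<open>a bet b\<close>, \<open>a' bet b\<close> and, by the quadratic equation of \<open>bet b\<close>, also \<open>b bet b\<close>, hence
  \<open>bet b\<close> itself.
\<close>

lemma lat_ip_lat:
  assumes d: "b\<^sup>2 - 4 * (a * a') * c = \<Delta>" and g: "gcd a (gcd a' b) = 1" and nz: "a \<noteq> 0" "a' \<noteq> 0"
  shows "lat a b \<bullet> lat a' b = lat (a * a') b"
proof
  have sq: "bet b * bet b = of_int b * bet b - of_int (a * a' * c)" using bet_sq[OF d] by simp
  have d1: "b\<^sup>2 - 4 * a * (a' * c) = \<Delta>" and d2: "b\<^sup>2 - 4 * a' * (a * c) = \<Delta>"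
    using d by (simp_all add: algebra_simps)
  show "lat a b \<bullet> lat a' b \<subseteq> lat (a * a') b"
  proof (rule ip_subsetI)
    fix z w assume "z \<in> lat a b" "w \<in> lat a' b"
    then obtain x y x' y' where zw: "z = of_int (x * a) + of_int y * bet b" "w = of_int (x' * a') + of_int y' * bet b"
      unfolding lat_iff by blast
    have "z * w = of_int (x * x' * (a * a')) + of_int (x * a * y' + x' * a' * y) * bet b + of_int (y * y') * (bet b * bet b)"
      unfolding zw by (simp add: algebra_simps)
    also have "\<dots> = of_int ((x * x' - y * y' * c) * (a * a')) + of_int (x * a * y' + x' * a' * y + y * y' * b) * bet b"
      unfolding sq by (simp add: algebra_simps)
    finally show "z * w \<in> lat (a * a') b" using lat_intro by metis
  qed (rule lat_add)
  have fr: "frac_ideal \<Delta> (lat a b \<bullet> lat a' b)"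
    by (intro frac_ideal_ip frac_ideal_lat[OF d1] frac_ideal_lat[OF d2] nz)
  note cl = frac_idealD(2,3)[OF fr]
  have aa: "of_int (a * a') \<in> lat a b \<bullet> lat a' b" using ip_prod[OF lat_gens(1) lat_gens(1)] by simp
  have ab: "of_int a * bet b \<in> lat a b \<bullet> lat a' b" using ip_prod[OF lat_gens(1) lat_gens(2)] .
  have a'b: "of_int a' * bet b \<in> lat a b \<bullet> lat a' b"
    using ip_prod[OF lat_gens(2) lat_gens(1)] by (simp add: mult.commute)
  have "bet b * bet b + of_int c * of_int (a * a') \<in> lat a b \<bullet> lat a' b"
    by (intro cl aa ip_prod[OF lat_gens(2) lat_gens(2)] Ord_int)
  then have bb: "of_int b * bet b \<in> lat a b \<bullet> lat a' b" unfolding sq by (simp add: mult.commute)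
  obtain u v where uv: "u * a + v * gcd a' b = 1" using g bezout_int[of a "gcd a' b"] by metis
  obtain s t where st: "s * a' + t * b = gcd a' b" using bezout_int[of a' b] by metis
  have "u * a + v * s * a' + v * t * b = 1" using uv unfolding st[symmetric] by (simp add: algebra_simps)
  then have "of_int u * (of_int a * bet b) + of_int (v * s) * (of_int a' * bet b) + of_int (v * t) * (of_int b * bet b)
      = of_int 1 * bet b"
    by (metis (no_types, lifting) distrib_right mult.assoc of_int_add of_int_mult)
  moreover have "of_int u * (of_int a * bet b) + of_int (v * s) * (of_int a' * bet b) + of_int (v * t) * (of_int b * bet b)
      \<in> lat a b \<bullet> lat a' b" by (intro cl ab a'b bb Ord_int)
  ultimately have bet: "bet b \<in> lat a b \<bullet> lat a' b" by simp
  show "lat (a * a') b \<subseteq> lat a b \<bullet> lat a' b"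
  proof
    fix z assume "z \<in> lat (a * a') b"
    then obtain x y where "z = of_int x * of_int (a * a') + of_int y * bet b" unfolding lat_iff by force
    then show "z \<in> lat a b \<bullet> lat a' b" using cl aa bet Ord_int by auto
  qed
qed

text \<open>A primitive lattice is invertible because its product with its conjugate is principal.\<close>

lemma lat_ip_cj:
  assumes d: "b\<^sup>2 - 4 * a * c = \<Delta>" and g: "gcd a (gcd b c) = 1" and nz: "a \<noteq> 0"
  shows "lat a b \<bullet> (cj ` lat a b) = scale (of_int a) Ord"
proof
  have sub: "lat a b \<subseteq> Ord" by (rule lat_sub_Ord[OF d])
  have fr: "frac_ideal \<Delta> (lat a b \<bullet> (cj ` lat a b))"
    by (intro frac_ideal_ip frac_ideal_cj frac_ideal_lat[OF d nz])
  have frO: "frac_ideal \<Delta> (scale (of_int a) Ord)" using nz by (intro frac_ideal_scale frac_ideal_Ord) auto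
  show "lat a b \<bullet> (cj ` lat a b) \<subseteq> scale (of_int a) Ord"
  proof (rule ip_subsetI)
    fix z w assume "z \<in> lat a b" "w \<in> cj ` lat a b"
    then obtain x y x' y' where zw: "z = of_int (x * a) + of_int y * bet b"
      "w = cj (of_int (x' * a) + of_int y' * bet b)" unfolding lat_def by blast
    have "z * w = of_int a * (of_int (x * x' * a) + of_int (x * y') * cj (bet b) + of_int (x' * y) * bet b)
        + of_int (y * y') * (bet b * cj (bet b))"
      unfolding zw by (simp add: algebra_simps)
    also have "\<dots> = of_int a * (of_int (x * x' * a + y * y' * c) + of_int (x * y') * cj (bet b) + of_int (x' * y) * bet b)"
      unfolding bet_norm[OF d] by (simp add: algebra_simps)
    finally have "z * w = of_int a * (of_int (x * x' * a + y * y' * c) + of_int (x * y') * cj (bet b) + of_int (x' * y) * bet b)" .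
    moreover have "of_int (x * x' * a + y * y' * c) + of_int (x * y') * cj (bet b) + of_int (x' * y) * bet b \<in> Ord"
      by (intro Ord_add Ord_mult Ord_cj bet_Ord[OF d] Ord_int)
    ultimately show "z * w \<in> scale (of_int a) Ord" unfolding scale_def by blast
  qed (use frac_idealD[OF frO] in auto)
  note cl = frac_idealD(2,3)[OF fr]
  have "cj (of_int a) \<in> cj ` lat a b" "cj (bet b) \<in> cj ` lat a b" by (intro imageI lat_gens)+
  then have c1: "of_int a \<in> cj ` lat a b" "cj (bet b) \<in> cj ` lat a b" by simp_all
  have aa: "of_int a * of_int a \<in> lat a b \<bullet> (cj ` lat a b)" by (intro ip_prod lat_gens c1)
  have "bet b * of_int a + of_int a * cj (bet b) \<in> lat a b \<bullet> (cj ` lat a b)"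
    by (intro cl ip_prod lat_gens c1)
  then have ab: "of_int b * of_int a \<in> lat a b \<bullet> (cj ` lat a b)"
    by (simp add: cj_bet algebra_simps)
  have ac: "of_int c * of_int a \<in> lat a b \<bullet> (cj ` lat a b)"
    using ip_prod[OF lat_gens(2)[of b a] c1(2)] unfolding bet_norm[OF d] by (simp add: mult.commute)
  obtain u v where uv: "u * a + v * gcd b c = 1" using g bezout_int[of a "gcd b c"] by metis
  obtain s t where st: "s * b + t * c = gcd b c" using bezout_int[of b c] by metis
  have "u * a + v * s * b + v * t * c = 1" using uv unfolding st[symmetric] by (simp add: algebra_simps)
  then have "of_int u * (of_int a * of_int a) + of_int (v * s) * (of_int b * of_int a) + of_int (v * t) * (of_int c * of_int a)
      = of_int 1 * (of_int a :: complex)"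
    by (metis (no_types, lifting) distrib_right mult.assoc of_int_add of_int_mult)
  moreover have "of_int u * (of_int a * of_int a) + of_int (v * s) * (of_int b * of_int a) + of_int (v * t) * (of_int c * of_int a)
      \<in> lat a b \<bullet> (cj ` lat a b)" by (intro cl aa ab ac Ord_int)
  ultimately have "of_int a \<in> lat a b \<bullet> (cj ` lat a b)" by simp
  from cl(2)[OF _ this] have "of_int a * x \<in> lat a b \<bullet> (cj ` lat a b)" if "x \<in> Ord" for x
    using that by (metis mult.commute)
  then show "scale (of_int a) Ord \<subseteq> lat a b \<bullet> (cj ` lat a b)" unfolding scale_def by blast
qed

lemma Inv_lat:
  assumes d: "b\<^sup>2 - 4 * a * c = \<Delta>" and g: "gcd a (gcd b c) = 1" and nz: "a \<noteq> 0"
  shows "lat a b \<in> Inv"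
proof (rule InvI)
  show fr: "frac_ideal \<Delta> (lat a b)" by (rule frac_ideal_lat[OF d nz])
  show "frac_ideal \<Delta> (scale (inverse (of_int a)) (cj ` lat a b))"
    using nz by (intro frac_ideal_scale frac_ideal_cj fr) auto
  have "lat a b \<bullet> scale (inverse (of_int a)) (cj ` lat a b) = scale (inverse (of_int a)) (lat a b \<bullet> (cj ` lat a b))"
    by (metis ip_comm ip_scale)
  then show "lat a b \<bullet> scale (inverse (of_int a)) (cj ` lat a b) = Ord"
    unfolding lat_ip_cj[OF assms] using nz by (simp add: scale_scale scale_1)
qed

text \<open>
  The Hermite normal form of an integral ideal.  With \<open>I \<inter> \<int> = k\<int>\<close> and with \<open>e\<int>\<close> the group of
  \<open>\<omega>\<close>-coordinates of elements of \<open>I\<close>, multiplication by \<open>\<omega>\<close> shows that \<open>e\<close> divides all coordinates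
  of \<open>I\<close>; the norm of the element \<open>e(h + \<omega>)\<close> of \<open>I\<close> then gives the third coefficient of a form.
\<close>

lemma integral_ideal_lat:
  assumes fr: "frac_ideal \<Delta> I" and sub: "I \<subseteq> Ord"
  obtains e a b c where "e > 0" "a > 0" "b\<^sup>2 - 4 * a * c = \<Delta>" "I = scale (of_int e) (lat a b)"
    "\<And>n. of_int n \<in> I \<longleftrightarrow> e * a dvd n"
proof -
  note cl = frac_idealD(2,3)[OF fr]
  have imult: "of_int n * x \<in> I" if "x \<in> I" for n x using cl(2)[OF Ord_int(1) that] .
  have minus: "- x \<in> I" if "x \<in> I" for x using imult[OF that, of "- 1"] by simp
  from fr obtain z where z: "z \<in> I" "z \<noteq> 0" unfolding frac_ideal_iff by blast
  then have zO: "z \<in> Ord" using sub by blast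
  then obtain N where N: "cj z * z = of_int N"
    using norm_Ord by (elim Ord_cases) (metis mult.commute)
  have "of_int N \<in> I" using cl(2)[OF Ord_cj[OF zO] z(1)] N by simp
  moreover have "N \<noteq> 0" using N z zO Ord_K by (metis cj_eq_0_iff mult_eq_0_iff of_int_0)
  ultimately obtain k where k: "k > 0" "\<And>n. n \<in> {n. of_int n \<in> I} \<longleftrightarrow> k dvd n"
    using int_subgroup_principal[of "{n. of_int n \<in> I}" N] cl(1) imult by auto
  have kI: "of_int k \<in> I" using k(2)[of k] by simp
  let ?T = "{y. \<exists>x. of_int x + of_int y * \<omega> \<in> I}"
  have "of_int 0 + of_int k * \<omega> \<in> I" using cl(2)[OF \<omega>_Ord kI] by (simp add: mult.commute)
  then have kT: "k \<in> ?T" by blast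
  have addT: "y + y' \<in> ?T" if yT: "y \<in> ?T" "y' \<in> ?T" for y y'
  proof -
    from yT obtain x x' where "of_int x + of_int y * \<omega> \<in> I" "of_int x' + of_int y' * \<omega> \<in> I" by blast
    from cl(1)[OF this] have "of_int (x + x') + of_int (y + y') * \<omega> \<in> I" by (simp add: algebra_simps)
    then show ?thesis by blast
  qed
  have multT: "n * y \<in> ?T" if yT: "y \<in> ?T" for n y
  proof -
    from yT obtain x where "of_int x + of_int y * \<omega> \<in> I" by blast
    from imult[OF this, of n] have "of_int (n * x) + of_int (n * y) * \<omega> \<in> I" by (simp add: algebra_simps)
    then show ?thesis by blast
  qed
  have "k \<noteq> 0" using k(1) by simp
  obtain e where e: "e > 0" "\<And>n. n \<in> ?T \<longleftrightarrow> e dvd n"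
  proof (rule int_subgroup_principal[of ?T k, OF addT multT kT \<open>k \<noteq> 0\<close>])
    fix e' assume "e' > 0" "\<And>n. n \<in> ?T \<longleftrightarrow> e' dvd n"
    then show thesis by (rule that)
  qed
  from kT e(2) obtain a where a: "k = e * a" by blast
  from e(2)[of e] obtain f where f: "of_int f + of_int e * \<omega> \<in> I" by auto
  have "\<omega> * (of_int f + of_int e * \<omega>) = of_int (e * (\<Delta> div 4)) + of_int (f + e * (\<Delta> mod 4)) * \<omega>"
  proof -
    have "\<omega> * (of_int f + of_int e * \<omega>) = of_int f * \<omega> + of_int e * (\<omega> * \<omega>)" by (simp add: algebra_simps)
    then show ?thesis unfolding \<omega>_sq by (simp add: algebra_simps)
  qed
  then have "f + e * (\<Delta> mod 4) \<in> ?T" using cl(2)[OF \<omega>_Ord f] by (metis (mono_tags, lifting) mem_Collect_eq)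
  then have "e dvd f + e * (\<Delta> mod 4)" using e(2) by blast
  then obtain h where h: "f = e * h" by (metis dvd_add_left_iff dvd_triv_left dvdE)
  define b where "b = 2 * h + \<Delta> mod 4"
  have bet: "bet b = of_int h + \<omega>" unfolding b_def by (rule bet_eq_\<omega>)
  have ebI: "of_int e * bet b \<in> I" using f unfolding h bet by (simp add: algebra_simps)
  have a0: "a > 0" using k(1) e(1) unfolding a by (simp add: zero_less_mult_iff)
  have "bet b * cj (bet b) = of_int (bqf_eval (1, \<Delta> mod 4, - (\<Delta> div 4)) h 1)"
    using norm_Ord[of h 1] unfolding bet by (simp only: of_int_1 mult_1_left)
  then obtain N' where N': "bet b * cj (bet b) = of_int N'" by blast
  have "cj (bet b) \<in> Ord" using Ord_intro[of h 1] unfolding bet by (intro Ord_cj) simp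
  then have "cj (bet b) * (of_int e * bet b) \<in> I" using cl(2) ebI by blast
  moreover have "cj (bet b) * (of_int e * bet b) = of_int (e * N')" using N' by (simp add: ac_simps)
  ultimately have "k dvd e * N'" using k(2)[of "e * N'"] by simp
  then have "a dvd N'" using e(1) unfolding a by simp
  then obtain c where c: "N' = a * c" by blast
  have "4 * (bet b * cj (bet b)) = of_int b * of_int b - \<delta> * \<delta>" unfolding bet_def by (simp add: field_simps)
  then have "of_int (4 * (a * c)) = (of_int (b\<^sup>2 - \<Delta>) :: complex)"
    unfolding N' c \<delta>_sq by (simp add: power2_eq_square)
  then have d: "b\<^sup>2 - 4 * a * c = \<Delta>" by (simp only: of_int_eq_iff)
  have "I = scale (of_int e) (lat a b)"
  proof
    show "I \<subseteq> scale (of_int e) (lat a b)"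
    proof
      fix z assume zI: "z \<in> I"
      then obtain x y where z: "z = of_int x + of_int y * \<omega>" using sub by (blast elim: Ord_cases)
      then have "e dvd y" using e(2) zI by blast
      then obtain y' where y': "y = e * y'" by blast
      have "z + - (of_int y' * (of_int e * bet b)) \<in> I" by (intro cl zI minus imult ebI)
      moreover have "z + - (of_int y' * (of_int e * bet b)) = of_int (x - y' * e * h)"
        unfolding z y' bet by (simp add: algebra_simps)
      ultimately have "k dvd x - y' * e * h" using k(2)[of "x - y' * e * h"] by simp
      then obtain x' where x': "x - y' * e * h = e * a * x'" unfolding a by blast
      have "z = of_int e * (of_int (x' * a) + of_int y' * bet b)"
      proof -
        have "z = of_int (x - y' * e * h) + of_int e * (of_int y' * bet b)" unfolding z y' bet by (simp add: algebra_simps)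
        then show ?thesis unfolding x' by (simp add: algebra_simps)
      qed
      then show "z \<in> scale (of_int e) (lat a b)" unfolding scale_def using lat_intro by blast
    qed
    show "scale (of_int e) (lat a b) \<subseteq> I"
    proof
      fix z assume "z \<in> scale (of_int e) (lat a b)"
      then obtain x y where "z = of_int e * (of_int (x * a) + of_int y * bet b)" unfolding scale_def lat_def by blast
      then have "z = of_int x * of_int k + of_int y * (of_int e * bet b)" unfolding a by (simp add: algebra_simps)
      then show "z \<in> I" using cl(1) imult kI ebI by metis
    qed
  qed
  then show ?thesis using that[OF e(1) a0 d] k(2) a by simp
qed

text \<open>Multiplication by an inverse ideal turns multipliers of an ideal into multipliers of the order.\<close>

lemma Inv_multiplier:
  assumes inv: "I \<in> Inv" and mult: "\<And>x. x \<in> I \<Longrightarrow> w * x \<in> I"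
  shows "w \<in> Ord"
proof -
  from inv obtain J where J: "J \<in> Inv" "I \<bullet> J = Ord" using Inv_obtain by metis
  have "w * s \<in> I \<bullet> J" if "s \<in> I \<bullet> J" for s
    using that
  proof (induction rule: ip_induct)
    case (prod x y)
    then show ?case using ip_prod[OF mult] by (metis mult.assoc)
  qed (simp add: distrib_left ip_sum)
  from this[of 1] show "w \<in> Ord" unfolding J(2) by simp
qed

text \<open>A common divisor \<open>g\<close> of \<open>a\<close>, \<open>b\<close>, \<open>c\<close> provides the multiplier \<open>(b + \<delta>)/(2g)\<close>.\<close>

lemma invertible_lat_primitive:
  assumes d: "b\<^sup>2 - 4 * a * c = \<Delta>" and nz: "a \<noteq> 0" and inv: "lat a b \<in> Inv"
  shows "gcd a (gcd b c) = 1"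
proof -
  define g where "g = gcd a (gcd b c)"
  have g0: "g > 0" using nz unfolding g_def by (simp add: gcd_pos_int)
  obtain a1 b1 c1 where g: "a = g * a1" "b = g * b1" "c = g * c1"
    by (metis dvdE gcd_dvd1 gcd_dvd2 dvd_trans g_def)
  define w where "w = bet b / of_int g"
  have gw: "of_int g * w = bet b" using g0 by (simp add: w_def)
  have wb: "w * bet b = of_int b1 * bet b - of_int (c1 * a)"
  proof -
    have "of_int g * (w * bet b) = bet b * bet b" using gw by (simp add: mult.assoc[symmetric])
    also have "\<dots> = of_int g * (of_int b1 * bet b - of_int (c1 * a))"
      unfolding bet_sq[OF d] by (simp add: g(2,3) algebra_simps)
    finally show ?thesis using g0 by simp
  qed
  have wa: "w * of_int a = of_int a1 * bet b" using gw unfolding g(1) by (simp add: ac_simps)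
  have mult: "w * z \<in> lat a b" if "z \<in> lat a b" for z
  proof -
    from that obtain x y where z: "z = of_int (x * a) + of_int y * bet b" unfolding lat_iff by blast
    have "w * z = of_int x * (w * of_int a) + of_int y * (w * bet b)" unfolding z by (simp add: algebra_simps)
    also have "\<dots> = of_int ((- y * c1) * a) + of_int (x * a1 + y * b1) * bet b"
      unfolding wa wb by (simp add: algebra_simps)
    finally show ?thesis using lat_intro by metis
  qed
  have "w \<in> Ord" by (rule Inv_multiplier[OF inv mult])
  then obtain x y where w: "w = of_int x + of_int y * \<omega>" by (rule Ord_cases)
  from disc_parity[OF d] obtain h where h: "b = 2 * h + \<Delta> mod 4" by (metis dvdE diff_eq_eq)
  have "of_int (g * x) + of_int (g * y) * \<omega> = of_int h + of_int 1 * \<omega>"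
    using gw unfolding w h bet_eq_\<omega> by (simp add: algebra_simps)
  from Ord_coords(2)[OF this] show ?thesis using g0 unfolding g_def[symmetric] by (simp add: zmult_eq_1_iff)
qed

lemma frac_ideal_eq_scaled_lat:
  assumes fr: "frac_ideal \<Delta> I"
  obtains q a b c where "pos q" "a > 0" "b\<^sup>2 - 4 * a * c = \<Delta>" "I = scale q (lat a b)"
proof -
  from fr obtain d where d: "d \<in> Ord" "d \<noteq> 0" "\<forall>y\<in>I. d * y \<in> Ord" unfolding frac_ideal_iff by blast
  obtain N where N: "cj d * d = of_int N"
    using d(1) norm_Ord by (elim Ord_cases) (metis mult.commute)
  have N0: "N \<noteq> 0" using N d Ord_K by (metis cj_eq_0_iff mult_eq_0_iff of_int_0)
  define n where "n = \<bar>N\<bar>"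
  have n: "n > 0" using N0 by (simp add: n_def)
  have "of_int n * y \<in> Ord" if "y \<in> I" for y
  proof -
    have "of_int (sgn N) * (cj d * (d * y)) \<in> Ord" using d that by auto
    also have "of_int (sgn N) * (cj d * (d * y)) = of_int (sgn N * N) * y"
      using N by (simp add: mult.assoc[symmetric])
    also have "sgn N * N = n" unfolding n_def by (simp add: abs_sgn mult.commute)
    finally show ?thesis .
  qed
  then have sub: "scale (of_int n) I \<subseteq> Ord" unfolding scale_def by auto
  have "frac_ideal \<Delta> (scale (of_int n) I)" using n by (intro frac_ideal_scale fr) auto
  from integral_ideal_lat[OF this sub] obtain e a b c where
    l: "e > 0" "a > 0" "b\<^sup>2 - 4 * a * c = \<Delta>" "scale (of_int n) I = scale (of_int e) (lat a b)" by metis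
  have "I = scale (inverse (of_int n)) (scale (of_int n) I)" using n by (simp add: scale_scale scale_1)
  then have I: "I = scale (of_int e / of_int n) (lat a b)"
    unfolding l(4) scale_scale by (simp add: divide_inverse mult.commute)
  have q: "pos (of_int e / of_int n)"
  proof (rule pos_Rats)
    have "(of_int e / of_int n :: complex) = of_real (of_int e / of_int n)" by simp
    then show "Re (of_int e / of_int n) > 0" using l(1) n by (simp only: Re_complex_of_real) simp
  qed auto
  show ?thesis by (rule that[OF q l(2,3) I])
qed

lemma Inv_eq_scaled_lat:
  assumes "I \<in> Inv"
  obtains q a b c where "pos q" "a > 0" "b\<^sup>2 - 4 * a * c = \<Delta>" "gcd a (gcd b c) = 1"
    "I = scale q (lat a b)"
proof -
  from frac_ideal_eq_scaled_lat[OF Inv_frac[OF assms]] obtain q a b c where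
    l: "pos q" "a > 0" "b\<^sup>2 - 4 * a * c = \<Delta>" and I: "I = scale q (lat a b)" .
  have "lat a b = scale (inverse q) I"
    unfolding I scale_scale using pos_nz[OF l(1)] by (simp add: scale_1)
  then have "lat a b \<in> Inv" using Inv_scale[OF assms] pos_K[OF l(1)] pos_nz[OF l(1)] by simp
  from invertible_lat_primitive[OF l(3) _ this] show ?thesis using that[OF l _ I] l(2) by simp
qed

lemma CG_lat:
  assumes "X \<in> carrier CG"
  obtains a b c where "a > 0" "b\<^sup>2 - 4 * a * c = \<Delta>" "gcd a (gcd b c) = 1" "X = cls (lat a b)"
proof -
  from assms obtain I where I: "I \<in> Inv" "X = cls I" unfolding carrier_CG by blast
  from Inv_eq_scaled_lat[OF I(1)] obtain q a b c where l: "pos q" "a > 0" "b\<^sup>2 - 4 * a * c = \<Delta>"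
    "gcd a (gcd b c) = 1" "I = scale q (lat a b)" .
  then have "lat a b \<in> Inv" by (intro Inv_lat) auto
  then have "X = cls (lat a b)" unfolding I(2) l(5) using cls_scale l(1) by blast
  then show ?thesis by (rule that[OF l(2-4)])
qed


subsection \<open>Equivalent forms and similar lattices\<close>

lemma lat_norm:
  assumes "b\<^sup>2 - 4 * a * c = \<Delta>"
  shows "(of_int (x * a) + of_int y * bet b) * cj (of_int (x * a) + of_int y * bet b) =
    of_int (a * bqf_eval (a, b, c) x y)"
proof -
  have "(of_int (x * a) + of_int y * bet b) * cj (of_int (x * a) + of_int y * bet b) =
    of_int (x * a * x * a + x * y * a * b) + of_int (y * y) * (bet b * cj (bet b))"
    by (simp add: cj_bet algebra_simps)
  then show ?thesis unfolding bet_norm[OF assms] by (simp add: power2_eq_square algebra_simps)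
qed

text \<open>
  A substitution of determinant 1 with columns \<open>(p, r)\<close>, \<open>(q, s)\<close> is a change of basis
  of the lattice, with new basis \<open>(A, B)\<close>, and multiplication by \<open>cj A / a\<close> brings this basis to
  normal form.
\<close>

lemma lat_similar_if_equiv:
  assumes d: "b\<^sup>2 - 4 * a * c = \<Delta>" and a: "a > 0" "a' > 0"
    and det: "p * s - q * r = 1"
    and a': "a' = a * p\<^sup>2 + b * p * r + c * r\<^sup>2"
    and b': "b' = 2 * a * p * q + b * (p * s + q * r) + 2 * c * r * s"
  shows "\<exists>z. pos z \<and> lat a' b' = scale z (lat a b)"
proof -
  define A where "A = of_int (p * a) + of_int r * bet b"
  define B where "B = of_int (q * a) + of_int s * bet b"
  define z where "z = cj A / of_int a"
  have AK: "A \<in> K" "B \<in> K" by (simp_all add: A_def B_def)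
  have NA: "A * cj A = of_int (a * a')"
    unfolding A_def lat_norm[OF d] a' by simp
  have zA: "z * A = of_int a'" using NA a by (simp add: z_def field_simps)
  have bb: "bet b' = bet b + of_int (a * p * q + b * (q * r) + c * r * s)"
  proof -
    have ps: "p * s = 1 + q * r" using det by simp
    have "b' = b + 2 * (a * p * q + b * (q * r) + c * r * s)" unfolding b' ps by (simp add: algebra_simps)
    then show ?thesis unfolding bet_def by (simp add: field_simps)
  qed
  have "cj A * B = of_int (p * q * a * a + r * q * a * b) + of_int ((p * s - q * r) * a) * bet b + of_int (r * s) * (bet b * cj (bet b))"
    unfolding A_def B_def by (simp add: cj_bet algebra_simps)
  also have "\<dots> = of_int a * bet b'" unfolding det bet_norm[OF d] bb by (simp add: algebra_simps)
  finally have zB: "z * B = bet b'" using a by (simp add: z_def field_simps)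
  have "Re (z * cj z) > 0"
  proof -
    have "z * cj z = of_int a' / of_int a"
      using NA a by (simp add: z_def AK field_simps)
    also have "\<dots> = of_real (of_int a' / of_int a)" by simp
    finally show ?thesis using a by (simp only: Re_complex_of_real) simp
  qed
  moreover have zK: "z \<in> K" using AK by (simp add: z_def)
  ultimately have z_pos: "pos z \<or> pos (- z)" by (rule pos_of_norm[rotated])
  have "lat a' b' = scale z (lat a b)"
  proof
    show "lat a' b' \<subseteq> scale z (lat a b)"
    proof
      fix w assume "w \<in> lat a' b'"
      then obtain x y where "w = of_int (x * a') + of_int y * bet b'" unfolding lat_iff by blast
      then have "w = of_int x * (z * A) + of_int y * (z * B)" unfolding zA zB by simp
      then have "w = z * (of_int ((x * p + y * q) * a) + of_int (x * r + y * s) * bet b)"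
        unfolding A_def B_def by (simp add: algebra_simps)
      then show "w \<in> scale z (lat a b)" unfolding scale_def using lat_intro by blast
    qed
    show "scale z (lat a b) \<subseteq> lat a' b'"
    proof
      fix w assume "w \<in> scale z (lat a b)"
      then obtain x y where w: "w = z * (of_int (x * a) + of_int y * bet b)" unfolding scale_def lat_def by blast
      have "of_int ((s * x - q * y) * a') + of_int (p * y - r * x) * bet b'
          = of_int (s * x - q * y) * (z * A) + of_int (p * y - r * x) * (z * B)"
        unfolding zA zB by simp
      also have "\<dots> = z * (of_int ((p * s - q * r) * x * a) + of_int ((p * s - q * r) * y) * bet b)"
        unfolding A_def B_def by (simp add: algebra_simps)
      also have "\<dots> = w" unfolding w det by simp
      finally show "w \<in> lat a' b'" using lat_intro by metis
    qed
  qed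
  moreover have "scale (- z) (lat a b) = scale z (lat a b)"
    using a frac_ideal_lat[OF d] by (intro scale_minus) auto
  ultimately show ?thesis using z_pos by metis
qed

text \<open>
  Conversely a similarity maps one basis to another.  The change of basis has determinant
  \<open>\<plusminus>1\<close>, and comparing \<open>cj A * B - A * cj B\<close> for both bases shows that its sign is that of
  the norm of the similarity factor.
\<close>

lemma equiv_if_lat_similar:
  assumes d: "b\<^sup>2 - 4 * a * c = \<Delta>" and d': "b'\<^sup>2 - 4 * a' * c' = \<Delta>" and a: "a > 0" "a' > 0"
    and z: "pos z" and eq: "lat a' b' = scale z (lat a b)"
  shows "bqf_properly_equiv (a, b, c) (a', b', c')"
proof -
  note z0 = pos_nz[OF z] pos_K[OF z]
  have "of_int a' \<in> scale z (lat a b)" using lat_gens(1)[of a' b'] unfolding eq .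
  then obtain p r where pr: "of_int a' = z * (of_int (p * a) + of_int r * bet b)"
    unfolding scale_def lat_def by blast
  have "bet b' \<in> scale z (lat a b)" using lat_gens(2)[of b' a'] unfolding eq .
  then obtain q s where qs: "bet b' = z * (of_int (q * a) + of_int s * bet b)"
    unfolding scale_def lat_def by blast
  define A where "A = of_int (p * a) + of_int r * bet b"
  define B where "B = of_int (q * a) + of_int s * bet b"
  have zA: "of_int a' = z * A" and zB: "bet b' = z * B" using pr qs by (simp_all add: A_def B_def)
  have AK: "A \<in> K" "B \<in> K" by (simp_all add: A_def B_def)
  have "z * of_int a \<in> lat a' b'" unfolding eq scale_def by (intro imageI lat_gens)
  then obtain x y where xy: "z * of_int a = of_int (x * a') + of_int y * bet b'" unfolding lat_iff by blast
  have "z * bet b \<in> lat a' b'" unfolding eq scale_def by (intro imageI lat_gens)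
  then obtain x' y' where "z * bet b = of_int (x' * a') + of_int y' * bet b'" unfolding lat_iff by blast
  with xy have "z * of_int a = z * (of_int x * A + of_int y * B)" "z * bet b = z * (of_int x' * A + of_int y' * B)"
    by (simp_all add: zA zB algebra_simps)
  then have ab: "of_int a = of_int x * A + of_int y * B" "bet b = of_int x' * A + of_int y' * B"
    using mult_left_cancel[OF z0(1)] by blast+
  have AB: "of_int u * A + of_int v * B = of_int ((u * p + v * q) * a) + of_int (u * r + v * s) * bet b" for u v
    by (simp add: A_def B_def algebra_simps)
  have c1: "of_int a + of_int 0 * bet b = of_int ((x * p + y * q) * a) + of_int (x * r + y * s) * bet b"
    unfolding AB[symmetric] using ab(1) by (simp only: of_int_0 mult_zero_left add_0_right)
  have c2: "of_int 0 + of_int 1 * bet b = of_int ((x' * p + y' * q) * a) + of_int (x' * r + y' * s) * bet b"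
    unfolding AB[symmetric] using ab(2) by (simp only: of_int_0 of_int_1 mult_1_left add_0_left)
  have e: "x * p + y * q = 1" "x * r + y * s = 0" "x' * p + y' * q = 0" "x' * r + y' * s = 1"
    using lat_coords[OF c1] lat_coords[OF c2] a by auto
  have "(p * s - q * r) * (x * y' - y * x') = (x * p + y * q) * (x' * r + y' * s) - (x * r + y * s) * (x' * p + y' * q)"
    by (simp add: algebra_simps)
  then have unit: "(p * s - q * r) * (x * y' - y * x') = 1" unfolding e by simp
  have or1: "cj (of_int a') * bet b' - of_int a' * cj (bet b') = of_int a' * \<delta>"
    by (simp add: bet_def field_simps)
  have or2: "cj A * B - A * cj B = of_int ((p * s - q * r) * a) * \<delta>"
  proof -
    have "cj A * B - A * cj B = of_int ((p * s - q * r) * a) * (bet b - cj (bet b))"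
      unfolding A_def B_def by (simp add: algebra_simps)
    also have "bet b - cj (bet b) = \<delta>" by (simp add: bet_def field_simps)
    finally show ?thesis .
  qed
  have "of_int a' * \<delta> = (z * cj z) * (cj A * B - A * cj B)"
  proof -
    have "of_int a' * \<delta> = cj (z * A) * (z * B) - (z * A) * cj (z * B)"
      using or1[symmetric] unfolding zA zB .
    also have "\<dots> = (z * cj z) * (cj A * B - A * cj B)" using z0 AK by (simp add: algebra_simps)
    finally show ?thesis .
  qed
  then have N: "of_int a' = (z * cj z) * of_int ((p * s - q * r) * a)"
    unfolding or2 using \<delta>_nonzero by (simp add: mult.assoc[symmetric])
  have "of_int a' = Re (z * cj z) * of_int ((p * s - q * r) * a)"
  proof -
    have "Re (of_int a') = Re ((z * cj z) * of_int ((p * s - q * r) * a))" using N by (rule arg_cong)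
    then show ?thesis by simp
  qed
  then have "real_of_int ((p * s - q * r) * a) > 0" using a pos_norm[OF z]
    by (metis of_int_0_less_iff zero_less_mult_pos)
  then have "p * s - q * r > 0" using a by (simp only: of_int_0_less_iff) (simp add: zero_less_mult_iff)
  then have det: "p * s - q * r = 1" using unit by (simp add: zmult_eq_1_iff)
  have N': "of_int a' = (z * cj z) * of_int a" using N unfolding det by simp
  have "bqf_eval (a', b', c') x y = bqf_eval (a, b, c) (p * x + q * y) (r * x + s * y)" for x y
  proof -
    have "of_int (a' * bqf_eval (a', b', c') x y) = (of_int x * (z * A) + of_int y * (z * B)) * cj (of_int x * (z * A) + of_int y * (z * B))"
      unfolding lat_norm[OF d', symmetric] zB[symmetric] zA[symmetric] by (simp only: of_int_mult)
    also have "\<dots> = (z * cj z) * ((of_int x * A + of_int y * B) * cj (of_int x * A + of_int y * B))"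
      using z0 AK by (simp add: algebra_simps)
    also have "of_int x * A + of_int y * B = of_int ((p * x + q * y) * a) + of_int (r * x + s * y) * bet b"
      unfolding A_def B_def by (simp add: algebra_simps)
    also have "(z * cj z) * (\<dots> * cj \<dots>) = (z * cj z) * of_int (a * bqf_eval (a, b, c) (p * x + q * y) (r * x + s * y))"
      unfolding lat_norm[OF d] ..
    also have "\<dots> = of_int a' * of_int (bqf_eval (a, b, c) (p * x + q * y) (r * x + s * y))"
      unfolding N' by (simp only: of_int_mult mult.assoc)
    also have "\<dots> = of_int (a' * bqf_eval (a, b, c) (p * x + q * y) (r * x + s * y))" by (simp only: of_int_mult)
    finally show ?thesis using a by (simp only: of_int_eq_iff) simp
  qed
  then show ?thesis unfolding bqf_properly_equiv_def using det by blast
qed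

end


section \<open>Proper equivalence of forms\<close>

lemma bqf_eval_eq_iff: "(\<forall>x y. bqf_eval f x y = bqf_eval g x y) \<longleftrightarrow> f = g"
proof
  assume *: "\<forall>x y. bqf_eval f x y = bqf_eval g x y"
  obtain a b c where f: "f = (a, b, c)" by (cases f)
  obtain a' b' c' where g: "g = (a', b', c')" by (cases g)
  show "f = g" using *[rule_format, of 1 0] *[rule_format, of 0 1] *[rule_format, of 1 1] by (simp add: f g)
qed simp

lemma bqf_eval_subst:
  "bqf_eval (a, b, c) (p * x + q * y) (r * x + s * y) =
   bqf_eval (a * p\<^sup>2 + b * p * r + c * r\<^sup>2, 2 * a * p * q + b * (p * s + q * r) + 2 * c * r * s,
     a * q\<^sup>2 + b * q * s + c * s\<^sup>2) x y"
  by (simp add: power2_eq_square algebra_simps)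

lemma properly_equiv_iff:
  "bqf_properly_equiv (a, b, c) g \<longleftrightarrow> (\<exists>p q r s. p * s - q * r = 1 \<and>
     g = (a * p\<^sup>2 + b * p * r + c * r\<^sup>2, 2 * a * p * q + b * (p * s + q * r) + 2 * c * r * s,
     a * q\<^sup>2 + b * q * s + c * s\<^sup>2))"
  unfolding bqf_properly_equiv_def bqf_eval_subst bqf_eval_eq_iff ..

lemma properly_equiv_refl: "bqf_properly_equiv f f"
  unfolding bqf_properly_equiv_def
  by (intro exI[of _ 1] exI[of _ 0] exI[of _ 0] exI[of _ 1]) simp

lemma properly_equiv_sym:
  assumes "bqf_properly_equiv f g" shows "bqf_properly_equiv g f"
proof -
  from assms obtain p q r s where d: "p * s - q * r = 1"
    and g: "\<And>x y. bqf_eval g x y = bqf_eval f (p * x + q * y) (r * x + s * y)"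
    unfolding bqf_properly_equiv_def by blast
  have "bqf_eval f x y = bqf_eval g (s * x + (- q) * y) ((- r) * x + p * y)" for x y
  proof -
    have "p * (s * x + (- q) * y) + q * ((- r) * x + p * y) = (p * s - q * r) * x"
      "r * (s * x + (- q) * y) + s * ((- r) * x + p * y) = (p * s - q * r) * y"
      by (simp_all add: algebra_simps)
    then show ?thesis unfolding g d by simp
  qed
  moreover have "s * p - (- q) * (- r) = 1" using d by (simp add: mult.commute)
  ultimately show ?thesis unfolding bqf_properly_equiv_def by blast
qed

lemma properly_equiv_trans:
  assumes "bqf_properly_equiv f g" "bqf_properly_equiv g h" shows "bqf_properly_equiv f h"
proof -
  from assms(1) obtain p q r s where d: "p * s - q * r = 1"
    and g: "\<And>x y. bqf_eval g x y = bqf_eval f (p * x + q * y) (r * x + s * y)"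
    unfolding bqf_properly_equiv_def by blast
  from assms(2) obtain p' q' r' s' where d': "p' * s' - q' * r' = 1"
    and h: "\<And>x y. bqf_eval h x y = bqf_eval g (p' * x + q' * y) (r' * x + s' * y)"
    unfolding bqf_properly_equiv_def by blast
  have "bqf_eval h x y = bqf_eval f ((p * p' + q * r') * x + (p * q' + q * s') * y)
      ((r * p' + s * r') * x + (r * q' + s * s') * y)" for x y
    unfolding h g by (simp add: algebra_simps)
  moreover have "(p * p' + q * r') * (r * q' + s * s') - (p * q' + q * s') * (r * p' + s * r') =
      (p * s - q * r) * (p' * s' - q' * r')" by (simp add: algebra_simps)
  ultimately show ?thesis unfolding bqf_properly_equiv_def d d' by (metis mult_1)
qed

lemma bqf_class_eq_iff: "bqf_class f = bqf_class g \<longleftrightarrow> bqf_properly_equiv f g"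
  unfolding bqf_class_def
  using properly_equiv_refl properly_equiv_sym properly_equiv_trans by blast

lemma properly_equiv_disc:
  assumes "bqf_properly_equiv f g" shows "bqf_disc g = bqf_disc f"
proof -
  obtain a b c where f: "f = (a, b, c)" by (cases f)
  from assms obtain p q r s where d: "p * s - q * r = 1" and
    g: "g = (a * p\<^sup>2 + b * p * r + c * r\<^sup>2, 2 * a * p * q + b * (p * s + q * r) + 2 * c * r * s,
     a * q\<^sup>2 + b * q * s + c * s\<^sup>2)" unfolding f properly_equiv_iff by blast
  have "bqf_disc g = (p * s - q * r)\<^sup>2 * bqf_disc f"
    unfolding f g by (simp add: power2_eq_square algebra_simps)
  then show ?thesis unfolding d by simp
qed

lemma properly_equiv_primitive:
  assumes "bqf_properly_equiv f g" "bqf_primitive f" shows "bqf_primitive g"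
proof -
  obtain a b c where g: "g = (a, b, c)" by (cases g)
  obtain a' b' c' where f: "f = (a', b', c')" by (cases f)
  let ?d = "gcd a (gcd b c)"
  have d: "?d dvd a" "?d dvd b" "?d dvd c" using dvd_trans[OF gcd_dvd2] by auto
  have comb: "?d dvd a * u + b * v + c * w" for u v w using d by simp
  from properly_equiv_sym[OF assms(1)] obtain p q r s where
    "a' = a * p\<^sup>2 + b * p * r + c * r\<^sup>2" "b' = 2 * a * p * q + b * (p * s + q * r) + 2 * c * r * s"
    "c' = a * q\<^sup>2 + b * q * s + c * s\<^sup>2" unfolding f g properly_equiv_iff by blast
  then have "?d dvd a'" "?d dvd b'" "?d dvd c'"
    using comb[of "p\<^sup>2" "p * r" "r\<^sup>2"] comb[of "2 * p * q" "p * s + q * r" "2 * r * s"]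
      comb[of "q\<^sup>2" "q * s" "s\<^sup>2"] by (simp_all add: ac_simps)
  then have "?d dvd gcd a' (gcd b' c')" by (intro gcd_greatest)
  then have "?d dvd 1" using assms(2) unfolding f bqf_primitive.simps by (simp only:)
  then show ?thesis unfolding g bqf_primitive.simps by simp
qed

lemma class_represents_bqf_class:
  "class_represents (bqf_class f) n \<longleftrightarrow> (\<exists>x y. n = bqf_eval f x y)"
proof
  assume "class_represents (bqf_class f) n"
  then obtain g x y where g: "bqf_properly_equiv f g" "n = bqf_eval g x y"
    unfolding class_represents_def bqf_class_def by blast
  then show "\<exists>x y. n = bqf_eval f x y" unfolding bqf_properly_equiv_def by auto
next
  assume "\<exists>x y. n = bqf_eval f x y"
  then show "class_represents (bqf_class f) n"
    unfolding class_represents_def bqf_class_def using properly_equiv_refl by blast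
qed

lemma properly_equiv_leading:
  assumes "coprime x y"
  shows "\<exists>b c. bqf_properly_equiv f (bqf_eval f x y, b, c)"
proof -
  obtain a b c where f: "f = (a, b, c)" by (cases f)
  obtain u v where "u * x + v * y = 1" using assms bezout_int[of x y] by auto
  then have "x * u - (- v) * y = 1" by (simp add: algebra_simps)
  then have "bqf_properly_equiv f (a * x\<^sup>2 + b * x * y + c * y\<^sup>2,
      2 * a * x * (- v) + b * (x * u + (- v) * y) + 2 * c * y * u, a * (- v)\<^sup>2 + b * (- v) * u + c * u\<^sup>2)"
    unfolding f properly_equiv_iff by blast
  then show ?thesis unfolding f bqf_eval.simps by blast
qed

text \<open>
  Modulo each prime dividing \<open>N\<close>, the pair \<open>(x, y)\<close> is chosen congruent to \<open>(unit, 0)\<close>, \<open>(0, unit)\<close> or \<open>(unit, unit)\<close> according to which of the coefficients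
  \<open>a\<close>, \<open>c\<close>, \<open>b\<close> is the first one that is not divisible by the prime.  Adding a large multiple of
  \<open>N y\<close> to \<open>x\<close> makes the value positive.
\<close>

lemma primitive_form_value_coprime:
  fixes a b c N :: int
  assumes prim: "gcd a (gcd b c) = 1" and a: "a > 0" and N: "N > 0"
  shows "\<exists>x y. coprime x y \<and> bqf_eval (a, b, c) x y > 0 \<and> coprime (bqf_eval (a, b, c) x y) N"
proof -
  define S where "S = {p \<in> prime_factors N. \<not> p dvd a}"
  define T where "T = {p \<in> prime_factors N. p dvd a \<and> \<not> p dvd c}"
  define y x0 where "y = \<Prod>S" and "x0 = \<Prod>T"
  \<comment> \<open>With this \<open>k\<close> the term \<open>a x\<^sup>2\<close> dominates the other two.\<close>
  define k where "k = \<bar>b\<bar> + \<bar>c\<bar> + 1"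
  define x where "x = x0 + k * N * y"
  have fin: "finite S" "finite T" unfolding S_def T_def by auto
  have primes: "Factorial_Ring.prime p" if "p \<in> S \<or> p \<in> T" for p using that unfolding S_def T_def by auto
  have dvd_prod: "p dvd \<Prod>A \<longleftrightarrow> p \<in> A"
    if "Factorial_Ring.prime p" "finite A" "\<And>q. q \<in> A \<Longrightarrow> Factorial_Ring.prime q" for p :: int and A
  proof -
    have "p dvd \<Prod>A \<longleftrightarrow> (\<exists>q\<in>A. p dvd q)" using that by (simp add: prime_dvd_prod_iff)
    also have "\<dots> \<longleftrightarrow> p \<in> A"
    proof
      assume "\<exists>q\<in>A. p dvd q"
      then obtain q where "q \<in> A" "p dvd q" by blast
      moreover from this have "p = q" using that primes_dvd_imp_eq[of p q] by simp
      ultimately show "p \<in> A" by simp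
    next
      assume "p \<in> A"
      then show "\<exists>q\<in>A. p dvd q" using dvd_refl by (rule bexI[rotated])
    qed
    finally show ?thesis .
  qed
  have py: "p dvd y \<longleftrightarrow> p dvd N \<and> \<not> p dvd a" if "Factorial_Ring.prime p" for p
    unfolding y_def dvd_prod[OF that fin(1) primes, simplified] using that N by (auto simp: S_def in_prime_factors_iff)
  have px0: "p dvd x0 \<longleftrightarrow> p dvd N \<and> p dvd a \<and> \<not> p dvd c" if "Factorial_Ring.prime p" for p
    unfolding x0_def dvd_prod[OF that fin(2) primes, simplified] using that N by (auto simp: T_def in_prime_factors_iff)
  have y0: "y > 0" unfolding y_def using primes by (intro prod_pos) (auto dest: prime_gt_0_int)
  have x0: "x0 > 0" unfolding x0_def using primes by (intro prod_pos) (auto dest: prime_gt_0_int)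
  have k0: "k > 0" unfolding k_def by simp
  have "k * y \<le> k * N * y" using k0 y0 N by simp
  then have xky: "x > k * y" unfolding x_def using x0 by linarith
  have "1 * y \<le> k * y" using k0 y0 by (intro mult_right_mono) auto
  then have xy: "x \<ge> y" using xky by linarith
  have px: "p dvd x \<longleftrightarrow> p dvd x0" if "p dvd N" for p
    unfolding x_def using that by (simp add: dvd_add_left_iff)
  have "coprime x y"
  proof (rule coprimeI)
    fix d assume d: "d dvd x" "d dvd y"
    show "is_unit d"
    proof (rule ccontr)
      assume "\<not> is_unit d"
      moreover have "d \<noteq> 0" using d y0 by auto
      ultimately obtain p where p: "Factorial_Ring.prime p" "p dvd d" using prime_divisorE by blast
      then have "p dvd y" "p dvd x" using d dvd_trans by blast+
      then show False using py[OF p(1)] px0[OF p(1)] px[of p] by blast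
    qed
  qed
  moreover have "bqf_eval (a, b, c) x y > 0"
  proof -
    have xp: "x > 0" using xy y0 by linarith
    have "a * x\<^sup>2 \<ge> x\<^sup>2" using a by (simp add: mult_le_cancel_right1)
    moreover have "b * x * y \<ge> - (\<bar>b\<bar> * x * y)"
      using abs_ge_minus_self[of "b * (x * y)"] xp y0 by (simp add: abs_mult mult.assoc)
    moreover have "c * y\<^sup>2 \<ge> - (\<bar>c\<bar> * x * y)"
    proof -
      have "\<bar>c\<bar> * (y * y) \<le> \<bar>c\<bar> * (x * y)" using xy y0 by (intro mult_left_mono mult_right_mono) auto
      moreover have "c * (y * y) \<ge> - (\<bar>c\<bar> * (y * y))"
        using abs_ge_minus_self[of "c * (y * y)"] y0 by (simp add: abs_mult)
      ultimately show ?thesis by (simp add: power2_eq_square mult.assoc)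
    qed
    moreover have "x\<^sup>2 - \<bar>b\<bar> * x * y - \<bar>c\<bar> * x * y > 0"
    proof -
      have "x * (x - (\<bar>b\<bar> + \<bar>c\<bar>) * y) > 0"
        using xp xky y0 unfolding k_def by (intro mult_pos_pos) (auto simp: algebra_simps)
      then show ?thesis by (simp add: power2_eq_square algebra_simps)
    qed
    ultimately show ?thesis by simp
  qed
  moreover have "coprime (bqf_eval (a, b, c) x y) N"
  proof (rule coprimeI)
    fix d assume d: "d dvd bqf_eval (a, b, c) x y" "d dvd N"
    show "is_unit d"
    proof (rule ccontr)
      assume "\<not> is_unit d"
      moreover have "d \<noteq> 0" using d N by auto
      ultimately obtain p where p: "Factorial_Ring.prime p" "p dvd d" using prime_divisorE by blast
      then have pN: "p dvd N" and pf: "p dvd a * x\<^sup>2 + b * x * y + c * y\<^sup>2" using d dvd_trans by auto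
      note pd = prime_dvd_mult_iff[OF p(1)] prime_dvd_power_iff[OF p(1)]
      show False
      proof (cases "p dvd a")
        case False
        then have "p dvd y" "\<not> p dvd x" using py[OF p(1)] px0[OF p(1)] px[OF pN] pN by auto
        moreover from this have "p dvd a * x\<^sup>2"
          using pf by (simp add: add.assoc dvd_add_left_iff power2_eq_square)
        ultimately show False using False by (simp add: pd)
      next
        case True
        then have ny: "\<not> p dvd y" using py[OF p(1)] by simp
        show False
        proof (cases "p dvd c")
          case False
          then have "p dvd x" using px0[OF p(1)] px[OF pN] pN True by simp
          then have "p dvd c * y\<^sup>2" using pf True by (simp add: dvd_add_right_iff)
          then show False using False ny by (simp add: pd)
        next
          case c: True
          then have nx: "\<not> p dvd x" using px0[OF p(1)] px[OF pN] by simp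
          have "p dvd (b * x * y) + (a * x\<^sup>2 + c * y\<^sup>2)" using pf by (simp add: ac_simps)
          then have "p dvd b * x * y" using True c by (subst (asm) dvd_add_left_iff) auto
          then have "p dvd b" using nx ny by (simp add: pd)
          then have "p dvd gcd a (gcd b c)" using True c by simp
          then show False using prim p(1) by (simp add: not_prime_unit)
        qed
      qed
    qed
  qed
  ultimately show ?thesis by blast
qed

lemma primitive_form_leading_coprime:
  fixes a b c N :: int
  assumes "gcd a (gcd b c) = 1" "a > 0" "N > 0"
  shows "\<exists>a' b' c'. bqf_properly_equiv (a, b, c) (a', b', c') \<and> a' > 0 \<and> coprime a' N"
  using primitive_form_value_coprime[OF assms] properly_equiv_leading[of _ _ "(a, b, c)"] by metis


section \<open>Form classes and narrow ideal classes\<close>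

context quadratic
begin

lemma form_classes_obtain:
  assumes "F \<in> form_classes \<Delta>"
  obtains a b c where "a > 0" "b\<^sup>2 - 4 * a * c = \<Delta>" "gcd a (gcd b c) = 1" "F = bqf_class (a, b, c)"
proof -
  from assms obtain f where f: "bqf_disc f = \<Delta>" "bqf_primitive f" "\<not> bqf_negative_definite f" "F = bqf_class f"
    unfolding form_classes_def by blast
  obtain a b c where abc: "f = (a, b, c)" by (cases f)
  have d: "b\<^sup>2 - 4 * a * c = \<Delta>" using f(1) abc by simp
  have a0: "a \<noteq> 0" using d nonsquare by auto
  from f(3) obtain x y where xy: "(x, y) \<noteq> (0, 0)" "bqf_eval f x y \<ge> 0"
    unfolding bqf_negative_definite_def by (meson not_less)
  have "bqf_eval f x y \<noteq> 0"
  proof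
    assume "bqf_eval f x y = 0"
    then have "(of_int (x * a) + of_int y * bet b) * cj (of_int (x * a) + of_int y * bet b) = 0"
      unfolding lat_norm[OF d] abc[symmetric] by simp
    moreover have "of_int (x * a) + of_int y * bet b \<in> K" by simp
    ultimately have "of_int (x * a) + of_int y * bet b = 0" by (metis cj_eq_0_iff mult_eq_0_iff)
    then have "of_int (x * a) + of_int y * bet b = of_int 0 + of_int 0 * bet b" by simp
    from lat_coords[OF this] show False using xy(1) a0 by auto
  qed
  with xy have pos: "bqf_eval f x y > 0" by simp
  define g where "g = gcd x y"
  have g0: "g \<noteq> 0" using xy(1) unfolding g_def by auto
  obtain p r where pr: "x = p * g" "y = r * g" "coprime p r"
    using gcd_coprime_exists[of x y] g0 unfolding g_def by auto
  have "bqf_eval f x y = g\<^sup>2 * bqf_eval f p r"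
    unfolding abc pr(1,2) by (simp add: power2_eq_square algebra_simps)
  then have "bqf_eval f p r > 0" using pos by (simp add: zero_less_mult_iff)
  moreover obtain b' c' where "bqf_properly_equiv f (bqf_eval f p r, b', c')"
    using properly_equiv_leading[OF pr(3)] by blast
  moreover from this have "bqf_disc (bqf_eval f p r, b', c') = \<Delta>" "bqf_primitive (bqf_eval f p r, b', c')"
    using properly_equiv_disc properly_equiv_primitive f by (blast, blast)
  ultimately show ?thesis using that[of "bqf_eval f p r" b' c'] f(4) bqf_class_eq_iff by simp
qed

lemma form_classes_intro:
  assumes "a > 0" "b\<^sup>2 - 4 * a * c = \<Delta>" "gcd a (gcd b c) = 1"
  shows "bqf_class (a, b, c) \<in> form_classes \<Delta>"
proof -
  have "bqf_eval (a, b, c) 1 0 > 0" using assms by simp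
  then have "\<not> bqf_negative_definite (a, b, c)"
    unfolding bqf_negative_definite_def by (metis less_asym' prod.inject zero_neq_one)
  then show ?thesis unfolding form_classes_def using assms by auto
qed

lemma form_class_member:
  assumes "(a', b', c') \<in> bqf_class (a, b, c)" "b\<^sup>2 - 4 * a * c = \<Delta>" "gcd a (gcd b c) = 1"
  shows "b'\<^sup>2 - 4 * a' * c' = \<Delta>" "gcd a' (gcd b' c') = 1" "bqf_properly_equiv (a, b, c) (a', b', c')"
  using assms properly_equiv_disc[of "(a, b, c)" "(a', b', c')"]
    properly_equiv_primitive[of "(a, b, c)" "(a', b', c')"]
  unfolding bqf_class_def by auto

text \<open>
  The two directions of the correspondence between equivalence of forms and similarity of lattices;
  a totally positive factor of similarity corresponds to a substitution of determinant \<open>1\<close>.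
\<close>

lemma cls_lat_eq_iff:
  assumes "a > 0" "b\<^sup>2 - 4 * a * c = \<Delta>" "gcd a (gcd b c) = 1"
    and "a' > 0" "b'\<^sup>2 - 4 * a' * c' = \<Delta>" "gcd a' (gcd b' c') = 1"
  shows "cls (lat a b) = cls (lat a' b') \<longleftrightarrow> bqf_properly_equiv (a, b, c) (a', b', c')"
proof -
  have inv: "lat a b \<in> Inv" "lat a' b' \<in> Inv"
    using Inv_lat[OF assms(2,3)] Inv_lat[OF assms(5,6)] assms(1,4) by simp_all
  show ?thesis
    unfolding cls_eq_iff[OF inv]
  proof
    assume "\<exists>z. pos z \<and> lat a' b' = scale z (lat a b)"
    then show "bqf_properly_equiv (a, b, c) (a', b', c')"
      using equiv_if_lat_similar[OF assms(2,5,1,4)] by blast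
  next
    assume "bqf_properly_equiv (a, b, c) (a', b', c')"
    then show "\<exists>z. pos z \<and> lat a' b' = scale z (lat a b)"
      unfolding properly_equiv_iff using lat_similar_if_equiv[OF assms(2,1,4)] by auto
  qed
qed

abbreviation \<Phi> :: "bqf set \<Rightarrow> complex set set" where "\<Phi> \<equiv> form_to_ideal_class \<Delta>"
abbreviation FG :: "bqf set monoid" where "FG \<equiv> form_class_group \<Delta>"

lemma \<Phi>_eval:
  assumes "a > 0" "b\<^sup>2 - 4 * a * c = \<Delta>" "gcd a (gcd b c) = 1"
  shows "\<Phi> (bqf_class (a, b, c)) = cls (lat a b)"
  unfolding form_to_ideal_class_def
proof (rule the_equality)
  have "(a, b, c) \<in> bqf_class (a, b, c)" unfolding bqf_class_def using properly_equiv_refl by simp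
  then show "\<exists>a' b' c'. (a', b', c') \<in> bqf_class (a, b, c) \<and> a' > 0 \<and> cls (lat a b) =
      cls (Idl\<^bsub>ring_on Ord\<^esub> {of_int a', (of_int b' + csqrt (of_int \<Delta>)) / 2})"
    using assms(1) genideal_lat[OF assms(2)] by metis
next
  fix X
  assume "\<exists>a' b' c'. (a', b', c') \<in> bqf_class (a, b, c) \<and> a' > 0 \<and> X =
      cls (Idl\<^bsub>ring_on Ord\<^esub> {of_int a', (of_int b' + csqrt (of_int \<Delta>)) / 2})"
  then obtain a' b' c' where m: "(a', b', c') \<in> bqf_class (a, b, c)" "a' > 0"
    "X = cls (Idl\<^bsub>ring_on Ord\<^esub> {of_int a', (of_int b' + csqrt (of_int \<Delta>)) / 2})" by blast
  note mem = form_class_member[OF m(1) assms(2,3)]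
  show "X = cls (lat a b)"
    unfolding m(3) genideal_lat[OF mem(1)] using cls_lat_eq_iff[OF assms m(2) mem(1,2)] mem(3) by simp
qed

lemma \<Phi>_bij: "bij_betw \<Phi> (form_classes \<Delta>) (carrier CG)"
  unfolding bij_betw_def
proof
  show "inj_on \<Phi> (form_classes \<Delta>)"
  proof (rule inj_onI)
    fix F F' assume F: "F \<in> form_classes \<Delta>" and F': "F' \<in> form_classes \<Delta>" and eq: "\<Phi> F = \<Phi> F'"
    obtain a b c where f: "a > 0" "b\<^sup>2 - 4 * a * c = \<Delta>" "gcd a (gcd b c) = 1" "F = bqf_class (a, b, c)"
      using form_classes_obtain[OF F] .
    obtain a' b' c' where f': "a' > 0" "b'\<^sup>2 - 4 * a' * c' = \<Delta>" "gcd a' (gcd b' c') = 1" "F' = bqf_class (a', b', c')"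
      using form_classes_obtain[OF F'] .
    have "cls (lat a b) = cls (lat a' b')" using eq unfolding f(4) f'(4) \<Phi>_eval[OF f(1-3)] \<Phi>_eval[OF f'(1-3)] .
    then show "F = F'"
      unfolding cls_lat_eq_iff[OF f(1-3) f'(1-3)] f(4) f'(4) bqf_class_eq_iff .
  qed
  show "\<Phi> ` form_classes \<Delta> = carrier CG"
  proof
    show "\<Phi> ` form_classes \<Delta> \<subseteq> carrier CG"
    proof (rule image_subsetI)
      fix F assume "F \<in> form_classes \<Delta>"
      then obtain a b c where f: "a > 0" "b\<^sup>2 - 4 * a * c = \<Delta>" "gcd a (gcd b c) = 1" "F = bqf_class (a, b, c)"
        by (rule form_classes_obtain)
      then have "lat a b \<in> Inv" by (intro Inv_lat) auto
      then show "\<Phi> F \<in> carrier CG" unfolding f(4) \<Phi>_eval[OF f(1-3)] by (rule cls_closed)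
    qed
    show "carrier CG \<subseteq> \<Phi> ` form_classes \<Delta>"
    proof
      fix X assume "X \<in> carrier CG"
      then obtain a b c where l: "a > 0" "b\<^sup>2 - 4 * a * c = \<Delta>" "gcd a (gcd b c) = 1" "X = cls (lat a b)"
        by (rule CG_lat)
      then show "X \<in> \<Phi> ` form_classes \<Delta>" using \<Phi>_eval[OF l(1-3)] form_classes_intro[OF l(1-3)] by blast
    qed
  qed
qed

lemma equiv_translate:
  "bqf_properly_equiv (a, b, c) (a, b + 2 * a * k, a * k\<^sup>2 + b * k + c)"
  unfolding properly_equiv_iff
  by (intro exI[of _ 1] exI[of _ k] exI[of _ 0]) (simp add: algebra_simps)

text \<open>
  United forms in two given classes: with coprime leading coefficients \<open>a\<close>, \<open>a'\<close>, translations
  change the middle coefficients by multiples of \<open>2a\<close> and \<open>2a'\<close>, and these have the same parity.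
\<close>

lemma united_forms_exist:
  assumes F: "F \<in> form_classes \<Delta>" and F': "F' \<in> form_classes \<Delta>"
  obtains a a' b c where "a > 0" "a' > 0" "(a, b, a' * c) \<in> F" "(a', b, a * c) \<in> F'"
proof -
  obtain a b1 c1 where f: "a > 0" "b1\<^sup>2 - 4 * a * c1 = \<Delta>" "gcd a (gcd b1 c1) = 1" "F = bqf_class (a, b1, c1)"
    using form_classes_obtain[OF F] .
  obtain a0 b0 c0 where f0: "a0 > 0" "b0\<^sup>2 - 4 * a0 * c0 = \<Delta>" "gcd a0 (gcd b0 c0) = 1" "F' = bqf_class (a0, b0, c0)"
    using form_classes_obtain[OF F'] .
  obtain a' b2 c2 where e: "bqf_properly_equiv (a0, b0, c0) (a', b2, c2)" "a' > 0" "coprime a' a"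
    using primitive_form_leading_coprime[OF f0(3,1) f(1)] by blast
  have d2: "b2\<^sup>2 - 4 * a' * c2 = \<Delta>" using properly_equiv_disc[OF e(1)] f0(2) by simp
  have "even (b2 - b1)" using disc_parity[OF f(2)] disc_parity[OF d2] by presburger
  then obtain t where t: "b2 - b1 = 2 * t" by blast
  obtain u v where uv: "u * a' + v * a = 1" using e(3) bezout_int[of a' a] by auto
  define k l where "k = v * t" and "l = - (u * t)"
  have "a * k - a' * l = (u * a' + v * a) * t" unfolding k_def l_def by (simp add: algebra_simps)
  then have kl: "a * k - a' * l = t" unfolding uv by simp
  define b where "b = b1 + 2 * a * k"
  have b: "b = b2 + 2 * a' * l" unfolding b_def using kl t by linarith
  define C where "C = a * k\<^sup>2 + b1 * k + c1"
  define C' where "C' = a' * l\<^sup>2 + b2 * l + c2"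
  have C: "bqf_properly_equiv (a, b1, c1) (a, b, C)" unfolding b_def C_def by (rule equiv_translate)
  have C': "bqf_properly_equiv (a', b2, c2) (a', b, C')" unfolding b C'_def by (rule equiv_translate)
  have dC: "b\<^sup>2 - 4 * a * C = \<Delta>" using properly_equiv_disc[OF C] f(2) by simp
  have dC': "b\<^sup>2 - 4 * a' * C' = \<Delta>" using properly_equiv_disc[OF C'] d2 by simp
  have aC: "a * C = a' * C'" using dC dC' by linarith
  then have "a' dvd a * C" by simp
  then have "a' dvd C" using e(3) by (simp add: coprime_dvd_mult_right_iff)
  then obtain c where c: "C = a' * c" by blast
  then have "C' = a * c" using aC e(2) by simp
  then have "(a', b, a * c) \<in> F'" unfolding f0(4) bqf_class_def using properly_equiv_trans[OF e(1) C'] by simp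
  moreover have "(a, b, a' * c) \<in> F" unfolding f(4) bqf_class_def using C c by simp
  ultimately show ?thesis using that f(1) e(2) by blast
qed

text \<open>
  Since the lattices of united forms multiply to the lattice of the composed form and \<open>\<Phi>\<close> is
  injective, the composed class depends only on the classes of the two forms.
\<close>

lemma united_forms_\<Phi>:
  assumes F: "F \<in> form_classes \<Delta>" and F': "F' \<in> form_classes \<Delta>"
    and u: "a > 0" "a' > 0" "(a, b, a' * c) \<in> F" "(a', b, a * c) \<in> F'"
  shows "bqf_class (a * a', b, c) \<in> form_classes \<Delta>"
    "\<Phi> (bqf_class (a * a', b, c)) = \<Phi> F \<otimes>\<^bsub>CG\<^esub> \<Phi> F'"
proof -
  obtain a1 b1 c1 where f1: "a1 > 0" "b1\<^sup>2 - 4 * a1 * c1 = \<Delta>" "gcd a1 (gcd b1 c1) = 1" "F = bqf_class (a1, b1, c1)"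
    using form_classes_obtain[OF F] .
  obtain a2 b2 c2 where f2: "a2 > 0" "b2\<^sup>2 - 4 * a2 * c2 = \<Delta>" "gcd a2 (gcd b2 c2) = 1" "F' = bqf_class (a2, b2, c2)"
    using form_classes_obtain[OF F'] .
  note m1 = form_class_member[OF u(3)[unfolded f1(4)] f1(2,3)]
  note m2 = form_class_member[OF u(4)[unfolded f2(4)] f2(2,3)]
  have F_eq: "F = bqf_class (a, b, a' * c)" "F' = bqf_class (a', b, a * c)"
    using m1(3) m2(3) unfolding f1(4) f2(4) bqf_class_eq_iff by simp_all
  have d: "b\<^sup>2 - 4 * (a * a') * c = \<Delta>" using m1(1) by (simp add: algebra_simps)
  have dvd1: "is_unit e" if "e dvd a" "e dvd b" "e dvd a' * c" for e
    using m1(2) that by (metis gcd_greatest)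
  have dvd2: "is_unit e" if "e dvd a'" "e dvd b" "e dvd a * c" for e
    using m2(2) that by (metis gcd_greatest)
  have g: "gcd a (gcd a' b) = 1"
    using dvd1[of "gcd a (gcd a' b)"] by (simp add: dvd_trans[OF gcd_dvd2] dvd_mult2 gcd_proj1_iff)
  have g': "gcd (a * a') (gcd b c) = 1"
  proof (rule ccontr)
    assume "gcd (a * a') (gcd b c) \<noteq> 1"
    then have "\<not> is_unit (gcd (a * a') (gcd b c))" by simp
    moreover have "gcd (a * a') (gcd b c) \<noteq> 0" using u by simp
    ultimately obtain p where p: "Factorial_Ring.prime p" "p dvd gcd (a * a') (gcd b c)" using prime_divisorE by blast
    then have "p dvd a * a'" "p dvd b" "p dvd c" by auto
    then have "is_unit p" using dvd1[of p] dvd2[of p] by (auto simp: prime_dvd_mult_iff[OF p(1)])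
    then show False using p(1) not_prime_unit by blast
  qed
  have aa: "a * a' > 0" using u by simp
  show "bqf_class (a * a', b, c) \<in> form_classes \<Delta>" by (rule form_classes_intro[OF aa d g'])
  have "lat a b \<in> Inv" "lat a' b \<in> Inv" using Inv_lat[OF m1(1,2)] Inv_lat[OF m2(1,2)] u by simp_all
  then have "cls (lat (a * a') b) = cls (lat a b) \<otimes>\<^bsub>CG\<^esub> cls (lat a' b)"
    using lat_ip_lat[OF d g] u cls_ip[of "lat a b" "lat a' b"] by simp
  then show "\<Phi> (bqf_class (a * a', b, c)) = \<Phi> F \<otimes>\<^bsub>CG\<^esub> \<Phi> F'"
    unfolding F_eq \<Phi>_eval[OF aa d g'] \<Phi>_eval[OF u(1) m1(1,2)] \<Phi>_eval[OF u(2) m2(1,2)] .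
qed

lemma form_compose_\<Phi>:
  assumes F: "F \<in> form_classes \<Delta>" and F': "F' \<in> form_classes \<Delta>"
  shows "form_compose F F' \<in> form_classes \<Delta>" "\<Phi> (form_compose F F') = \<Phi> F \<otimes>\<^bsub>CG\<^esub> \<Phi> F'"
proof -
  obtain a a' b c where u: "a > 0" "a' > 0" "(a, b, a' * c) \<in> F" "(a', b, a * c) \<in> F'"
    using united_forms_exist[OF F F'] .
  have inj: "inj_on \<Phi> (form_classes \<Delta>)" using \<Phi>_bij by (simp add: bij_betw_def)
  have "form_compose F F' = bqf_class (a * a', b, c)"
    unfolding form_compose_def
  proof (rule the_equality)
    show "\<exists>a'' a''' b' c'. a'' > 0 \<and> a''' > 0 \<and> (a'', b', a''' * c') \<in> F \<and> (a''', b', a'' * c') \<in> F' \<and>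
        bqf_class (a * a', b, c) = bqf_class (a'' * a''', b', c')" using u by blast
  next
    fix X assume "\<exists>a a' b c. a > 0 \<and> a' > 0 \<and> (a, b, a' * c) \<in> F \<and> (a', b, a * c) \<in> F' \<and> X = bqf_class (a * a', b, c)"
    then obtain d d' e h where w: "d > 0" "d' > 0" "(d, e, d' * h) \<in> F" "(d', e, d * h) \<in> F'" "X = bqf_class (d * d', e, h)"
      by blast
    show "X = bqf_class (a * a', b, c)"
      unfolding w(5) using united_forms_\<Phi>[OF F F' u] united_forms_\<Phi>[OF F F' w(1-4)] inj_onD[OF inj] by metis
  qed
  then show "form_compose F F' \<in> form_classes \<Delta>" "\<Phi> (form_compose F F') = \<Phi> F \<otimes>\<^bsub>CG\<^esub> \<Phi> F'"
    using united_forms_\<Phi>[OF F F' u] by simp_all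
qed

lemma principal_class_\<Phi>:
  "principal_class \<Delta> \<in> form_classes \<Delta>" "\<Phi> (principal_class \<Delta>) = \<one>\<^bsub>CG\<^esub>"
proof -
  have d: "(\<Delta> mod 4)\<^sup>2 - 4 * 1 * (- (\<Delta> div 4)) = \<Delta>"
  proof -
    have "(\<Delta> mod 4)\<^sup>2 = \<Delta> mod 4" using mod4 by auto
    then show ?thesis using mult_div_mod_eq[of 4 \<Delta>] by linarith
  qed
  have "lat 1 (\<Delta> mod 4) = Ord"
    using bet_eq_\<omega>[of 0] by (auto simp: lat_iff Ord_iff set_eq_iff)
  then show "principal_class \<Delta> \<in> form_classes \<Delta>" "\<Phi> (principal_class \<Delta>) = \<one>\<^bsub>CG\<^esub>"
    unfolding principal_class_def
    using form_classes_intro[OF _ d] \<Phi>_eval[OF _ d] cls_Ord by simp_all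
qed

text \<open>
  The group laws are pulled back along the injection \<open>\<Phi>\<close> into the narrow class group.
\<close>

theorem comm_group_FG: "comm_group FG"
proof -
  interpret CG: comm_group CG by (rule comm_group_CG)
  have inj: "inj_on \<Phi> (form_classes \<Delta>)" and surj: "\<Phi> ` form_classes \<Delta> = carrier CG"
    using \<Phi>_bij by (simp_all add: bij_betw_def)
  have cl: "\<Phi> F \<in> carrier CG" if "F \<in> form_classes \<Delta>" for F using surj that by blast
  note simps = form_class_group_def form_compose_\<Phi> principal_class_\<Phi>
  show ?thesis
  proof (rule comm_groupI)
    fix F F' F''
    assume "F \<in> carrier FG" "F' \<in> carrier FG" "F'' \<in> carrier FG"
    then have F: "F \<in> form_classes \<Delta>" "F' \<in> form_classes \<Delta>" "F'' \<in> form_classes \<Delta>"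
      by (simp_all add: form_class_group_def)
    show "F \<otimes>\<^bsub>FG\<^esub> F' \<in> carrier FG" using F by (simp add: simps)
    show "F \<otimes>\<^bsub>FG\<^esub> F' \<otimes>\<^bsub>FG\<^esub> F'' = F \<otimes>\<^bsub>FG\<^esub> (F' \<otimes>\<^bsub>FG\<^esub> F'')"
      by (rule inj_onD[OF inj]) (use F in \<open>simp_all add: simps CG.m_assoc cl\<close>)
    show "F \<otimes>\<^bsub>FG\<^esub> F' = F' \<otimes>\<^bsub>FG\<^esub> F"
      by (rule inj_onD[OF inj]) (use F in \<open>simp_all add: simps CG.m_comm cl\<close>)
    show "\<one>\<^bsub>FG\<^esub> \<otimes>\<^bsub>FG\<^esub> F = F"
      by (rule inj_onD[OF inj]) (use F in \<open>simp_all add: simps cl\<close>)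
    obtain E where E: "E \<in> form_classes \<Delta>" "\<Phi> E = inv\<^bsub>CG\<^esub> \<Phi> F"
      using surj CG.inv_closed[OF cl[OF F(1)]] by (metis imageE)
    have "E \<otimes>\<^bsub>FG\<^esub> F = \<one>\<^bsub>FG\<^esub>"
      by (rule inj_onD[OF inj]) (use F E in \<open>simp_all add: simps cl\<close>)
    then show "\<exists>E\<in>carrier FG. E \<otimes>\<^bsub>FG\<^esub> F = \<one>\<^bsub>FG\<^esub>" using E(1) by (auto simp: form_class_group_def)
  qed (simp add: simps)
qed

lemma \<Phi>_hom: "group_hom FG CG \<Phi>"
proof (rule group_hom.intro)
  show "group_hom_axioms FG CG \<Phi>"
    using form_compose_\<Phi> \<Phi>_bij by (auto simp: group_hom_axioms_def hom_def form_class_group_def bij_betw_def)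
qed (use comm_group_FG comm_group_CG in \<open>auto simp: comm_group_def\<close>)

lemma pm_signed_products_\<Phi>:
  assumes "set gs \<subseteq> form_classes \<Delta>"
  shows "\<one>\<^bsub>FG\<^esub> \<in> signed_products FG gs \<longleftrightarrow> \<one>\<^bsub>CG\<^esub> \<in> signed_products CG (map \<Phi> gs)"
proof -
  interpret group_hom FG CG \<Phi> by (rule \<Phi>_hom)
  interpret FG: comm_group FG by (rule comm_group_FG)
  have gs: "set gs \<subseteq> carrier FG" using assms by (simp add: form_class_group_def)
  have "inj_on \<Phi> (carrier FG)" using \<Phi>_bij by (simp add: bij_betw_def form_class_group_def)
  then have "\<Phi> \<one>\<^bsub>FG\<^esub> \<in> \<Phi> ` signed_products FG gs \<longleftrightarrow> \<one>\<^bsub>FG\<^esub> \<in> signed_products FG gs"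
    by (rule inj_on_image_mem_iff[OF _ G.one_closed FG.signed_products_closed[OF gs]])
  then show ?thesis unfolding signed_products_hom[OF gs comm_group_FG] hom_one by blast
qed

lemma ideal_to_form_class:
  assumes "X \<in> carrier CG"
  shows "ideal_to_form_class \<Delta> X \<in> form_classes \<Delta>" "\<Phi> (ideal_to_form_class \<Delta> X) = X"
  using \<Phi>_bij assms the_inv_into_into[of \<Phi> "form_classes \<Delta>" X "form_classes \<Delta>"]
    f_the_inv_into_f[of \<Phi> "form_classes \<Delta>" X]
  unfolding ideal_to_form_class_def bij_betw_def by auto

lemma principal_represents_iff:
  "class_represents (principal_class \<Delta>) n \<longleftrightarrow> (\<exists>\<alpha>\<in>Ord. \<alpha> * cj \<alpha> = of_int n)"
proof
  assume "class_represents (principal_class \<Delta>) n"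
  then obtain x y where "n = bqf_eval (1, \<Delta> mod 4, - (\<Delta> div 4)) x y"
    unfolding principal_class_def class_represents_bqf_class by blast
  then show "\<exists>\<alpha>\<in>Ord. \<alpha> * cj \<alpha> = of_int n" using norm_Ord Ord_intro by metis
next
  assume "\<exists>\<alpha>\<in>Ord. \<alpha> * cj \<alpha> = of_int n"
  then obtain x y where "(of_int n :: complex) = of_int (bqf_eval (1, \<Delta> mod 4, - (\<Delta> div 4)) x y)"
    using norm_Ord by (metis Ord_cases)
  then have "n = bqf_eval (1, \<Delta> mod 4, - (\<Delta> div 4)) x y" by (simp only: of_int_eq_iff)
  then show "class_represents (principal_class \<Delta>) n"
    unfolding principal_class_def class_represents_bqf_class by blast
qed

end


section \<open>Norms of ideals with prescribed prime factors\<close>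

context quadratic
begin

lemma scale_Ord_ip: "scale z Ord \<bullet> scale w Ord = scale (z * w) Ord"
  by (metis frac_ideal_Ord ip_Ord ip_comm ip_scale scale_scale)

lemma ip_scale_scale: "scale z I \<bullet> scale w J = scale (z * w) (I \<bullet> J)"
  by (metis ip_comm ip_scale scale_scale)

lemma cj_scale: "z \<in> K \<Longrightarrow> I \<subseteq> K \<Longrightarrow> cj ` scale z I = scale (cj z) (cj ` I)"
  unfolding scale_def by (auto simp: image_image subset_iff intro!: image_cong)

lemma ip_mono: "I \<subseteq> I' \<Longrightarrow> J \<subseteq> J' \<Longrightarrow> I \<bullet> J \<subseteq> I' \<bullet> J'"
  by (intro ip_subsetI ip_sum ip_prod) auto

lemma scale_mono: "I \<subseteq> J \<Longrightarrow> scale z I \<subseteq> scale z J"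
  unfolding scale_def by (rule image_mono)

lemma cj_cj_image: "I \<subseteq> K \<Longrightarrow> cj ` cj ` I = I"
  by (force simp: image_image subset_iff image_iff)

text \<open>
  The last condition expresses that the norm is \<open>p\<close>; it fails for the ideal \<open>(p)\<close>, whose norm is
  \<open>p\<^sup>2\<close>.
\<close>

definition prime_of_norm :: "nat \<Rightarrow> complex set \<Rightarrow> bool" where
  "prime_of_norm p P \<longleftrightarrow> p > 0 \<and> P \<in> Inv \<and> P \<subseteq> Ord \<and> of_nat p \<in> P \<and>
     (\<forall>x\<in>Ord. \<forall>y\<in>Ord. x * y \<in> P \<longrightarrow> x \<in> P \<or> y \<in> P) \<and> P \<bullet> (cj ` P) = scale (of_nat p) Ord"

lemma cls_cj:
  assumes "prime_of_norm p P"
  shows "cls (cj ` P) = inv\<^bsub>CG\<^esub> cls P"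
  using assms cls_inverse[of P "cj ` P" "of_nat p"] Inv_cj pos_of_nat unfolding prime_of_norm_def by blast

text \<open>
  The quotient of \<open>I\<close> by \<open>Q\<close> is \<open>p\<^sup>-\<^sup>1 I \<bullet> cj Q\<close>; it is integral because \<open>I\<close> is contained in \<open>Q\<close>.
\<close>

lemma cancel_prime:
  assumes I: "I \<in> Inv" "I \<subseteq> Q" "I \<bullet> (cj ` I) = scale (of_nat (p * n)) Ord"
    and Q: "Q \<in> Inv" "Q \<bullet> (cj ` Q) = scale (of_nat p) Ord" and p: "p > 0"
  obtains J where "J \<in> Inv" "J \<subseteq> Ord" "J \<bullet> (cj ` J) = scale (of_nat n) Ord" "cls I = cls Q \<otimes>\<^bsub>CG\<^esub> cls J"
proof
  interpret comm_group CG by (rule comm_group_CG)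
  define J where "J = scale (inverse (of_nat p)) (I \<bullet> (cj ` Q))"
  have IQ: "I \<bullet> (cj ` Q) \<in> Inv" by (intro Inv_ip Inv_cj I Q)
  show J: "J \<in> Inv" unfolding J_def using p by (intro Inv_scale IQ) auto
  have "I \<bullet> (cj ` Q) \<subseteq> scale (of_nat p) Ord" using ip_mono[OF I(2), of "cj ` Q" "cj ` Q"] Q(2) by simp
  then have "J \<subseteq> scale (inverse (of_nat p)) (scale (of_nat p) Ord)" unfolding J_def by (rule scale_mono)
  then show "J \<subseteq> Ord" using p by (simp add: scale_scale scale_1)
  have cJ: "cj ` J = scale (inverse (of_nat p)) ((cj ` I) \<bullet> Q)"
    unfolding J_def using Inv_K[OF IQ] Inv_K[OF I(1)] Inv_K[OF Q(1)] Inv_K[OF Inv_cj[OF Q(1)]]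
    by (subst cj_scale) (simp_all add: cj_ip cj_cj_image)
  have "(I \<bullet> (cj ` Q)) \<bullet> ((cj ` I) \<bullet> Q) = (I \<bullet> (cj ` I)) \<bullet> (Q \<bullet> (cj ` Q))"
    by (metis ip_assoc ip_comm)
  also have "\<dots> = scale (of_nat (p * n) * of_nat p) Ord" unfolding I(3) Q(2) scale_Ord_ip ..
  finally have "J \<bullet> (cj ` J) = scale (inverse (of_nat p) * inverse (of_nat p)) (scale (of_nat (p * n) * of_nat p) Ord)"
    unfolding cJ unfolding J_def ip_scale_scale by simp
  moreover have "inverse (of_nat p) * inverse (of_nat p) * (of_nat (p * n) * of_nat p) = (of_nat n :: complex)"
    using p by (simp add: field_simps)
  ultimately show "J \<bullet> (cj ` J) = scale (of_nat n) Ord" by (simp only: scale_scale)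
  have "pos (inverse (of_nat p))" by (intro pos_inverse pos_of_nat p)
  then have "cls J = cls I \<otimes>\<^bsub>CG\<^esub> cls (cj ` Q)"
    unfolding J_def using cls_scale[OF IQ] cls_ip[OF I(1) Inv_cj[OF Q(1)]] by simp
  moreover have "cls (cj ` Q) = inv\<^bsub>CG\<^esub> cls Q"
    by (rule cls_inverse[OF Q(1) Inv_cj[OF Q(1)] Q(2) pos_of_nat[OF p]])
  ultimately have "cls Q \<otimes>\<^bsub>CG\<^esub> cls J = cls Q \<otimes>\<^bsub>CG\<^esub> (inv\<^bsub>CG\<^esub> cls Q \<otimes>\<^bsub>CG\<^esub> cls I)"
    using cls_closed[OF I(1)] cls_closed[OF Q(1)] by (simp add: m_comm)
  also have "\<dots> = cls I"
    using cls_closed[OF I(1)] cls_closed[OF Q(1)] by (simp add: m_assoc[symmetric])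
  finally show "cls I = cls Q \<otimes>\<^bsub>CG\<^esub> cls J" ..
qed

text \<open>
  Since \<open>I \<bullet> cj I = (p\<^sub>1 \<dots> p\<^sub>l)\<close> is contained in the prime ideal \<open>P p\<^sub>1\<close>, one of \<open>I\<close> and \<open>cj I\<close> is.
  So \<open>P p\<^sub>1\<close> or its conjugate can be cancelled from \<open>I\<close>, and by induction \<open>I\<close> is a product of
  ideals \<open>P p\<^sub>i\<close> and conjugates of such ideals, whose classes are the inverses.
\<close>

lemma class_of_ideal_of_norm:
  assumes "\<forall>p\<in>set ps. prime_of_norm p (P p)"
    and "I \<in> Inv" "I \<subseteq> Ord" "I \<bullet> (cj ` I) = scale (of_nat (prod_list ps)) Ord"
  shows "cls I \<in> signed_products CG (map (\<lambda>p. cls (P p)) ps)"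
  using assms
proof (induction ps arbitrary: I)
  case Nil
  have fr: "frac_ideal \<Delta> I" by (rule Inv_frac[OF Nil(2)])
  have "I \<bullet> (cj ` I) \<subseteq> I"
  proof (rule ip_subsetI)
    fix x y assume "x \<in> I" "y \<in> cj ` I"
    then show "x * y \<in> I"
      using frac_idealD(3)[OF fr, of y x] Nil.prems(3) by (auto simp: mult.commute)
  qed (rule frac_idealD(2)[OF fr])
  then have "1 \<in> I" using Nil.prems(4) by (auto simp: scale_1)
  then have "Ord \<subseteq> I" using frac_idealD(3)[OF fr, of _ 1] by auto
  then have "I = Ord" using Nil.prems by blast
  then show ?case by (simp add: cls_Ord)
next
  case (Cons p ps)
  define n where "n = prod_list ps"
  let ?P = "P p"
  have P: "p > 0" "?P \<in> Inv" "?P \<subseteq> Ord" "of_nat p \<in> ?P" "?P \<bullet> (cj ` ?P) = scale (of_nat p) Ord"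
    and prime: "\<And>x y. x \<in> Ord \<Longrightarrow> y \<in> Ord \<Longrightarrow> x * y \<in> ?P \<Longrightarrow> x \<in> ?P \<or> y \<in> ?P"
    and Pn: "prime_of_norm p ?P"
    using Cons.prems(1) unfolding prime_of_norm_def by auto
  have norm: "I \<bullet> (cj ` I) = scale (of_nat (p * n)) Ord" using Cons.prems(4) unfolding n_def by simp
  have IH: "cls J \<in> signed_products CG (map (\<lambda>p. cls (P p)) ps)"
    if "J \<in> Inv" "J \<subseteq> Ord" "J \<bullet> (cj ` J) = scale (of_nat n) Ord" for J
    using Cons.IH[of J] Cons.prems(1) that unfolding n_def by simp
  have "I \<bullet> (cj ` I) \<subseteq> ?P"
  proof
    fix x assume "x \<in> I \<bullet> (cj ` I)"
    then obtain y where y: "y \<in> Ord" "x = of_nat (p * n) * y" unfolding norm scale_def by blast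
    have "(of_nat n * y) * of_nat p \<in> ?P" using frac_idealD(3)[OF Inv_frac[OF P(2)] _ P(4)] y(1) by simp
    then show "x \<in> ?P" unfolding y(2) by (simp add: ac_simps)
  qed
  then have "I \<subseteq> ?P \<or> cj ` I \<subseteq> ?P"
    using prime ip_prod[of _ I _ "cj ` I"] Cons.prems(3) Ord_cj by (smt (verit) imageE subset_iff)
  then show ?case
  proof
    assume sub: "I \<subseteq> ?P"
    obtain J where "J \<in> Inv" "J \<subseteq> Ord" "J \<bullet> (cj ` J) = scale (of_nat n) Ord" "cls I = cls ?P \<otimes>\<^bsub>CG\<^esub> cls J"
      by (rule cancel_prime[OF Cons.prems(2) sub norm P(2,5,1)])
    then show ?case using IH by auto
  next
    assume "cj ` I \<subseteq> ?P"
    then have sub: "I \<subseteq> cj ` ?P" using cj_cj_image[OF Inv_K[OF Cons.prems(2)]] by blast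
    have "(cj ` ?P) \<bullet> (cj ` cj ` ?P) = scale (of_nat p) Ord"
      unfolding cj_cj_image[OF Inv_K[OF P(2)]] using P(5) ip_comm by metis
    from cancel_prime[OF Cons.prems(2) sub norm Inv_cj[OF P(2)] this P(1)]
    obtain J where "J \<in> Inv" "J \<subseteq> Ord" "J \<bullet> (cj ` J) = scale (of_nat n) Ord"
      "cls I = cls (cj ` ?P) \<otimes>\<^bsub>CG\<^esub> cls J" .
    then show ?case using IH cls_cj[OF Pn] by auto
  qed
qed

lemma ideal_of_norm_in_class:
  assumes "\<forall>p\<in>set ps. prime_of_norm p (P p)" "X \<in> signed_products CG (map (\<lambda>p. cls (P p)) ps)"
  shows "\<exists>I\<in>Inv. I \<subseteq> Ord \<and> I \<bullet> (cj ` I) = scale (of_nat (prod_list ps)) Ord \<and> cls I = X"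
  using assms
proof (induction ps arbitrary: X)
  case Nil
  then show ?case
    using Inv_Ord by (intro bexI[of _ Ord]) (auto simp: cls_Ord cj_image_Ord scale_1 ip_Ord[OF frac_ideal_Ord])
next
  case (Cons p ps)
  let ?P = "P p"
  have P: "?P \<in> Inv" "?P \<subseteq> Ord" "?P \<bullet> (cj ` ?P) = scale (of_nat p) Ord" and Pn: "prime_of_norm p ?P"
    using Cons.prems(1) unfolding prime_of_norm_def by auto
  have P': "cj ` ?P \<in> Inv" "cj ` ?P \<subseteq> Ord" "(cj ` ?P) \<bullet> (cj ` cj ` ?P) = scale (of_nat p) Ord"
    using P Inv_cj ip_comm[of ?P] cj_cj_image[OF Inv_K[OF P(1)]] by auto
  from Cons.prems(2) obtain Y where Y: "Y \<in> signed_products CG (map (\<lambda>p. cls (P p)) ps)"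
    "X = cls ?P \<otimes>\<^bsub>CG\<^esub> Y \<or> X = inv\<^bsub>CG\<^esub> cls ?P \<otimes>\<^bsub>CG\<^esub> Y" by auto
  then obtain I where I: "I \<in> Inv" "I \<subseteq> Ord" "I \<bullet> (cj ` I) = scale (of_nat (prod_list ps)) Ord" "cls I = Y"
    using Cons.IH[of Y] Cons.prems(1) by auto
  have step: "\<exists>J\<in>Inv. J \<subseteq> Ord \<and> J \<bullet> (cj ` J) = scale (of_nat (prod_list (p # ps))) Ord \<and> cls J = cls Q \<otimes>\<^bsub>CG\<^esub> Y"
    if Q: "Q \<in> Inv" "Q \<subseteq> Ord" "Q \<bullet> (cj ` Q) = scale (of_nat p) Ord" for Q
  proof (intro bexI conjI)
    show "Q \<bullet> I \<in> Inv" by (rule Inv_ip[OF Q(1) I(1)])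
    show "Q \<bullet> I \<subseteq> Ord" using ip_mono[OF Q(2) I(2)] ip_Ord[OF frac_ideal_Ord] by simp
    have "(Q \<bullet> I) \<bullet> (cj ` (Q \<bullet> I)) = (Q \<bullet> (cj ` Q)) \<bullet> (I \<bullet> (cj ` I))"
      unfolding cj_ip[OF Inv_K[OF Q(1)] Inv_K[OF I(1)]] by (metis ip_assoc ip_comm)
    then show "(Q \<bullet> I) \<bullet> (cj ` (Q \<bullet> I)) = scale (of_nat (prod_list (p # ps))) Ord"
      unfolding Q(3) I(3) scale_Ord_ip by simp
    show "cls (Q \<bullet> I) = cls Q \<otimes>\<^bsub>CG\<^esub> Y" using cls_ip[OF Q(1) I(1)] I(4) by simp
  qed
  from Y(2) show ?case
  proof
    assume "X = cls ?P \<otimes>\<^bsub>CG\<^esub> Y" then show ?case using step[OF P] by simp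
  next
    assume "X = inv\<^bsub>CG\<^esub> cls ?P \<otimes>\<^bsub>CG\<^esub> Y" then show ?case using step[OF P'] cls_cj[OF Pn] by simp
  qed
qed

text \<open>
  If \<open>\<alpha>\<close> has norm \<open>n > 0\<close>, then \<open>\<alpha>\<close> or \<open>-\<alpha>\<close> is totally positive, so the class of \<open>(\<alpha>)\<close> is trivial, and
  it is a signed product.  Conversely, a trivial signed product is the class of an ideal of norm
  \<open>n\<close> with a totally positive generator \<open>z\<close>.  The norm of \<open>z\<close> is \<open>n\<close> times a unit of the order,
  which is rational and positive, hence \<open>1\<close>.
\<close>

lemma norm_iff_signed_product:
  assumes P: "\<forall>p\<in>set ps. prime_of_norm p (P p)"
  shows "(\<exists>\<alpha>\<in>Ord. \<alpha> * cj \<alpha> = of_nat (prod_list ps)) \<longleftrightarrow>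
    \<one>\<^bsub>CG\<^esub> \<in> signed_products CG (map (\<lambda>p. cls (P p)) ps)"
proof
  define n where "n = prod_list ps"
  have n: "n > 0" using P unfolding n_def prime_of_norm_def by (induction ps) auto
  assume "\<exists>\<alpha>\<in>Ord. \<alpha> * cj \<alpha> = of_nat (prod_list ps)"
  then obtain \<alpha> where \<alpha>: "\<alpha> \<in> Ord" "\<alpha> * cj \<alpha> = of_nat n" unfolding n_def by blast
  have \<alpha>K: "\<alpha> \<in> K" "\<alpha> \<noteq> 0" using \<alpha> n Ord_K by auto
  have "pos \<alpha> \<or> pos (- \<alpha>)" using pos_of_norm[OF \<alpha>K(1)] \<alpha>(2) n by simp
  then have "cls (scale \<alpha> Ord) = cls Ord"
    using cls_scale[OF Inv_Ord] scale_minus[OF frac_ideal_Ord] by metis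
  then have one: "cls (scale \<alpha> Ord) = \<one>\<^bsub>CG\<^esub>" by (simp add: cls_Ord)
  have "cj ` scale \<alpha> Ord = scale (cj \<alpha>) Ord"
    using cj_scale[OF \<alpha>K(1), of Ord] Ord_K cj_image_Ord by auto
  then have "scale \<alpha> Ord \<bullet> (cj ` scale \<alpha> Ord) = scale (of_nat (prod_list ps)) Ord"
    unfolding scale_Ord_ip \<alpha>(2) n_def by (simp add: scale_Ord_ip \<alpha>(2)[unfolded n_def])
  moreover have "scale \<alpha> Ord \<subseteq> Ord" using \<alpha>(1) unfolding scale_def by auto
  ultimately have "cls (scale \<alpha> Ord) \<in> signed_products CG (map (\<lambda>p. cls (P p)) ps)"
    using class_of_ideal_of_norm[OF P Inv_scale[OF Inv_Ord \<alpha>K]] by blast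
  then show "\<one>\<^bsub>CG\<^esub> \<in> signed_products CG (map (\<lambda>p. cls (P p)) ps)" unfolding one .
next
  define n where "n = prod_list ps"
  have n: "n > 0" using P unfolding n_def prime_of_norm_def by (induction ps) auto
  assume "\<one>\<^bsub>CG\<^esub> \<in> signed_products CG (map (\<lambda>p. cls (P p)) ps)"
  then obtain I where I: "I \<in> Inv" "I \<subseteq> Ord" "I \<bullet> (cj ` I) = scale (of_nat n) Ord" "cls I = \<one>\<^bsub>CG\<^esub>"
    using ideal_of_norm_in_class[OF P] unfolding n_def by blast
  then obtain z where z: "pos z" "I = scale z Ord" using cls_eq_iff[OF Inv_Ord I(1)] cls_Ord by auto
  have zK: "z \<in> K" "z \<noteq> 0" using pos_K[OF z(1)] pos_nz[OF z(1)] by auto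
  have "z * 1 \<in> I" unfolding z(2) scale_def by (rule imageI) simp
  then have zO: "z \<in> Ord" using I(2) by auto
  have "cj ` I = scale (cj z) Ord"
    using cj_scale[OF zK(1), of Ord] Ord_K cj_image_Ord unfolding z(2) by auto
  then have eq: "scale (z * cj z) Ord = scale (of_nat n) Ord" using I(3) unfolding z(2) by (simp add: scale_Ord_ip)
  have zcz: "z * cj z \<noteq> 0" "(of_nat n :: complex) \<noteq> 0" using zK n by auto
  have rat: "z * cj z \<in> \<rat>" by (rule norm_Rats[OF zK(1)])
  have "1 \<in> Ord" by simp
  then have "z * cj z * 1 \<in> scale (z * cj z) Ord" "of_nat n * 1 \<in> scale (of_nat n) Ord"
    unfolding scale_def by (blast intro: imageI)+
  then have "z * cj z \<in> scale (of_nat n) Ord" "of_nat n \<in> scale (z * cj z) Ord" using eq by simp_all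
  then have "z * cj z / of_nat n \<in> Ord" "of_nat n / (z * cj z) \<in> Ord" using zcz by (simp_all add: scale_iff)
  then have "z * cj z / of_nat n \<in> \<int>" "of_nat n / (z * cj z) \<in> \<int>" using rat by (auto intro!: Ord_Rats)
  then obtain u v where uv: "z * cj z / of_nat n = of_int u" "of_nat n / (z * cj z) = of_int v" by (auto elim!: Ints_cases)
  have "of_int (u * v) = (1 :: complex)" unfolding of_int_mult uv[symmetric] using zcz by simp
  then have "u * v = 1" by (simp only: of_int_eq_1_iff)
  moreover have zu: "z * cj z = of_int u * of_nat n" using uv(1) zcz by (simp add: field_simps)
  have "u > 0"
  proof -
    have "Re (of_int u * of_nat n) > 0" using pos_norm[OF z(1)] unfolding zu .
    then show ?thesis using n by (simp add: zero_less_mult_iff)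
  qed
  ultimately have "u = 1" by (simp add: zmult_eq_1_iff)
  then have "z * cj z = of_nat (prod_list ps)" using zu unfolding n_def by simp
  then show "\<exists>\<alpha>\<in>Ord. \<alpha> * cj \<alpha> = of_nat (prod_list ps)" using zO by blast
qed

end


section \<open>Fundamental discriminants and maximal orders\<close>

lemma disc_mod_4: "(b\<^sup>2 - 4 * a * c) mod 4 = 0 \<or> (b\<^sup>2 - 4 * a * c) mod 4 = (1 :: int)"
proof -
  have "(b\<^sup>2 - 4 * a * c) mod 4 = b\<^sup>2 mod 4" by (simp add: mod_diff_eq[symmetric] mult.assoc)
  moreover have "b\<^sup>2 mod 4 = 0 \<or> b\<^sup>2 mod 4 = 1"
  proof (cases "even b")
    case True
    then obtain t where "b = 2 * t" by blast
    then show ?thesis by (simp add: power2_eq_square)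
  next
    case False
    then obtain t where "b = 2 * t + 1" by (rule oddE)
    then have "b\<^sup>2 = 4 * (t * t + t) + 1" by (simp add: power2_eq_square algebra_simps)
    then show ?thesis by presburger
  qed
  ultimately show ?thesis by simp
qed

locale fundamental = quadratic +
  assumes fundamental: "\<Delta> = e * j\<^sup>2 \<Longrightarrow> e mod 4 = 0 \<or> e mod 4 = 1 \<Longrightarrow> \<bar>j\<bar> = 1"
begin

text \<open>
  A common divisor of the coefficients would leave a discriminant after division by its square.
\<close>

lemma lat_primitive:
  assumes "b\<^sup>2 - 4 * a * c = \<Delta>"
  shows "gcd a (gcd b c) = 1"
proof -
  define g where "g = gcd a (gcd b c)"
  obtain a1 b1 c1 where g: "a = g * a1" "b = g * b1" "c = g * c1"
    by (metis dvdE gcd_dvd1 gcd_dvd2 dvd_trans g_def)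
  have "\<Delta> = (b1\<^sup>2 - 4 * a1 * c1) * g\<^sup>2"
    unfolding assms[symmetric] g by (simp add: power2_eq_square algebra_simps)
  then have "\<bar>g\<bar> = 1" by (rule fundamental[OF _ disc_mod_4])
  then show ?thesis unfolding g_def by simp
qed

lemma Inv_if_frac_ideal: assumes "frac_ideal \<Delta> I" shows "I \<in> Inv"
proof -
  from frac_ideal_eq_scaled_lat[OF assms] obtain q a b c where
    "pos q" "a > 0" "b\<^sup>2 - 4 * a * c = \<Delta>" "I = scale q (lat a b)" .
  then show ?thesis using Inv_scale[OF Inv_lat] lat_primitive pos_K pos_nz by simp
qed

end

context quadratic
begin

lemma Ord_power: "z \<in> Ord \<Longrightarrow> z ^ k \<in> Ord"
  by (induction k) auto

lemma Ord_sum: "(\<And>i. i \<in> A \<Longrightarrow> f i \<in> Ord) \<Longrightarrow> sum f A \<in> Ord"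
  by (induction A rule: infinite_finite_induct) auto

lemma algebraic_int_Ord: assumes "z \<in> Ord" shows "algebraic_int z"
proof -
  from assms obtain x y where z: "z = of_int x + of_int y * \<omega>" by (rule Ord_cases)
  define t n where "t = 2 * x + y * (\<Delta> mod 4)" and "n = bqf_eval (1, \<Delta> mod 4, - (\<Delta> div 4)) x y"
  have "z + cj z = of_int t" unfolding z t_def by (simp add: cj_\<omega> algebra_simps)
  moreover have "z * cj z = of_int n" unfolding z n_def norm_Ord ..
  moreover have "z * z - (z + cj z) * z + z * cj z = 0" by (simp add: algebra_simps)
  ultimately have "z * z - of_int t * z + of_int n = 0" by simp
  then show ?thesis
    unfolding algebraic_int_altdef_ipoly by (intro exI[of _ "[:n, - t, 1:]"]) (simp add: map_poly_pCons algebra_simps)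
qed

text \<open>
  Let \<open>n\<close> be the degree of a monic equation of \<open>z\<close> and let \<open>N\<close> be a denominator of \<open>z\<close>.  Then \<open>N\<^sup>n\<close>
  is a denominator of the powers below the \<open>n\<close>-th, and of all others because they are integral
  combinations of these.
\<close>

lemma algebraic_int_bounded_denominator:
  assumes "z \<in> K" "algebraic_int z"
  obtains M :: nat where "M > 0" "\<And>k. of_nat M * z ^ k \<in> Ord"
proof -
  from assms(2) obtain p :: "int poly" where p: "poly (map_poly of_int p) z = 0" "lead_coeff p = 1"
    unfolding algebraic_int_altdef_ipoly by blast
  define n where "n = degree p"
  from assms(1) obtain N :: nat where N: "N > 0" "of_nat N * z \<in> Ord" by (rule K_denominator)
  have "(\<Sum>i\<le>n. of_int (coeff p i) * z ^ i) = 0"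
    using p(1) unfolding poly_altdef n_def by (simp add: coeff_map_poly degree_map_poly)
  moreover have "{..n} = insert n {..<n}" by auto
  ultimately have zn: "z ^ n = - (\<Sum>i<n. of_int (coeff p i) * z ^ i)"
    using p(2) unfolding n_def by (simp add: eq_neg_iff_add_eq_0)
  have "of_nat (N ^ n) * z ^ k \<in> Ord" for k
  proof (induction k rule: less_induct)
    case (less k)
    show ?case
    proof (cases "k < n")
      case True
      then have "N ^ n = N ^ (n - k) * N ^ k" by (simp flip: power_add)
      then have "of_nat (N ^ n) * z ^ k = of_nat (N ^ (n - k)) * (of_nat N * z) ^ k"
        by (simp add: power_mult_distrib)
      then show ?thesis using Ord_power[OF N(2)] by (simp del: of_nat_power)
    next
      case False
      then have "z ^ k = z ^ (k - n) * z ^ n" by (simp flip: power_add)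
      then have "of_nat (N ^ n) * z ^ k = - (\<Sum>i<n. of_int (coeff p i) * (of_nat (N ^ n) * z ^ (k - n + i)))"
        unfolding zn by (simp add: sum_distrib_left power_add ac_simps del: of_nat_power)
      moreover have "(\<Sum>i<n. of_int (coeff p i) * (of_nat (N ^ n) * z ^ (k - n + i))) \<in> Ord"
      proof (rule Ord_sum)
        fix i assume "i \<in> {..<n}"
        then have "of_nat (N ^ n) * z ^ (k - n + i) \<in> Ord" using False by (intro less.IH) auto
        then show "of_int (coeff p i) * (of_nat (N ^ n) * z ^ (k - n + i)) \<in> Ord" by (rule Ord_mult[OF Ord_int(1)])
      qed
      ultimately show ?thesis by simp
    qed
  qed
  with N(1) show ?thesis using that[of "N ^ n"] by simp
qed

end

context fundamental
begin

text \<open>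
  An algebraic integer \<open>z\<close> is a multiplier of the ideal of all \<open>y\<close> with \<open>y z\<^sup>k \<in> Ord\<close> for all \<open>k\<close>.
  For a fundamental discriminant every ideal is invertible, so \<open>z\<close> is in the order.
\<close>

lemma integers_of_K: "integers_of K = Ord"
proof
  show "Ord \<subseteq> integers_of K" unfolding integers_of_def using algebraic_int_Ord Ord_K by blast
  show "integers_of K \<subseteq> Ord"
  proof
    fix z assume "z \<in> integers_of K"
    then have z: "z \<in> K" "algebraic_int z" unfolding integers_of_def by auto
    obtain M :: nat where M: "M > 0" "\<And>k. of_nat M * z ^ k \<in> Ord"
      using algebraic_int_bounded_denominator[OF z] by blast
    define I where "I = {y. \<forall>k. y * z ^ k \<in> Ord}"
    have "frac_ideal \<Delta> I"
    proof (rule frac_ideal_integral)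
      show "I \<subseteq> Ord"
      proof
        fix y assume "y \<in> I"
        then have "y * z ^ 0 \<in> Ord" unfolding I_def by blast
        then show "y \<in> Ord" by simp
      qed
      show "\<exists>x\<in>I. x \<noteq> 0" using M by (intro bexI[of _ "of_nat M"]) (auto simp: I_def)
      show "x + y \<in> I" if "x \<in> I" "y \<in> I" for x y using that unfolding I_def by (simp add: distrib_right)
      show "x * y \<in> I" if "x \<in> Ord" "y \<in> I" for x y using that unfolding I_def by (simp add: mult.assoc)
    qed
    then have "I \<in> Inv" by (rule Inv_if_frac_ideal)
    moreover have "z * y \<in> I" if "y \<in> I" for y
    proof -
      have "z * y * z ^ k = y * z ^ Suc k" for k by simp
      then show ?thesis using that unfolding I_def mem_Collect_eq by metis
    qed
    ultimately show "z \<in> Ord" by (rule Inv_multiplier)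
  qed
qed

text \<open>
  A nontrivial embedding is the conjugation, and two bases of the maximal order differ by an integral
  matrix of determinant \<open>\<plusminus>1\<close>.
\<close>

lemma quad_field_disc_K: "quad_field_disc K = \<Delta>"
  unfolding quad_field_disc_def integers_of_K
proof (rule the_equality)
  have \<omega>\<delta>: "\<omega> - cj \<omega> = \<delta>" by (simp add: \<omega>_def field_simps)
  show "\<exists>u v. \<exists>\<sigma>\<in>field_embeddings K. Ord = {of_int x * u + of_int y * v | x y. True} \<and>
        (\<forall>x y. of_int x * u + of_int y * v = 0 \<longrightarrow> x = 0 \<and> y = 0) \<and> (\<exists>z\<in>K. \<sigma> z \<noteq> z) \<and>
        of_int \<Delta> = (u * \<sigma> v - v * \<sigma> u)\<^sup>2"
  proof (rule exI[of _ 1], rule exI[of _ \<omega>], rule bexI[OF _ cj_embedding], intro conjI allI impI)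
    show "Ord = {of_int x * 1 + of_int y * \<omega> | x y. True}" using Ord_iff by auto
    show "x = 0" "y = 0" if "of_int x * 1 + of_int y * \<omega> = 0" for x y
      using Ord_coords[of x y 0 0] that by auto
    show "\<exists>z\<in>K. cj z \<noteq> z" using \<delta>_nonzero by (intro bexI[of _ \<delta>]) auto
    have "(1 * cj \<omega> - \<omega> * cj 1)\<^sup>2 = (\<omega> - cj \<omega>) * (\<omega> - cj \<omega>)" by (simp add: power2_eq_square algebra_simps)
    then show "of_int \<Delta> = (1 * cj \<omega> - \<omega> * cj 1)\<^sup>2" unfolding \<omega>\<delta> \<delta>_sq by simp
  qed
next
  fix d
  assume "\<exists>u v. \<exists>\<sigma>\<in>field_embeddings K. Ord = {of_int x * u + of_int y * v | x y. True} \<and>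
        (\<forall>x y. of_int x * u + of_int y * v = 0 \<longrightarrow> x = 0 \<and> y = 0) \<and> (\<exists>z\<in>K. \<sigma> z \<noteq> z) \<and>
        of_int d = (u * \<sigma> v - v * \<sigma> u)\<^sup>2"
  then obtain u v \<sigma> where \<sigma>: "\<sigma> \<in> field_embeddings K" "\<exists>z\<in>K. \<sigma> z \<noteq> z"
    and span: "Ord = {of_int x * u + of_int y * v | x y. True}"
    and d: "of_int d = (u * \<sigma> v - v * \<sigma> u)\<^sup>2" by blast
  have \<sigma>_cj: "\<sigma> z = cj z" if "z \<in> K" for z using embedding_cases[OF \<sigma>(1)] \<sigma>(2) that by blast
  have "of_int 1 * u + of_int 0 * v \<in> Ord" "of_int 0 * u + of_int 1 * v \<in> Ord" unfolding span by blast+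
  then have uv: "u \<in> Ord" "v \<in> Ord" by simp_all
  obtain a b where u: "u = of_int a + of_int b * \<omega>" using uv(1) by (rule Ord_cases)
  obtain e f where v: "v = of_int e + of_int f * \<omega>" using uv(2) by (rule Ord_cases)
  have "1 \<in> Ord" "\<omega> \<in> Ord" by simp_all
  then obtain x y x' y' where xy: "1 = of_int x * u + of_int y * v" "\<omega> = of_int x' * u + of_int y' * v"
    unfolding span by blast
  have lin: "of_int s * u + of_int t * v = of_int (s * a + t * e) + of_int (s * b + t * f) * \<omega>" for s t
    unfolding u v by (simp add: algebra_simps)
  have c1: "of_int 1 + of_int 0 * \<omega> = of_int (x * a + y * e) + of_int (x * b + y * f) * \<omega>"
    unfolding lin[symmetric] using xy(1) by (simp only: of_int_0 of_int_1 mult_zero_left add_0_right)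
  have c2: "of_int 0 + of_int 1 * \<omega> = of_int (x' * a + y' * e) + of_int (x' * b + y' * f) * \<omega>"
    unfolding lin[symmetric] using xy(2) by (simp only: of_int_0 of_int_1 mult_1_left add_0_left)
  have eqs: "x * a + y * e = 1" "x * b + y * f = 0" "x' * a + y' * e = 0" "x' * b + y' * f = 1"
    using Ord_coords[OF c1] Ord_coords[OF c2] by auto
  have "(x * y' - y * x') * (a * f - b * e) = (x * a + y * e) * (x' * b + y' * f) - (x * b + y * f) * (x' * a + y' * e)"
    by (simp add: algebra_simps)
  then have "(x * y' - y * x') * (a * f - b * e) = 1" unfolding eqs by simp
  then have unit: "(a * f - b * e)\<^sup>2 = 1" by (metis abs_mult abs_zmult_eq_1 power2_abs power_one abs_1 mult.commute)
  have "u * \<sigma> v - v * \<sigma> u = of_int (a * f - b * e) * (cj \<omega> - \<omega>)"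
    using uv \<sigma>_cj Ord_K unfolding u v by (simp add: algebra_simps)
  also have "cj \<omega> - \<omega> = - \<delta>" by (simp add: \<omega>_def field_simps)
  finally have "u * \<sigma> v - v * \<sigma> u = of_int (a * f - b * e) * - \<delta>" .
  then have "of_int d = of_int ((a * f - b * e)\<^sup>2) * (\<delta> * \<delta>)"
    unfolding d by (simp add: power2_eq_square)
  then have "(of_int d :: complex) = of_int \<Delta>" unfolding unit \<delta>_sq by simp
  then show "d = \<Delta>" by (simp only: of_int_eq_iff)
qed

end


subsection \<open>Primes above rational primes\<close>

context quadratic
begin

lemma lat_1: assumes "b\<^sup>2 - 4 * 1 * c = \<Delta>" shows "lat 1 b = Ord"
proof
  show "lat 1 b \<subseteq> Ord" by (rule lat_sub_Ord[OF assms])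
  show "Ord \<subseteq> lat 1 b"
    using lat_Ord_mult[OF assms _ lat_gens(1)] by fastforce
qed

lemma prime_above_props:
  assumes "prime_above Ord p I" and p: "p > 0"
  shows "I \<subseteq> Ord" "frac_ideal \<Delta> I" "of_nat p \<in> I" "1 \<notin> I"
    "\<And>n. of_int n \<in> I \<longleftrightarrow> int p dvd n"
    "\<And>x y. x \<in> Ord \<Longrightarrow> y \<in> Ord \<Longrightarrow> x * y \<in> I \<Longrightarrow> x \<in> I \<or> y \<in> I"
proof -
  from assms have pr: "primeideal I (ring_on Ord)" and int: "I \<inter> \<int> = {of_int (int p * k) | k. True}"
    unfolding prime_above_def by auto
  have id: "I \<subseteq> Ord \<and> 0 \<in> I \<and> (\<forall>x\<in>I. \<forall>y\<in>I. x + y \<in> I) \<and> (\<forall>x\<in>Ord. \<forall>y\<in>I. x * y \<in> I)"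
    using primeideal.axioms(1)[OF pr] unfolding ideal_Ord_iff .
  show mem: "of_int n \<in> I \<longleftrightarrow> int p dvd n" for n
  proof -
    have "of_int n \<in> I \<longleftrightarrow> of_int n \<in> I \<inter> \<int>" by simp
    also have "\<dots> \<longleftrightarrow> (\<exists>k. n = int p * k)" unfolding int by (simp only: mem_Collect_eq of_int_eq_iff simp_thms)
    finally show ?thesis by (simp add: dvd_def)
  qed
  from mem[of "int p"] show pI: "of_nat p \<in> I" by simp
  show "I \<subseteq> Ord" using id by blast
  show "frac_ideal \<Delta> I" using id pI p by (intro frac_ideal_integral) (auto intro!: bexI[of _ "of_nat p"])
  have "Ord \<noteq> I" using primeideal.I_notcarr[OF pr] by simp
  moreover have "Ord \<subseteq> I" if "1 \<in> I" using id that by (metis mult.right_neutral subsetI)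
  ultimately show "1 \<notin> I" using id by blast
  show "x \<in> I \<or> y \<in> I" if "x \<in> Ord" "y \<in> Ord" "x * y \<in> I" for x y
    using primeideal.I_prime[OF pr, of x y] that by simp
qed

text \<open>
  In the Hermite normal form \<open>e (a, (b + \<delta>)/2)\<close> of the ideal, the smallest positive integer
  contained in it is \<open>e a\<close>.  Thus \<open>e a = p\<close>.
\<close>

lemma prime_above_cases:
  assumes p: "Factorial_Ring.prime p" and I: "prime_above Ord p I"
  shows "I = scale (of_nat p) Ord \<or> (\<exists>b c. b\<^sup>2 - 4 * int p * c = \<Delta> \<and> I = lat (int p) b)"
proof -
  have p0: "p > 0" using p prime_gt_0_nat by blast
  note props = prime_above_props[OF I p0]
  obtain e a b c where l: "e > 0" "a > 0" "b\<^sup>2 - 4 * a * c = \<Delta>" "I = scale (of_int e) (lat a b)"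
    "\<And>n. of_int n \<in> I \<longleftrightarrow> e * a dvd n" using integral_ideal_lat[OF props(2,1)] by blast
  have "int p dvd e * a" "e * a dvd int p" using props(5)[of "e * a"] l(5)[of "e * a"] l(5)[of "int p"] props(5)[of "int p"] by auto
  then have ea: "e * a = int p" using l(1,2) p0 by (metis mult_pos_pos of_nat_0_less_iff zdvd_antisym_nonneg less_imp_le)
  then have "e dvd int p" by (metis dvd_triv_left)
  then have "e = 1 \<or> e = int p" using p l(1) by (metis prime_nat_int_transfer prime_int_iff less_imp_le)
  then show ?thesis
  proof
    assume "e = 1"
    then show ?thesis using l(3,4) ea by (auto simp: scale_1)
  next
    assume "e = int p"
    then have "a = 1" using ea p0 by simp
    then show ?thesis using lat_1 l(3,4) \<open>e = int p\<close> by auto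
  qed
qed

text \<open>The quotient of the order by an inert prime: residues \<open>x + y\<omega>\<close> with \<open>0 \<le> x, y < p\<close>.\<close>

lemma card_Quot_inert:
  assumes "p > 0"
  shows "card (carrier (ring_on Ord Quot scale (of_nat p) Ord)) = p\<^sup>2"
proof -
  let ?I = "scale (of_nat p) Ord"
  define f where "f = (\<lambda>(x, y). ?I +>\<^bsub>ring_on Ord\<^esub> (of_int x + of_int y * \<omega>))"
  have coset: "?I +>\<^bsub>ring_on Ord\<^esub> z = {w + z | w. w \<in> ?I}" for z
    unfolding a_r_coset_def' by auto
  have fr: "frac_ideal \<Delta> ?I" using assms by (intro frac_ideal_scale frac_ideal_Ord) auto
  have zero: "0 \<in> ?I" unfolding scale_def by (intro image_eqI[of _ _ 0]) auto
  have minus: "- x \<in> ?I" if "x \<in> ?I" for x using frac_idealD(3)[OF fr Ord_int(1)[of "- 1"] that] by simp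
  have eq_iff: "?I +>\<^bsub>ring_on Ord\<^esub> z = ?I +>\<^bsub>ring_on Ord\<^esub> z' \<longleftrightarrow> z - z' \<in> ?I" for z z'
  proof
    assume "?I +>\<^bsub>ring_on Ord\<^esub> z = ?I +>\<^bsub>ring_on Ord\<^esub> z'"
    moreover have "0 + z \<in> ?I +>\<^bsub>ring_on Ord\<^esub> z" unfolding coset using zero by blast
    ultimately obtain w where "w \<in> ?I" "0 + z = w + z'" unfolding coset by blast
    then show "z - z' \<in> ?I" by (simp add: algebra_simps)
  next
    have sub: "{w + z | w. w \<in> ?I} \<subseteq> {w + z' | w. w \<in> ?I}" if "z - z' \<in> ?I" for z z'
    proof
      fix s assume "s \<in> {w + z | w. w \<in> ?I}"
      then obtain w where "w \<in> ?I" "s = w + z" by blast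
      then have "w + (z - z') \<in> ?I" "s = (w + (z - z')) + z'" using frac_idealD(2)[OF fr _ that] by auto
      then show "s \<in> {w + z' | w. w \<in> ?I}" by blast
    qed
    assume "z - z' \<in> ?I"
    moreover from minus[OF this] have "z' - z \<in> ?I" by simp
    ultimately show "?I +>\<^bsub>ring_on Ord\<^esub> z = ?I +>\<^bsub>ring_on Ord\<^esub> z'" unfolding coset using sub by blast
  qed
  have mem: "of_int x + of_int y * \<omega> \<in> ?I \<longleftrightarrow> int p dvd x \<and> int p dvd y" for x y
  proof
    assume "of_int x + of_int y * \<omega> \<in> ?I"
    then obtain w where w: "w \<in> Ord" "of_int x + of_int y * \<omega> = of_nat p * w" unfolding scale_def by blast
    from w(1) obtain s t where "w = of_int s + of_int t * \<omega>" by (rule Ord_cases)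
    with w(2) have "of_int x + of_int y * \<omega> = of_int (int p * s) + of_int (int p * t) * \<omega>" by (simp add: algebra_simps)
    from Ord_coords[OF this] show "int p dvd x \<and> int p dvd y" by simp
  next
    assume "int p dvd x \<and> int p dvd y"
    then obtain s t where "x = int p * s" "y = int p * t" by (auto elim!: dvdE)
    then have "of_int x + of_int y * \<omega> = of_nat p * (of_int s + of_int t * \<omega>)" by (simp add: algebra_simps)
    then show "of_int x + of_int y * \<omega> \<in> ?I" unfolding scale_def using Ord_intro by blast
  qed
  have diff: "(of_int x + of_int y * \<omega>) - (of_int x' + of_int y' * \<omega>) = of_int (x - x') + of_int (y - y') * \<omega>"
    for x y x' y' by (simp add: algebra_simps)
  let ?D = "{0..<int p} \<times> {0..<int p}"
  have "carrier (ring_on Ord Quot ?I) = f ` ?D"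
  proof
    show "f ` ?D \<subseteq> carrier (ring_on Ord Quot ?I)"
      unfolding FactRing_def A_RCOSETS_def' f_def by (auto intro: bexI[OF refl Ord_intro])
    show "carrier (ring_on Ord Quot ?I) \<subseteq> f ` ?D"
    proof
      fix C assume "C \<in> carrier (ring_on Ord Quot ?I)"
      then obtain x y where C: "C = ?I +>\<^bsub>ring_on Ord\<^esub> (of_int x + of_int y * \<omega>)"
        unfolding FactRing_def A_RCOSETS_def' by (auto simp: Ord_iff)
      have "C = f (x mod int p, y mod int p)"
        unfolding C f_def prod.case eq_iff diff mem by (simp add: mod_eq_dvd_iff[symmetric])
      moreover have "(x mod int p, y mod int p) \<in> ?D" using assms by simp
      ultimately show "C \<in> f ` ?D" by blast
    qed
  qed
  moreover have "inj_on f ?D"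
  proof (rule inj_onI)
    fix u v assume u: "u \<in> ?D" and v: "v \<in> ?D" and eq: "f u = f v"
    obtain x y x' y' where uv: "u = (x, y)" "v = (x', y')" by (metis surj_pair)
    have "int p dvd x - x' \<and> int p dvd y - y'" using eq unfolding uv f_def prod.case eq_iff diff mem .
    then have "x mod int p = x' mod int p" "y mod int p = y' mod int p" by (simp_all add: mod_eq_dvd_iff)
    then show "u = v" using u v unfolding uv by simp
  qed
  ultimately show ?thesis by (simp add: card_image power2_eq_square)
qed

text \<open>
  A prime ideal above \<open>p\<close> other than \<open>(p)\<close> is a lattice \<open>(p, (b + \<delta>)/2)\<close>.  The norm of the second
  generator is a multiple of \<open>p\<close>, although neither this generator nor its conjugate is in \<open>(p)\<close>.
  So \<open>(p)\<close> is the only prime ideal above \<open>p\<close>.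
\<close>

lemma inertia_degree_inert:
  assumes max: "integers_of K = Ord" and p: "Factorial_Ring.prime p"
    and inert: "\<And>x y. x \<in> Ord \<Longrightarrow> y \<in> Ord \<Longrightarrow> x * y \<in> scale (of_nat p) Ord \<Longrightarrow>
      x \<in> scale (of_nat p) Ord \<or> y \<in> scale (of_nat p) Ord"
  shows "inertia_degree K p = 2"
proof -
  let ?I = "scale (of_nat p) Ord"
  have p0: "p > 0" and p2: "p \<ge> 2" using p prime_gt_0_nat prime_ge_2_nat by auto
  have fr: "frac_ideal \<Delta> ?I" using p0 by (intro frac_ideal_scale frac_ideal_Ord) auto
  have sub: "?I \<subseteq> Ord" unfolding scale_def by auto
  have memI: "z \<in> ?I \<longleftrightarrow> z / of_nat p \<in> Ord" for z using p0 by (simp add: scale_iff)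
  have mem: "of_int n \<in> ?I \<longleftrightarrow> int p dvd n" for n
  proof
    assume "of_int n \<in> ?I"
    then have "of_int n / of_nat p \<in> Ord" using memI by blast
    then have "of_int n / of_nat p \<in> (\<int> :: complex set)" by (rule Ord_Rats) auto
    then obtain k where "of_int n / of_nat p = (of_int k :: complex)" by (auto elim: Ints_cases)
    then have "(of_int n :: complex) = of_int (int p * k)" using p0 by (simp add: field_simps)
    then show "int p dvd n" by (simp only: of_int_eq_iff dvd_triv_left)
  next
    assume "int p dvd n"
    then obtain k where "n = int p * k" by blast
    then show "of_int n \<in> ?I" using p0 unfolding memI by simp
  qed
  have above: "prime_above Ord p ?I"
    unfolding prime_above_def
  proof
    show "primeideal ?I (ring_on Ord)"
    proof (rule primeidealI)
      have "0 \<in> ?I" using mem[of 0] by simp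
      then show "ideal ?I (ring_on Ord)"
        unfolding ideal_Ord_iff by (intro conjI ballI sub frac_idealD(2,3)[OF fr])
      show "cring (ring_on Ord)" by (rule cring_Ord)
      have "1 \<notin> ?I" using mem[of 1] p2 by (simp add: zdvd1_eq)
      then show "carrier (ring_on Ord) \<noteq> ?I" using Ord_int by auto
      show "x \<in> ?I \<or> y \<in> ?I"
        if "x \<in> carrier (ring_on Ord)" "y \<in> carrier (ring_on Ord)" "x \<otimes>\<^bsub>ring_on Ord\<^esub> y \<in> ?I" for x y
        using that inert[of x y] by simp
    qed
    show "?I \<inter> \<int> = {of_int (int p * k) | k. True}"
    proof (intro equalityI subsetI)
      fix z :: complex assume z: "z \<in> ?I \<inter> \<int>"
      then obtain n where n: "z = of_int n" by (blast elim: Ints_cases)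
      then have "int p dvd n" using z mem[of n] by blast
      then obtain k where "n = int p * k" by blast
      then show "z \<in> {of_int (int p * k) | k. True}" using n by blast
    next
      fix z :: complex assume "z \<in> {of_int (int p * k) | k. True}"
      then obtain k where z: "z = of_int (int p * k)" by blast
      then show "z \<in> ?I \<inter> \<int>" using mem[of "int p * k"] Ints_of_int[of "int p * k"] by auto
    qed
  qed
  have unique: "I = ?I" if I: "prime_above Ord p I" for I
  proof (rule ccontr)
    assume "I \<noteq> ?I"
    then obtain b c where b: "b\<^sup>2 - 4 * int p * c = \<Delta>" "I = lat (int p) b"
      using prime_above_cases[OF p I] by blast
    have bO: "bet b \<in> Ord" "cj (bet b) \<in> Ord" using bet_Ord[OF b(1)] by auto
    have "bet b * cj (bet b) \<in> ?I" unfolding bet_norm[OF b(1)] mem by simp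
    then have "bet b \<in> ?I \<or> cj (bet b) \<in> ?I" using inert bO by blast
    then have "bet b \<in> ?I"
    proof
      assume "cj (bet b) \<in> ?I"
      then have "cj (cj (bet b) / of_nat p) \<in> Ord" unfolding memI by (rule Ord_cj)
      then show ?thesis unfolding memI by simp
    qed
    then obtain w where w: "w \<in> Ord" "bet b = of_nat p * w" unfolding scale_def by blast
    from w(1) obtain s t where "w = of_int s + of_int t * \<omega>" by (rule Ord_cases)
    with w(2) have st: "bet b = of_nat p * (of_int s + of_int t * \<omega>)" by simp
    from disc_parity[OF b(1)] obtain h where h: "b = 2 * h + \<Delta> mod 4" by (metis dvdE diff_eq_eq)
    have "of_int h + of_int 1 * \<omega> = of_int (int p * s) + of_int (int p * t) * \<omega>"
      using st unfolding h bet_eq_\<omega> by (simp add: algebra_simps)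
    from Ord_coords(2)[OF this] have "int p dvd 1" by (metis dvd_triv_left)
    then show False using p2 by simp
  qed
  show ?thesis
    unfolding inertia_degree_def max
  proof (rule the_equality)
    show "\<exists>I. prime_above Ord p I \<and> card (carrier (ring_on Ord Quot I)) = p ^ 2"
      using above card_Quot_inert[OF p0] by blast
    fix f assume "\<exists>I. prime_above Ord p I \<and> card (carrier (ring_on Ord Quot I)) = p ^ f"
    then have "p ^ f = p\<^sup>2" using unique card_Quot_inert[OF p0] by metis
    then show "f = 2" using p2 power_inject_exp[of p f 2] by simp
  qed
qed

end


subsection \<open>Orders of conductor prime to \<open>p\<close>\<close>

lemma int_le_square: "int k \<le> (int k)\<^sup>2"
  using le_square[of k] by (simp add: power2_eq_square flip: of_nat_mult)

text \<open>
  Split off the largest square that leaves a discriminant.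
\<close>

lemma fundamental_decomposition:
  assumes "quadratic \<Delta>"
  obtains d k where "\<Delta> = d * (int k)\<^sup>2" "k > 0" "fundamental d"
proof -
  interpret quadratic \<Delta> by fact
  define S where "S = {k :: nat. \<exists>e. \<Delta> = e * (int k)\<^sup>2 \<and> (e mod 4 = 0 \<or> e mod 4 = 1)}"
  have "k \<le> nat \<bar>\<Delta>\<bar>" if kS: "k \<in> S" for k
  proof -
    from kS obtain e where e: "\<Delta> = e * (int k)\<^sup>2" unfolding S_def by blast
    then have "e \<noteq> 0" using \<Delta>_nonzero by auto
    then have "1 \<le> \<bar>e\<bar>" by linarith
    then have "1 * (int k)\<^sup>2 \<le> \<bar>e\<bar> * \<bar>(int k)\<^sup>2\<bar>" by (intro mult_mono) auto
    then have "(int k)\<^sup>2 \<le> \<bar>\<Delta>\<bar>" unfolding e abs_mult by simp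
    moreover have "int k \<le> (int k)\<^sup>2" by (rule int_le_square)
    ultimately show ?thesis by linarith
  qed
  then have "S \<subseteq> {..nat \<bar>\<Delta>\<bar>}" by auto
  then have fin: "finite S" using finite_subset by blast
  have "\<Delta> = \<Delta> * (int 1)\<^sup>2 \<and> (\<Delta> mod 4 = 0 \<or> \<Delta> mod 4 = 1)"
    by (rule conjI[OF _ mod4]) (simp only: of_nat_1 power_one mult_1_right)
  then have "1 \<in> S" unfolding S_def mem_Collect_eq by (rule exI)
  then have ne: "S \<noteq> {}" by blast
  define k where "k = Max S"
  have "k \<in> S" unfolding k_def using fin ne by (rule Max_in)
  then have "\<exists>d. \<Delta> = d * (int k)\<^sup>2 \<and> (d mod 4 = 0 \<or> d mod 4 = 1)" unfolding S_def mem_Collect_eq .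
  then obtain d where d: "\<Delta> = d * (int k)\<^sup>2" "d mod 4 = 0 \<or> d mod 4 = 1" by (elim exE conjE) (rule that)
  have k0: "k > 0"
  proof (rule Nat.gr0I)
    assume "k = 0"
    then show False using d(1) \<Delta>_nonzero by simp
  qed
  have "fundamental d"
  proof
    show "\<nexists>j. d = j\<^sup>2"
    proof
      assume "\<exists>j. d = j\<^sup>2"
      then obtain j where "d = j\<^sup>2" by blast
      then have "\<Delta> = (j * int k)\<^sup>2" unfolding d(1) by (simp add: power_mult_distrib)
      then show False using nonsquare by blast
    qed
    show "d mod 4 = 0 \<or> d mod 4 = 1" by (rule d(2))
    fix e j assume e: "d = e * j\<^sup>2" "e mod 4 = 0 \<or> e mod 4 = 1"
    have "\<Delta> = e * (int (nat \<bar>j\<bar> * k))\<^sup>2" unfolding d(1) e(1) by (simp add: power_mult_distrib)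
    with e(2) have "\<Delta> = e * (int (nat \<bar>j\<bar> * k))\<^sup>2 \<and> (e mod 4 = 0 \<or> e mod 4 = 1)" by (rule conjI[rotated])
    then have "nat \<bar>j\<bar> * k \<in> S" unfolding S_def mem_Collect_eq by (rule exI)
    then have "nat \<bar>j\<bar> * k \<le> k" unfolding k_def using fin by (intro Max_ge)
    then have "nat \<bar>j\<bar> \<le> 1" using k0 by simp
    moreover have "j \<noteq> 0"
    proof
      assume "j = 0"
      then show False using d(1) e(1) \<Delta>_nonzero by simp
    qed
    ultimately show "\<bar>j\<bar> = 1" by linarith
  qed
  then show ?thesis using that d(1) k0 by blast
qed

lemma csqrt_mult_square:
  assumes "m > 0" shows "csqrt (of_int (d * (int m)\<^sup>2)) = of_nat m * csqrt (of_int d)"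
proof (rule csqrt_unique)
  show "(of_nat m * csqrt (of_int d))\<^sup>2 = of_int (d * (int m)\<^sup>2)" by (simp add: power_mult_distrib)
  have "0 < Re (of_nat m * w) \<or> Re (of_nat m * w) = 0 \<and> 0 \<le> Im (of_nat m * w)"
    if "0 < Re w \<or> Re w = 0 \<and> 0 \<le> Im w" for w
    using that assms by auto
  from this[OF csqrt_principal] show "0 < Re (of_nat m * csqrt (of_int d)) \<or>
      Re (of_nat m * csqrt (of_int d)) = 0 \<and> 0 \<le> Im (of_nat m * csqrt (of_int d))" .
qed

lemma quad_field_mult_square:
  assumes "m > 0" shows "quad_field (d * (int m)\<^sup>2) = quad_field d"
proof -
  let ?s = "csqrt (of_int d)"
  show ?thesis
    unfolding quad_field_def csqrt_mult_square[OF assms]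
  proof (intro equalityI subsetI)
    fix z assume "z \<in> {x + y * (of_nat m * ?s) | x y. x \<in> \<rat> \<and> y \<in> \<rat>}"
    then obtain x y where "x \<in> \<rat>" "y \<in> \<rat>" "z = x + y * (of_nat m * ?s)" by blast
    then have "x \<in> \<rat>" "y * of_nat m \<in> \<rat>" "z = x + (y * of_nat m) * ?s" by (simp_all add: mult.assoc)
    then show "z \<in> {x + y * ?s | x y. x \<in> \<rat> \<and> y \<in> \<rat>}" by blast
  next
    fix z assume "z \<in> {x + y * ?s | x y. x \<in> \<rat> \<and> y \<in> \<rat>}"
    then obtain x y where "x \<in> \<rat>" "y \<in> \<rat>" "z = x + y * ?s" by blast
    then have "x \<in> \<rat>" "y / of_nat m \<in> \<rat>" "z = x + (y / of_nat m) * (of_nat m * ?s)" using assms by simp_all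
    then show "z \<in> {x + y * (of_nat m * ?s) | x y. x \<in> \<rat> \<and> y \<in> \<rat>}" by blast
  qed
qed

text \<open>
  Multiplication by the conductor maps the maximal order into the given one, and it is invertible
  modulo a prime that does not divide the conductor.  At such primes the two orders behave alike.
\<close>

locale order_in_maximal = A: quadratic \<Delta> + R: fundamental d for \<Delta> d :: int +
  fixes m :: nat
  assumes conductor: "\<Delta> = d * (int m)\<^sup>2"
begin

lemma m_pos: "m > 0"
proof (rule Nat.gr0I)
  assume "m = 0"
  then show False using conductor A.\<Delta>_nonzero by simp
qed

lemma field_eq: "quad_field \<Delta> = quad_field d"
  unfolding conductor by (rule quad_field_mult_square[OF m_pos])

lemma \<omega>_conv: obtains h where "A.\<omega> = of_nat m * R.\<omega> + of_int h"
proof -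
  have "csqrt (of_int \<Delta>) = of_nat m * csqrt (of_int d)"
    unfolding conductor by (rule csqrt_mult_square[OF m_pos])
  then have \<delta>: "A.\<delta> = of_nat m * R.\<delta>" unfolding A.\<delta>_def R.\<delta>_def .
  have "even (\<Delta> mod 4 - int m * (d mod 4))"
  proof -
    have "even (\<Delta> mod 4) \<longleftrightarrow> even \<Delta>" "even (d mod 4) \<longleftrightarrow> even d" by presburger+
    moreover have "even \<Delta> \<longleftrightarrow> even d \<or> even m" by (subst conductor) simp
    ultimately show ?thesis by auto
  qed
  then obtain h where h: "\<Delta> mod 4 - int m * (d mod 4) = 2 * h" by blast
  then have s: "\<Delta> mod 4 = int m * (d mod 4) + 2 * h" by simp
  have "A.\<omega> = of_nat m * R.\<omega> + of_int h"
    unfolding A.\<omega>_def R.\<omega>_def \<delta> s by (simp add: field_simps)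
  then show ?thesis by (rule that)
qed

lemma order_sub: "quad_order \<Delta> \<subseteq> quad_order d"
proof
  fix z assume "z \<in> quad_order \<Delta>"
  then obtain x y where z: "z = of_int x + of_int y * A.\<omega>" by (rule A.Ord_cases)
  obtain h where "A.\<omega> = of_nat m * R.\<omega> + of_int h" by (rule \<omega>_conv)
  then show "z \<in> quad_order d" unfolding z by auto
qed

lemma conductor_mult: assumes "z \<in> quad_order d" shows "of_nat m * z \<in> quad_order \<Delta>"
proof -
  from assms obtain x y where z: "z = of_int x + of_int y * R.\<omega>" by (rule R.Ord_cases)
  obtain h where h: "A.\<omega> = of_nat m * R.\<omega> + of_int h" by (rule \<omega>_conv)
  have "of_nat m * z = of_int (int m * x - y * h) + of_int y * A.\<omega>"
    unfolding z h by (simp add: algebra_simps)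
  then show ?thesis by (simp only: A.Ord_intro)
qed

lemma inert_in_maximal_order:
  assumes p: "Factorial_Ring.prime p" "\<not> p dvd m"
    and inert: "\<And>x y. x \<in> quad_order \<Delta> \<Longrightarrow> y \<in> quad_order \<Delta> \<Longrightarrow>
      x * y \<in> A.scale (of_nat p) (quad_order \<Delta>) \<Longrightarrow>
      x \<in> A.scale (of_nat p) (quad_order \<Delta>) \<or> y \<in> A.scale (of_nat p) (quad_order \<Delta>)"
    and xy: "x \<in> quad_order d" "y \<in> quad_order d" "x * y \<in> A.scale (of_nat p) (quad_order d)"
  shows "x \<in> A.scale (of_nat p) (quad_order d) \<or> y \<in> A.scale (of_nat p) (quad_order d)"
proof -
  have p0: "(of_nat p :: complex) \<noteq> 0" using p(1) by auto
  have "coprime (int m) (int p)" using prime_imp_coprime[OF p] by (simp add: coprime_commute)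
  then obtain u v where uv: "u * int m + v * int p = 1" using bezout_int[of "int m" "int p"] by auto
  have descend: "z \<in> A.scale (of_nat p) (quad_order d)"
    if z: "z \<in> quad_order d" "of_nat m * z \<in> A.scale (of_nat p) (quad_order \<Delta>)" for z
  proof -
    have "of_nat m * z / of_nat p \<in> quad_order d" using z(2) order_sub A.scale_iff[OF p0] by blast
    then have "of_int u * (of_nat m * z / of_nat p) + of_int v * z \<in> quad_order d"
      using z(1) by (intro R.Ord_add R.Ord_mult[OF R.Ord_int(1)])
    also have "of_int u * (of_nat m * z / of_nat p) + of_int v * z = of_int (u * int m + v * int p) * z / of_nat p"
      using p0 by (simp add: field_simps)
    finally show ?thesis unfolding uv A.scale_iff[OF p0] by simp
  qed
  have "x * y / of_nat p \<in> quad_order d" using xy(3) A.scale_iff[OF p0] by blast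
  then have "of_nat m * (x * y / of_nat p) \<in> quad_order \<Delta>" by (rule conductor_mult)
  then have "of_nat m * (of_nat m * (x * y / of_nat p)) \<in> quad_order \<Delta>"
    by (rule A.Ord_mult[OF A.Ord_int(2)])
  then have "(of_nat m * x) * (of_nat m * y) \<in> A.scale (of_nat p) (quad_order \<Delta>)"
    unfolding A.scale_iff[OF p0] by (simp add: ac_simps)
  then show ?thesis using inert[OF conductor_mult[OF xy(1)] conductor_mult[OF xy(2)]] descend xy(1,2) by blast
qed

text \<open>If \<open>p\<close> divided all coefficients, \<open>d\<close> could be divided by \<open>p\<^sup>2\<close>.\<close>

lemma form_primitive_at:
  assumes p: "Factorial_Ring.prime p" "\<not> p dvd m" and b: "b\<^sup>2 - 4 * int p * c = \<Delta>"
  shows "gcd (int p) (gcd b c) = 1"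
proof (rule ccontr)
  have pp: "Factorial_Ring.prime (int p)" using p(1) by simp
  assume "gcd (int p) (gcd b c) \<noteq> 1"
  then have "int p dvd gcd b c" using pp by (metis coprime_iff_gcd_eq_1 prime_imp_coprime)
  then obtain b1 c1 where bc: "b = int p * b1" "c = int p * c1" by (auto elim!: dvdE)
  define e where "e = b1\<^sup>2 - 4 * 1 * c1"
  have e4: "e mod 4 = 0 \<or> e mod 4 = 1" unfolding e_def by (rule disc_mod_4)
  have eq: "d * (int m)\<^sup>2 = (int p)\<^sup>2 * e"
    unfolding conductor[symmetric] b[symmetric] bc e_def by (simp add: power2_eq_square algebra_simps)
  have "coprime ((int p)\<^sup>2) ((int m)\<^sup>2)" using p by (simp add: prime_imp_coprime)
  moreover have "(int p)\<^sup>2 dvd d * (int m)\<^sup>2" unfolding eq by simp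
  ultimately have "(int p)\<^sup>2 dvd d" by (simp add: coprime_dvd_mult_left_iff)
  then obtain d1 where d1: "d = (int p)\<^sup>2 * d1" by blast
  have p0: "p > 0" using p(1) prime_gt_0_nat by blast
  then have e_eq: "d1 * (int m)\<^sup>2 = e" using eq unfolding d1 by simp
  \<comment> \<open>One of \<open>m\<close> and \<open>p\<close> is odd, and odd squares are \<open>1\<close> modulo \<open>4\<close>.\<close>
  have odd_sq: "d1 * n\<^sup>2 mod 4 = d1 mod 4" if "odd n" for n :: int
  proof -
    from that obtain t where "n = 2 * t + 1" by (rule oddE)
    then have "d1 * n\<^sup>2 = d1 + 4 * (d1 * (t * t + t))" by (simp add: power2_eq_square algebra_simps)
    then show ?thesis by simp
  qed
  have "d1 mod 4 = 0 \<or> d1 mod 4 = 1"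
  proof (cases "odd m")
    case True
    then show ?thesis using odd_sq[of "int m"] e4 unfolding e_eq by simp
  next
    case False
    then have "odd p" using p by (metis primes_dvd_imp_eq two_is_prime_nat)
    then show ?thesis using odd_sq[of "int p"] R.mod4 unfolding d1 by (simp add: mult.commute)
  qed
  then have "\<bar>int p\<bar> = 1" using R.fundamental[of d1 "int p"] d1 by (simp add: mult.commute)
  then show False using p(1) by simp
qed

text \<open>
  If \<open>P\<close> were \<open>(p)\<close>, then \<open>p\<close> would generate a prime ideal of the maximal order as well and have inertia
  degree 2.  So \<open>P\<close> is the lattice of a form with leading coefficient \<open>p\<close>, which is primitive.
\<close>

theorem degree_one_prime_of_norm:
  assumes p: "Factorial_Ring.prime p" "\<not> p dvd m" "inertia_degree (quad_field \<Delta>) p = 1"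
    and P: "prime_above (quad_order \<Delta>) p P"
  shows "A.prime_of_norm p P"
proof -
  have p0: "p > 0" using p(1) prime_gt_0_nat by blast
  note props = A.prime_above_props[OF P p0]
  have "P \<noteq> A.scale (of_nat p) (quad_order \<Delta>)"
  proof
    assume "P = A.scale (of_nat p) (quad_order \<Delta>)"
    then have "inertia_degree (quad_field d) p = 2"
      using R.inertia_degree_inert[OF R.integers_of_K p(1)] inert_in_maximal_order[OF p(1,2)] props(6) by blast
    then show False using p(3) unfolding field_eq by simp
  qed
  then obtain b c where b: "b\<^sup>2 - 4 * int p * c = \<Delta>" "P = quadratic.lat \<Delta> (int p) b"
    using A.prime_above_cases[OF p(1) P] by blast
  have g: "gcd (int p) (gcd b c) = 1" by (rule form_primitive_at[OF p(1,2) b(1)])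
  show ?thesis
    unfolding A.prime_of_norm_def
    using props p0 A.Inv_lat[OF b(1) g] A.lat_ip_cj[OF b(1) g] b(2) by auto
qed

end

lemma order_in_maximal_if_disc:
  assumes "quadratic \<Delta>" and \<Delta>: "\<Delta> = quad_field_disc (quad_field \<Delta>) * (int m)\<^sup>2"
  shows "order_in_maximal \<Delta> (quad_field_disc (quad_field \<Delta>)) m"
proof -
  obtain d k where d: "\<Delta> = d * (int k)\<^sup>2" "k > 0" "fundamental d"
    using fundamental_decomposition[OF assms(1)] .
  have "quad_field_disc (quad_field \<Delta>) = d"
    using fundamental.quad_field_disc_K[OF d(3)] quad_field_mult_square[OF d(2)] d(1) by simp
  then show ?thesis using assms d(3) by (simp add: order_in_maximal_def order_in_maximal_axioms_def)
qed


section \<open>Represented numbers and plus-minus zero-sum sequences\<close>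

lemma theta_deg1_eq:
  assumes "prime_factors n \<subseteq> primes_away_deg1 \<Delta> m"
  shows "theta_deg1 \<Delta> m P n = image_mset (prime_form_class \<Delta> P) (prime_factorization n)"
proof -
  let ?F = "prime_form_class \<Delta> P"
  have "primes_away_deg1 \<Delta> m \<inter> prime_factors n = prime_factors n" using assms by blast
  then have "theta_deg1 \<Delta> m P n = (\<Sum>p\<in>prime_factors n. replicate_mset (count (prime_factorization n) p) (?F p))"
    unfolding theta_deg1_def by (intro sum.cong) (auto simp: count_prime_factorization_prime in_prime_factors_imp_prime)
  also have "\<dots> = image_mset ?F (\<Sum>p\<in>prime_factors n. replicate_mset (count (prime_factorization n) p) p)"
  proof -
    have "image_mset ?F (sum g A) = (\<Sum>x\<in>A. image_mset ?F (g x))" for g and A :: "nat set"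
      by (induction A rule: infinite_finite_induct) auto
    then show ?thesis by simp
  qed
  also have "(\<Sum>p\<in>prime_factors n. replicate_mset (count (prime_factorization n) p) p) = prime_factorization n"
    by (rule multiset_eqI) (auto simp: count_sum count_replicate_mset if_distrib sum.delta not_in_iff cong: if_cong)
  finally show ?thesis .
qed

theorem corollary3p6:
  fixes \<Delta> :: int and m :: nat and P :: "nat \<Rightarrow> complex set"
  assumes "\<nexists>k. \<Delta> = k\<^sup>2"
    and "\<Delta> mod 4 = 0 \<or> \<Delta> mod 4 = 1"
    and "\<Delta> = quad_field_disc (quad_field \<Delta>) * (int m)\<^sup>2"
    and "\<forall>p\<in>primes_away m. prime_above (quad_order \<Delta>) p (P p)"
    and "carrier (narrow_class_group \<Delta>) = {narrow_class \<Delta> (P p) | p. p \<in> primes_away_deg1 \<Delta> m}"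
  shows "(\<forall>n\<in>represented_deg1 \<Delta> m.
            n \<in> represented_principal_deg1 \<Delta> m \<longleftrightarrow>
            theta_deg1 \<Delta> m P n \<in> pm_zero_sum (form_class_group \<Delta>)) \<and>
         transfer_hom
           (nat_mult_monoid (represented_principal_deg1 \<Delta> m))
           (mset_monoid (pm_zero_sum (form_class_group \<Delta>)))
           (theta_deg1 \<Delta> m P) \<and>
         fibre_catenary
           (nat_mult_monoid (represented_principal_deg1 \<Delta> m))
           (mset_monoid (pm_zero_sum (form_class_group \<Delta>)))
           (theta_deg1 \<Delta> m P) \<le> 2"
proof -
  have quad: "quadratic \<Delta>" by (rule quadratic.intro[OF assms(1,2)])
  interpret order_in_maximal \<Delta> "quad_field_disc (quad_field \<Delta>)" m
    by (rule order_in_maximal_if_disc[OF quad assms(3)])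
  interpret FG: comm_group "form_class_group \<Delta>" by (rule A.comm_group_FG)
  let ?Q = "primes_away_deg1 \<Delta> m" and ?F = "prime_form_class \<Delta> P"
  let ?B = "pm_zero_sum (form_class_group \<Delta>)"
  let ?H = "represented_principal_deg1 \<Delta> m"
  have Q: "Factorial_Ring.prime p" "\<not> p dvd m" "inertia_degree (quad_field \<Delta>) p = 1"
    "prime_above (quad_order \<Delta>) p (P p)" if "p \<in> ?Q" for p
    using that assms(4) unfolding primes_away_deg1_def primes_away_def by auto
  have norm: "A.prime_of_norm p (P p)" if "p \<in> ?Q" for p
    by (rule degree_one_prime_of_norm[OF Q[OF that]])
  have F: "?F p \<in> form_classes \<Delta>" "form_to_ideal_class \<Delta> (?F p) = narrow_class \<Delta> (P p)" if "p \<in> ?Q" for p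
    using that assms(5) A.ideal_to_form_class[of "narrow_class \<Delta> (P p)"]
    unfolding prime_form_class_def by blast+
  \<comment> \<open>By the choice of the \<open>P p\<close>, every class is the label of a prime.\<close>
  have F_surj: "form_classes \<Delta> \<subseteq> ?F ` ?Q"
  proof
    fix X assume X: "X \<in> form_classes \<Delta>"
    then have "form_to_ideal_class \<Delta> X \<in> carrier (narrow_class_group \<Delta>)"
      using A.\<Phi>_bij by (auto simp: bij_betw_def)
    then obtain p where p: "p \<in> ?Q" "form_to_ideal_class \<Delta> X = narrow_class \<Delta> (P p)"
      unfolding assms(5) by blast
    then have "X = ?F p"
      using F[OF p(1)] X A.\<Phi>_bij unfolding bij_betw_def by (metis inj_onD)
    then show "X \<in> ?F ` ?Q" using p(1) by blast
  qed
  \<comment> \<open>The criterion for norms of the order, transported to forms along the isomorphism \<open>\<Phi>\<close>.\<close>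
  have principal_list: "class_represents (principal_class \<Delta>) (int (prod_list ps)) \<longleftrightarrow>
      \<one>\<^bsub>form_class_group \<Delta>\<^esub> \<in> signed_products (form_class_group \<Delta>) (map ?F ps)"
    if ps: "set ps \<subseteq> ?Q" for ps
  proof -
    have "class_represents (principal_class \<Delta>) (int (prod_list ps)) \<longleftrightarrow>
        (\<exists>\<alpha>\<in>quad_order \<Delta>. \<alpha> * A.cj \<alpha> = of_nat (prod_list ps))"
      unfolding A.principal_represents_iff by (simp only: of_int_of_nat_eq)
    also have "\<dots> \<longleftrightarrow> \<one>\<^bsub>narrow_class_group \<Delta>\<^esub> \<in>
        signed_products (narrow_class_group \<Delta>) (map (\<lambda>p. narrow_class \<Delta> (P p)) ps)"
      using ps norm by (intro A.norm_iff_signed_product) blast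
    also have "map (\<lambda>p. narrow_class \<Delta> (P p)) ps = map (form_to_ideal_class \<Delta>) (map ?F ps)"
      using ps F(2) by auto
    also have "\<one>\<^bsub>narrow_class_group \<Delta>\<^esub> \<in> signed_products (narrow_class_group \<Delta>) \<dots> \<longleftrightarrow>
        \<one>\<^bsub>form_class_group \<Delta>\<^esub> \<in> signed_products (form_class_group \<Delta>) (map ?F ps)"
      using ps F(1) by (intro A.pm_signed_products_\<Phi>[symmetric]) auto
    finally show ?thesis .
  qed
  have principal: "class_represents (principal_class \<Delta>) (int n) \<longleftrightarrow> image_mset ?F (prime_factorization n) \<in> ?B"
    if n: "n > 0" "prime_factors n \<subseteq> ?Q" for n
  proof -
    have prod: "prod_list ps = n" "set ps \<subseteq> ?Q" if "mset ps = prime_factorization n" for ps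
    proof -
      have "prod_list ps = prod_mset (mset ps)" by (simp add: prod_mset_prod_list)
      then show "prod_list ps = n" unfolding that using n(1) by (simp add: prod_mset_prime_factorization_nat)
      show "set ps \<subseteq> ?Q" using n(2) unfolding that[symmetric] by simp
    qed
    show ?thesis
    proof
      assume rep: "class_represents (principal_class \<Delta>) (int n)"
      obtain ps where ps: "mset ps = prime_factorization n" using ex_mset by blast
      have "\<one>\<^bsub>form_class_group \<Delta>\<^esub> \<in> signed_products (form_class_group \<Delta>) (map ?F ps)"
        using principal_list[OF prod(2)[OF ps]] rep prod(1)[OF ps] by simp
      moreover have "set (map ?F ps) \<subseteq> carrier (form_class_group \<Delta>)"
        using prod(2)[OF ps] F(1) by (auto simp: form_class_group_def)
      ultimately show "image_mset ?F (prime_factorization n) \<in> ?B"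
        unfolding FG.pm_zero_sum_iff ps[symmetric] by (metis mset_map)
    next
      assume "image_mset ?F (prime_factorization n) \<in> ?B"
      then obtain gs where gs: "image_mset ?F (prime_factorization n) = mset gs"
        "\<one>\<^bsub>form_class_group \<Delta>\<^esub> \<in> signed_products (form_class_group \<Delta>) gs"
        unfolding FG.pm_zero_sum_iff by blast
      obtain ps where ps: "mset ps = prime_factorization n" "map ?F ps = gs"
        by (rule image_mset_eq_mset_obtain_list[OF gs(1)])
      then show "class_represents (principal_class \<Delta>) (int n)"
        using principal_list[OF prod(2)[OF ps(1)]] gs(2) prod(1)[OF ps(1)] by simp
    qed
  qed
  have deg1_iff: "n \<in> naturals_away_deg1 \<Delta> m \<longleftrightarrow> n > 0 \<and> prime_factors n \<subseteq> ?Q" for n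
    unfolding naturals_away_deg1_def by (auto simp: in_prime_factors_iff)
  have away: "n \<in> naturals_away m" if n: "n > 0" "prime_factors n \<subseteq> ?Q" for n
  proof -
    have "coprime n m"
    proof (rule ccontr)
      assume "\<not> coprime n m"
      then obtain c where c: "c dvd n" "c dvd m" "c \<noteq> 1" by (auto elim: not_coprimeE)
      then obtain p where "Factorial_Ring.prime p" "p dvd c" using prime_factor_nat by blast
      then have "Factorial_Ring.prime p" "p dvd n" "p dvd m" using c dvd_trans by blast+
      then show False using n Q(2)[of p] by (auto simp: in_prime_factors_iff)
    qed
    then show ?thesis using n(1) unfolding naturals_away_def by simp
  qed
  \<comment> \<open>The represented numbers form the full preimage of the zero-sum sequences.\<close>
  have H_iff: "n \<in> ?H \<longleftrightarrow> n > 0 \<and> prime_factors n \<subseteq> ?Q \<and> image_mset ?F (prime_factorization n) \<in> ?B" for n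
  proof -
    have "n \<in> ?H \<longleftrightarrow> n \<in> naturals_away m \<and> class_represents (principal_class \<Delta>) (int n) \<and>
        n > 0 \<and> prime_factors n \<subseteq> ?Q"
      unfolding represented_principal_deg1_def represented_principal_def represented_def
      using A.principal_class_\<Phi>(1) by (auto simp: deg1_iff)
    then show ?thesis using principal away by blast
  qed
  have theta: "theta_deg1 \<Delta> m P n = image_mset ?F (prime_factorization n)"
    if "prime_factors n \<subseteq> ?Q" for n using that by (rule theta_deg1_eq)
  interpret labelled_primes ?Q ?F ?B ?H "theta_deg1 \<Delta> m P"
  proof
    show "set_mset M \<subseteq> ?F ` ?Q" if M: "M \<in> ?B" for M
    proof -
      from M obtain gs where gs: "M = mset gs" "set gs \<subseteq> carrier (form_class_group \<Delta>)"
        unfolding FG.pm_zero_sum_iff by blast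
      then have "set gs \<subseteq> form_classes \<Delta>" by (simp add: form_class_group_def)
      then show ?thesis using F_surj gs(1) by auto
    qed
  qed (use Q(1) FG.pm_zero_sum_empty FG.pm_zero_sum_add H_iff theta in auto)
  show ?thesis
  proof (intro conjI ballI)
    fix n assume "n \<in> represented_deg1 \<Delta> m"
    then have "n > 0" "prime_factors n \<subseteq> ?Q" unfolding represented_deg1_def by (auto simp: deg1_iff)
    then show "n \<in> ?H \<longleftrightarrow> theta_deg1 \<Delta> m P n \<in> ?B" using H_iff theta by simp
  qed (rule transfer_hom_\<theta> fibre_catenary_le_2)+
qed

end
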